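(* Let $G_0$ be a $d$-regular graph on $n(G_0)$ vertices, and for each nonnegative integer $p$ let $G_0(p)=G_0\cup pK_{d+1}$. Assume that for each positive integer $p$ the graph $\overline{G_0(p)}$ is the only (up to isomorphism) trace-minimal graph in its class $\mathcal{R}(\overline{G_0(p)})$. Then there exists a positive integer $n_0$ such that, for each positive integer $p$ with $n(G_0(p))\ge n_0$, the graph $\overline{G_0(p)}$ is the only (up to isomorphism) $t$-optimal graph in $\mathcal{S}(\overline{G_0(p)})$. If, in addition, $c$ is a positive integer such that for each positive integer $p$ each graph $H$ in $\mathcal{S}(G_0(p))$ not isomorphic to $G_0(p)$ is not in $\mathcal{S}(G_0(p))^{(c+1)}$, then the conclusion holds with the choice $n_0=2d+n(G_0)(2d)^{c+2}$.
   Context: All graphs are finite and simple. $\overline{G}$ is the complement of $G$; $n(G)$ is the number of vertices of $G$; $t(G)$ is the number of spanning trees of $G$. $K_r$ is the complete graph on $r$ vertices; $\cup$ denotes disjoint union, and $pK_{r}$ is the disjoint union of $p$ copies of $K_r$. $\mathcal{S}_{n,m}$ is the class of simple graphs with $n$ vertices and $m$ edges; a graph $G\in\mathcal{S}_{n,m}$ is $t$-optimal if $t(G)\ge t(H)$ for each $H\in\mathcal{S}_{n,m}$. $\mathcal{R}_d(n)$ is the class of $d$-regular graphs on $n$ vertices. For a graph $G$ with $n$ vertices and $m$ edges, $\mathcal{S}(G)=\mathcal{S}_{n,m}$, and for regular $G$, $\mathcal{R}(G)$ is the class of regular graphs with the same number of vertices and edges as $G$. For real sequences, $(b_i)_{i\ge1}\preceq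 (c_i)_{i\ge1}$ means: either $b_i=c_i$ for all $i$, or there is a positive integer $j$ with $b_i\le c_i$ for all $i\in\{1,\dots,j-1\}$ and $b_j<c_j$. With $A(G)$ the adjacency matrix and $a_i(G)=\mathrm{tr}(A(G)^i)$, a graph $G\in\mathcal{R}_d(n)$ is trace-minimal if $(a_i(G))_i\preceq (a_i(H))_i$ for each $H\in\mathcal{R}_d(n)$. $L(G)=D(G)-A(G)$ is the Laplacian matrix (diagonal degree matrix minus adjacency matrix), and $\ell_k(G)=\mathrm{tr}(L(G)^k)$. Define $\mathcal{S}_{n,m}^{(1)}=\mathcal{S}_{n,m}$ and, for each positive integer $k$, $\mathcal{S}_{n,m}^{(k+1)}=\{G\in\mathcal{S}_{n,m}^{(k)} : \ell_{k+1}(G)\le \ell_{k+1}(H)\text{ for each } H\in \mathcal{S}_{n,m}^{(k)}\}$. For $G$ with $n$ vertices and $m$ edges, $\mathcal{S}(G)^{(k)}=\mathcal{S}_{n,m}^{(k)}$. *)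

theory Defs
  imports Complex_Main "Jordan_Normal_Form.Matrix"
begin

section \<open>Finite simple graphs\<close>

record 'a sgraph =
  verts :: "'a set"
  edges :: "'a set set"

definition all_pairs :: "'a set \<Rightarrow> 'a set set" where
  "all_pairs V = {e. e \<subseteq> V \<and> card e = 2}"

definition simple_graph :: "'a sgraph \<Rightarrow> bool" where
  "simple_graph G \<longleftrightarrow> finite (verts G) \<and> edges G \<subseteq> all_pairs (verts G)"

definition nv :: "'a sgraph \<Rightarrow> nat" where
  "nv G = card (verts G)"

definition ne :: "'a sgraph \<Rightarrow> nat" where
  "ne G = card (edges G)"

definition deg :: "'a sgraph \<Rightarrow> 'a \<Rightarrow> nat" where
  "deg G v = card {e \<in> edges G. v \<in> e}"

definition regular_graph :: "nat \<Rightarrow> 'a sgraph \<Rightarrow> bool" where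
  "regular_graph d G \<longleftrightarrow> simple_graph G \<and> (\<forall>v\<in>verts G. deg G v = d)"

definition graph_iso :: "'a sgraph \<Rightarrow> 'b sgraph \<Rightarrow> bool" where
  "graph_iso G H \<longleftrightarrow> (\<exists>f. bij_betw f (verts G) (verts H) \<and>
     (\<forall>u\<in>verts G. \<forall>v\<in>verts G. {u, v} \<in> edges G \<longleftrightarrow> {f u, f v} \<in> edges H))"

definition complement :: "'a sgraph \<Rightarrow> 'a sgraph" where
  "complement G = \<lparr>verts = verts G, edges = all_pairs (verts G) - edges G\<rparr>"

definition complete_graph :: "nat \<Rightarrow> nat sgraph" where
  "complete_graph r = \<lparr>verts = {..<r}, edges = all_pairs {..<r}\<rparr>"

definition disjoint_union :: "'a sgraph \<Rightarrow> 'b sgraph \<Rightarrow> ('a + 'b) sgraph" where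
  "disjoint_union G H = \<lparr>verts = verts G <+> verts H,
     edges = (\<lambda>e. Inl ` e) ` edges G \<union> (\<lambda>e. Inr ` e) ` edges H\<rparr>"

definition copies :: "nat \<Rightarrow> 'a sgraph \<Rightarrow> (nat \<times> 'a) sgraph" where
  "copies p G = \<lparr>verts = {..<p} \<times> verts G,
     edges = (\<Union>i<p. (\<lambda>e. Pair i ` e) ` edges G)\<rparr>"

text \<open>The graph $G_0(p) = G_0 \cup pK_{d+1}$.\<close>

definition add_cliques :: "'a sgraph \<Rightarrow> nat \<Rightarrow> nat \<Rightarrow> ('a + nat \<times> nat) sgraph" where
  "add_cliques G0 d p = disjoint_union G0 (copies p (complete_graph (d + 1)))"


section \<open>Spanning trees\<close>

definition connected_graph :: "'a sgraph \<Rightarrow> bool" where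
  "connected_graph G \<longleftrightarrow>
     (\<forall>u\<in>verts G. \<forall>v\<in>verts G. (u, v) \<in> {(x, y). {x, y} \<in> edges G}\<^sup>*)"

definition is_cycle :: "'a sgraph \<Rightarrow> 'a list \<Rightarrow> bool" where
  "is_cycle G vs \<longleftrightarrow> length vs \<ge> 3 \<and> distinct vs \<and> set vs \<subseteq> verts G \<and>
     (\<forall>i<length vs. {vs ! i, vs ! ((i + 1) mod length vs)} \<in> edges G)"

definition is_tree :: "'a sgraph \<Rightarrow> bool" where
  "is_tree G \<longleftrightarrow> simple_graph G \<and> connected_graph G \<and> (\<nexists>vs. is_cycle G vs)"

definition num_spanning_trees :: "'a sgraph \<Rightarrow> nat" where
  "num_spanning_trees G =
     card {T. T \<subseteq> edges G \<and> is_tree \<lparr>verts = verts G, edges = T\<rparr>}"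


section \<open>Classes of graphs\<close>

text \<open>
  The vertices of the members of a class are drawn from one type. When that type is infinite,
  every isomorphism type of finite simple graphs is represented; this holds in particular for
  the vertex type of \<^const>\<open>add_cliques\<close>.
\<close>

definition class_S :: "nat \<Rightarrow> nat \<Rightarrow> 'a sgraph set" where
  "class_S n m = {G. simple_graph G \<and> nv G = n \<and> ne G = m}"

definition class_S_of :: "'a sgraph \<Rightarrow> 'a sgraph set" where
  "class_S_of G = class_S (nv G) (ne G)"

definition class_R :: "nat \<Rightarrow> nat \<Rightarrow> 'a sgraph set" where
  "class_R d n = {G. regular_graph d G \<and> nv G = n}"

definition class_R_of :: "'a sgraph \<Rightarrow> 'a sgraph set" where
  "class_R_of G = {H. (\<exists>d. regular_graph d H) \<and> nv H = nv G \<and> ne H = ne G}"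

definition t_optimal :: "'a sgraph \<Rightarrow> bool" where
  "t_optimal G \<longleftrightarrow> simple_graph G \<and>
     (\<forall>H\<in>class_S_of G. num_spanning_trees H \<le> num_spanning_trees G)"


section \<open>Matrices of a graph and their traces\<close>

text \<open>
  Rows and columns are indexed by positions in an arbitrarily chosen enumeration of the vertices.
  Another choice conjugates the matrices by a permutation matrix, so the traces below do not
  depend on it.
\<close>

definition vertex_list :: "'a sgraph \<Rightarrow> 'a list" where
  "vertex_list G = (SOME vs. distinct vs \<and> set vs = verts G)"

definition adjacency_mat :: "'a sgraph \<Rightarrow> real mat" where
  "adjacency_mat G = mat (nv G) (nv G)
     (\<lambda>(i, j). if {vertex_list G ! i, vertex_list G ! j} \<in> edges G then 1 else 0)"

definition degree_mat :: "'a sgraph \<Rightarrow> real mat" where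
  "degree_mat G = mat (nv G) (nv G)
     (\<lambda>(i, j). if i = j then real (deg G (vertex_list G ! i)) else 0)"

definition laplacian_mat :: "'a sgraph \<Rightarrow> real mat" where
  "laplacian_mat G = degree_mat G - adjacency_mat G"

definition mat_trace :: "real mat \<Rightarrow> real" where
  "mat_trace M = (\<Sum>i<dim_row M. M $$ (i, i))"

definition adj_trace :: "'a sgraph \<Rightarrow> nat \<Rightarrow> real" where
  "adj_trace G i = mat_trace (adjacency_mat G ^\<^sub>m i)"

definition lap_trace :: "'a sgraph \<Rightarrow> nat \<Rightarrow> real" where
  "lap_trace G k = mat_trace (laplacian_mat G ^\<^sub>m k)"


section \<open>Trace-minimality and the refined classes\<close>

text \<open>Sequences are indexed from 1; the value at 0 is ignored.\<close>

definition seq_preceq :: "(nat \<Rightarrow> real) \<Rightarrow> (nat \<Rightarrow> real) \<Rightarrow> bool" where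
  "seq_preceq b c \<longleftrightarrow> (\<forall>i\<ge>1. b i = c i) \<or>
     (\<exists>j\<ge>1. (\<forall>i\<in>{1..<j}. b i \<le> c i) \<and> b j < c j)"

definition trace_minimal :: "'a sgraph \<Rightarrow> bool" where
  "trace_minimal G \<longleftrightarrow> (\<exists>d. G \<in> class_R d (nv G) \<and>
     (\<forall>H\<in>(class_R d (nv G) :: 'a sgraph set). seq_preceq (adj_trace G) (adj_trace H)))"

text \<open>
  The refined classes are indexed by positive integers, with \<^term>\<open>class_S n m\<close> at index 1;
  the value at index 0 is a dummy.
\<close>

fun class_S_iter :: "nat \<Rightarrow> nat \<Rightarrow> nat \<Rightarrow> 'a sgraph set" where
  "class_S_iter n m 0 = class_S n m"
| "class_S_iter n m (Suc 0) = class_S n m"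
| "class_S_iter n m (Suc (Suc k)) =
     {G \<in> class_S_iter n m (Suc k).
        \<forall>H\<in>class_S_iter n m (Suc k). lap_trace G (Suc (Suc k)) \<le> lap_trace H (Suc (Suc k))}"

definition class_S_iter_of :: "'a sgraph \<Rightarrow> nat \<Rightarrow> 'a sgraph set" where
  "class_S_iter_of G k = class_S_iter (nv G) (ne G) k"

definition only_trace_minimal :: "'a sgraph \<Rightarrow> bool" where
  "only_trace_minimal G \<longleftrightarrow> trace_minimal G \<and>
     (\<forall>H\<in>class_R_of G. trace_minimal H \<longrightarrow> graph_iso H G)"

definition only_t_optimal :: "'a sgraph \<Rightarrow> bool" where
  "only_t_optimal G \<longleftrightarrow> t_optimal G \<and>
     (\<forall>H\<in>class_S_of G. t_optimal H \<longrightarrow> graph_iso H G)"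

end

theory Submission
  imports Defs "Jordan_Normal_Form.Schur_Decomposition"
begin

text \<open>
  Let \<open>G = G\<^sub>0 \<union> pK\<^sub>d\<^sub>+\<^sub>1\<close> have \<open>n\<close> vertices, and let \<open>\<lambda>\<^sub>1, \<dots>, \<lambda>\<^sub>n\<close> be the Laplacian eigenvalues
  of a competitor \<open>H\<close> with as many vertices and edges. Since the Laplacians of \<open>H\<close> and of its
  complement add up to \<open>nI - J\<close>, the matrix-tree theorem says that the number of spanning trees of
  the complement of \<open>H\<close> is \<open>\<Prod>(n - \<lambda>\<^sub>i)\<close> up to a positive factor that depends on \<open>n\<close> only
  (\<open>spanning_trees_complement\<close>). As \<open>- ln (1 - x) = \<Sum> x\<^sup>k / k\<close>, the best complements are those for which
  \<open>\<Sum> \<ell>\<^sub>k(H) / (k n\<^sup>k)\<close> is smallest, where \<open>\<ell>\<^sub>k(H) = \<Sum> \<lambda>\<^sub>i\<^sup>k\<close>. For large \<open>n\<close> this should be decided by the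
  first \<open>k\<close> at which \<open>\<ell>\<^sub>k(H)\<close> and \<open>\<ell>\<^sub>k(G)\<close> differ.

  That first difference favours \<open>G\<close> (\<open>trace_dichotomy\<close>). If \<open>H\<close> is not regular then it occurs at
  \<open>k = 2\<close>, because among degree sequences with a given sum the constant one has the smallest sum of
  squares. If \<open>H\<close> is \<open>d\<close>-regular then the adjacency matrix of its complement is \<open>J + (L - (d + 1)I)\<close>,
  where \<open>J\<close> commutes with \<open>L\<close>; so the adjacency traces of the two complements first differ where the
  Laplacian traces of \<open>G\<close> and \<open>H\<close> first differ, and by the same amount, and trace-minimality applies.

  Traces are integers, so if the first difference is at \<open>k = j\<close> then \<open>H\<close> loses at least \<open>1 / (j n\<^sup>j)\<close>
  there. The later terms cannot make up for that. By convexity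
  \<open>\<ell>\<^sub>k\<^sub>+\<^sub>1(H) \<ge> n d (d + 1)\<^sup>k\<close>, and a union of copies of \<open>K\<^sub>d\<^sub>+\<^sub>1\<close> attains this bound, so the cliques in
  \<open>G\<close> contribute nothing to \<open>\<ell>\<^sub>k(G) - \<ell>\<^sub>k(H)\<close>: it is at most \<open>\<ell>\<^sub>k(G\<^sub>0) \<le> n(G\<^sub>0) (2d)\<^sup>k / 2\<close>, whatever \<open>p\<close> is.
  Summing a geometric series, \<open>H\<close> is worse as soon as \<open>n > 2d\<close> and \<open>n \<ge> 2d + n(G\<^sub>0) (2d)\<^sup>j\<^sup>+\<^sup>1\<close>
  (\<open>prod_less_of_power_sums\<close>, \<open>spanning_trees_comparison\<close>).

  The refined classes consist of the graphs that agree with \<open>G\<close> in the first traces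
  (\<open>class_S_iter_eq\<close>), so the additional hypothesis of the second part says that \<open>j \<le> c + 1\<close>. For the
  first part such a \<open>c\<close> has to be found (\<open>iter_bound_exists\<close>). Put \<open>q(x) = x (x - (d + 1))\<^sup>2\<close>. The
  eigenvalues \<open>0\<close> and \<open>d + 1\<close> of the cliques are its zeros, so \<open>\<Sum> q(\<lambda>\<^sub>i)\<close> has for \<open>G\<close> a value \<open>B\<close> that does
  not depend on \<open>p\<close>, and a competitor with the same first three traces has the same value. The
  characteristic polynomial has integer coefficients, which makes the product of the nonzero
  \<open>q(\<lambda>\<^sub>i)\<close> at least \<open>1\<close>; hence at most \<open>B\<close> of them are nonzero. So the eigenvalues of \<open>G\<close> and \<open>H\<close> lie
  in a set of bounded size, and boundedly many power sums determine all the others.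
\<close>

section \<open>Spanning trees as maps to the parent\<close>

definition nbrs :: "'a sgraph \<Rightarrow> 'a \<Rightarrow> 'a set" where
  "nbrs G v = {u \<in> verts G. {v, u} \<in> edges G}"

lemma edge_in_verts:
  assumes "simple_graph G" "{u, v} \<in> edges G"
  shows "u \<in> verts G" "v \<in> verts G" "u \<noteq> v"
  using assms by (auto simp: simple_graph_def all_pairs_def)

lemma finite_nbrs: "simple_graph G \<Longrightarrow> finite (nbrs G v)"
  by (simp add: nbrs_def simple_graph_def)

definition parent_maps :: "'a sgraph \<Rightarrow> 'a \<Rightarrow> ('a \<Rightarrow> 'a) set" where
  "parent_maps G r = {f \<in> (\<Pi>\<^sub>E v\<in>verts G. if v = r then {r} else nbrs G v).
     \<forall>v\<in>verts G. \<exists>k. (f ^^ k) v = r}"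

definition parent_edges :: "'a sgraph \<Rightarrow> 'a \<Rightarrow> ('a \<Rightarrow> 'a) \<Rightarrow> 'a set set" where
  "parent_edges G r f = (\<lambda>v. {v, f v}) ` (verts G - {r})"

definition depth :: "'a \<Rightarrow> ('a \<Rightarrow> 'a) \<Rightarrow> 'a \<Rightarrow> nat" where
  "depth r f v = (LEAST k. (f ^^ k) v = r)"

lemma depth_step:
  assumes "f \<in> parent_maps G r" "v \<in> verts G" "v \<noteq> r"
  shows "depth r f v = Suc (depth r f (f v))"
proof -
  obtain k where "(f ^^ k) v = r" using assms unfolding parent_maps_def by blast
  moreover have "(f ^^ 0) v \<noteq> r" using assms by simp
  ultimately show ?thesis
    unfolding depth_def by (subst Least_Suc[of _ k]) (simp_all add: funpow_Suc_right del: funpow.simps)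
qed

lemma parent_map_root: "f \<in> parent_maps G r \<Longrightarrow> r \<in> verts G \<Longrightarrow> f r = r"
  using PiE_mem[of f "verts G" "\<lambda>v. if v = r then {r} else nbrs G v" r]
  by (simp add: parent_maps_def)

lemma parent_map_nbr:
  assumes "f \<in> parent_maps G r" "v \<in> verts G" "v \<noteq> r"
  shows "f v \<in> verts G" "{v, f v} \<in> edges G"
  using assms PiE_mem[of f "verts G" "\<lambda>v. if v = r then {r} else nbrs G v" v]
  unfolding parent_maps_def by (auto simp: nbrs_def)

lemma parent_edges_subset:
  assumes "f \<in> parent_maps G r"
  shows "parent_edges G r f \<subseteq> edges G"
  using parent_map_nbr[OF assms] unfolding parent_edges_def by auto

lemma parent_edges_connected:
  assumes f: "f \<in> parent_maps G r" and r: "r \<in> verts G"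
  shows "connected_graph \<lparr>verts = verts G, edges = parent_edges G r f\<rparr>"
proof -
  let ?R = "{(x, y). {x, y} \<in> parent_edges G r f}"
  have s: "sym ?R" by (auto simp: sym_def insert_commute)
  have reach: "(v, r) \<in> ?R\<^sup>*" if "v \<in> verts G" for v
    using that
  proof (induction "depth r f v" arbitrary: v rule: less_induct)
    case less
    show ?case
    proof (cases "v = r")
      case False
      have "(f v, r) \<in> ?R\<^sup>*"
        using less False depth_step[OF f, of v] parent_map_nbr[OF f, of v] by auto
      moreover have "(v, f v) \<in> ?R" using less False by (auto simp: parent_edges_def)
      ultimately show ?thesis by (rule converse_rtrancl_into_rtrancl[rotated])
    qed simp
  qed
  show ?thesis
    unfolding connected_graph_def
    using reach s by (auto intro: rtrancl_trans dest: symD[OF sym_rtrancl[OF s]])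
qed

lemma cyclic_neighbours:
  assumes "3 \<le> length xs" "distinct xs" "i < length xs"
  obtains j where "j < length xs" "(j + 1) mod length xs = i"
    "xs ! j \<noteq> xs ! ((i + 1) mod length xs)"
proof -
  define j where "j = (if i = 0 then length xs - 1 else i - 1)"
  have "j < length xs" "(j + 1) mod length xs = i" using assms by (auto simp: j_def)
  moreover have "(i + 1) mod length xs = (if i + 1 = length xs then 0 else i + 1)"
    using assms(3) by auto
  then have "(i + 1) mod length xs < length xs" "j \<noteq> (i + 1) mod length xs"
    using assms(1,3) by (auto simp: j_def split: if_splits)
  then have "xs ! j \<noteq> xs ! ((i + 1) mod length xs)"
    using assms(2) \<open>j < length xs\<close> by (simp add: nth_eq_iff_index_eq)
  ultimately show ?thesis using that by blast
qed

text \<open>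
  Both neighbours of a deepest vertex on a cycle would be its parent.
\<close>

lemma parent_edges_acyclic:
  assumes f: "f \<in> parent_maps G r" and r: "r \<in> verts G"
  shows "\<not> is_cycle \<lparr>verts = verts G, edges = parent_edges G r f\<rparr> xs"
proof
  assume "is_cycle \<lparr>verts = verts G, edges = parent_edges G r f\<rparr> xs"
  then have len: "3 \<le> length xs" and dist: "distinct xs"
    and e: "\<And>i. i < length xs \<Longrightarrow> {xs ! i, xs ! ((i + 1) mod length xs)} \<in> parent_edges G r f"
    by (auto simp: is_cycle_def)
  have "\<exists>i<length xs. \<forall>j<length xs. depth r f (xs ! j) \<le> depth r f (xs ! i)"
  proof -
    let ?D = "(\<lambda>i. depth r f (xs ! i)) ` {..<length xs}"
    have "0 < length xs" using len by linarith
    then have "0 \<in> {..<length xs}" by simp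
    then have "Max ?D \<in> ?D" by (intro Max_in) blast+
    then obtain i where "i < length xs" "Max ?D = depth r f (xs ! i)" by auto
    moreover have "depth r f (xs ! j) \<le> Max ?D" if "j < length xs" for j
      using that by (intro Max_ge) auto
    ultimately show ?thesis by metis
  qed
  then obtain i where i: "i < length xs"
    and top: "\<And>j. j < length xs \<Longrightarrow> depth r f (xs ! j) \<le> depth r f (xs ! i)" by blast
  \<comment> \<open>a deepest vertex of the cycle is the parent of neither neighbour\<close>
  have up: "u = f (xs ! i)"
    if u: "{xs ! i, u} \<in> parent_edges G r f" "depth r f u \<le> depth r f (xs ! i)" for u
  proof -
    obtain x where "x \<in> verts G - {r}" and x3: "{xs ! i, u} = {x, f x}"
      using u(1) unfolding parent_edges_def by (elim imageE)
    then have x: "x \<in> verts G" "x \<noteq> r" by auto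
    from x3 show ?thesis using depth_step[OF f x(1,2)] u(2) by (auto simp: doubleton_eq_iff)
  qed
  obtain j where j: "j < length xs" "(j + 1) mod length xs = i"
    and ne: "xs ! j \<noteq> xs ! ((i + 1) mod length xs)"
    using cyclic_neighbours[OF len dist i] by blast
  have m: "(i + 1) mod length xs < length xs" by (rule mod_less_divisor) (use i in linarith)
  have "xs ! ((i + 1) mod length xs) = f (xs ! i)" using up[OF e[OF i] top[OF m]] .
  moreover have "xs ! j = f (xs ! i)"
    using up[of "xs ! j"] e[OF j(1)] j(2) top[OF j(1)] by (simp add: insert_commute)
  ultimately show False using ne by simp
qed

text \<open>
  By induction on the depth under \<open>f\<close>: the edge from \<open>v\<close> to \<open>f v\<close> could otherwise only be the parent edge of
  \<open>f v\<close> under \<open>g\<close>, but there \<open>g\<close> already agrees with \<open>f\<close>, and \<open>f (f v) = v\<close> is impossible.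
\<close>

lemma parent_edges_inj:
  assumes r: "r \<in> verts G"
  shows "inj_on (parent_edges G r) (parent_maps G r)"
proof (rule inj_onI)
  fix f g
  assume f: "f \<in> parent_maps G r" and g: "g \<in> parent_maps G r"
    and eq: "parent_edges G r f = parent_edges G r g"
  have "f v = g v" if "v \<in> verts G" for v
    using that
  proof (induction "depth r f v" arbitrary: v rule: less_induct)
    case less
    show ?case
    proof (cases "v = r")
      case True
      then show ?thesis using parent_map_root f g r by metis
    next
      case False
      have "{v, f v} \<in> parent_edges G r g"
        using less(2) False unfolding eq[symmetric] by (auto simp: parent_edges_def)
      then obtain y where y: "y \<in> verts G" "y \<noteq> r" "{v, f v} = {y, g y}"
        by (auto simp: parent_edges_def)
      show ?thesis
      proof (cases "y = v")
        case True
        then show ?thesis using y by (auto simp: doubleton_eq_iff)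
      next
        case F: False
        then have yv: "y = f v" "g y = v" using y by (auto simp: doubleton_eq_iff)
        then have "f y = v"
          using less(1)[of y] depth_step[OF f less(2) False] y(1) by auto
        then show ?thesis
          using depth_step[OF f less(2) False] depth_step[OF f y(1,2)] yv by auto
      qed
    qed
  qed
  then show "f = g" using f g unfolding parent_maps_def by (auto intro: PiE_ext)
qed

lemma rtrancl_simple_path:
  assumes "(u, v) \<in> R\<^sup>*"
  shows "\<exists>xs. xs \<noteq> [] \<and> hd xs = u \<and> last xs = v \<and> distinct xs \<and> successively (\<lambda>x y. (x, y) \<in> R) xs"
  using assms
proof (induction rule: converse_rtrancl_induct)
  case base
  show ?case by (rule exI[of _ "[v]"]) simp
next
  case (step u y)
  then obtain xs where xs: "xs \<noteq> []" "hd xs = y" "last xs = v" "distinct xs"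
    "successively (\<lambda>x y. (x, y) \<in> R) xs" by blast
  show ?case
  proof (cases "u \<in> set xs")
    case True
    then obtain as bs where "xs = as @ u # bs" by (auto simp: in_set_conv_decomp)
    then show ?thesis using xs by (intro exI[of _ "u # bs"]) (auto simp: successively_append_iff)
  next
    case False
    then show ?thesis using xs step(1)
      by (intro exI[of _ "u # xs"]) (cases xs; auto)
  qed
qed

text \<open>
  Send each vertex to a neighbour that is one step closer to \<open>r\<close>. The parent edges already form a
  spanning tree inside \<open>T\<close>, so a further edge of \<open>T\<close> would close a cycle.
\<close>

lemma spanning_tree_parent_map:
  assumes G: "simple_graph G" and r: "r \<in> verts G" and T: "T \<subseteq> edges G"
    and tree: "is_tree \<lparr>verts = verts G, edges = T\<rparr>"
  shows "\<exists>f\<in>parent_maps G r. T = parent_edges G r f"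
proof -
  define R where "R = {(x, y). {x, y} \<in> T}"
  define dst where "dst v = (LEAST k. (v, r) \<in> R ^^ k)" for v
  have conn: "(v, r) \<in> R\<^sup>*" if "v \<in> verts G" for v
    using tree that r by (auto simp: is_tree_def connected_graph_def R_def)
  have dst_path: "(v, r) \<in> R ^^ dst v" if v: "v \<in> verts G" for v
  proof -
    obtain k where "(v, r) \<in> R ^^ k" using conn[OF v] by (auto simp: rtrancl_power)
    then show ?thesis unfolding dst_def by (rule LeastI)
  qed
  have dst_le: "dst v \<le> k" if "(v, r) \<in> R ^^ k" for v k
    unfolding dst_def using that by (rule Least_le)
  have RV: "u \<in> verts G \<and> v \<in> verts G \<and> u \<noteq> v" if "{u, v} \<in> T" for u v
    using edge_in_verts[OF G, of u v] that T by auto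
  have ex: "\<exists>u. {v, u} \<in> T \<and> dst v = Suc (dst u)" if v: "v \<in> verts G" "v \<noteq> r" for v
  proof -
    have "dst v \<noteq> 0" using dst_path[OF v(1)] v(2) by (metis relpow_0_E)
    then obtain m where m: "dst v = Suc m" by (cases "dst v") auto
    then obtain u where u: "(v, u) \<in> R" "(u, r) \<in> R ^^ m"
      using dst_path[OF v(1)] by (metis relpow_Suc_D2)
    have "u \<in> verts G" using u(1) RV by (auto simp: R_def)
    then have "(v, r) \<in> R ^^ Suc (dst u)" using u(1) dst_path by (meson relpow_Suc_I2)
    then show ?thesis using dst_le[OF u(2)] dst_le[of v "Suc (dst u)"] m u(1)
      by (auto simp: R_def)
  qed
  define f where "f = (\<lambda>v\<in>verts G. if v = r then r else (SOME u. {v, u} \<in> T \<and> dst v = Suc (dst u)))"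
  have fr: "f r = r" using r by (simp add: f_def)
  have fT: "{v, f v} \<in> T" "dst v = Suc (dst (f v))" if "v \<in> verts G" "v \<noteq> r" for v
    using someI_ex[OF ex[OF that]] that by (simp_all add: f_def)
  have reach: "\<exists>k. (f ^^ k) v = r" if "v \<in> verts G" for v
    using that
  proof (induction "dst v" arbitrary: v rule: less_induct)
    case less
    show ?case
    proof (cases "v = r")
      case True
      then show ?thesis by (intro exI[of _ 0]) simp
    next
      case False
      then obtain k where "(f ^^ k) (f v) = r" using less fT[of v] RV by (metis lessI)
      then show ?thesis by (intro exI[of _ "Suc k"]) (simp add: funpow_Suc_right del: funpow.simps)
    qed
  qed
  have f: "f \<in> parent_maps G r"
  proof -
    have "f v \<in> (if v = r then {r} else nbrs G v)" if "v \<in> verts G" for v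
      using fr fT(1)[OF that] RV[of v "f v"] T by (auto simp: nbrs_def)
    moreover have "f \<in> extensional (verts G)" by (simp add: f_def)
    ultimately show ?thesis using reach by (auto simp: parent_maps_def PiE_iff)
  qed
  let ?F = "parent_edges G r f"
  have FT: "?F \<subseteq> T" using fT by (auto simp: parent_edges_def)
  \<comment> \<open>an edge of \<open>T\<close> outside \<open>?F\<close> would close a cycle with a path of \<open>?F\<close>\<close>
  have "T \<subseteq> ?F"
  proof (rule ccontr)
    assume "\<not> T \<subseteq> ?F"
    then obtain e where e: "e \<in> T" "e \<notin> ?F" by auto
    then have "card e = 2" using T G by (auto simp: simple_graph_def all_pairs_def)
    then obtain u v where uv: "e = {u, v}" "u \<noteq> v" by (auto simp: card_2_iff)
    let ?S = "{(x, y). {x, y} \<in> ?F}"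
    have "(v, u) \<in> ?S\<^sup>*"
      using parent_edges_connected[OF f r] RV[of u v] e uv by (auto simp: connected_graph_def)
    from rtrancl_simple_path[OF this]
    obtain xs where xs: "xs \<noteq> []" "hd xs = v" "last xs = u" "distinct xs"
      "successively (\<lambda>x y. (x, y) \<in> ?S) xs" by blast
    have len: "3 \<le> length xs"
    proof (rule ccontr)
      assume "\<not> ?thesis"
      then consider "length xs = 1" | "length xs = 2"
        using xs(1) length_greater_0_conv[of xs] by linarith
      then show False
      proof cases
        case 1
        then show ?thesis using xs uv by (cases xs) auto
      next
        case 2
        then obtain a b where "xs = [a, b]" by (auto simp: numeral_2_eq_2 length_Suc_conv)
        then show ?thesis using xs uv e by (auto simp: insert_commute)
      qed
    qed
    have step: "{xs ! i, xs ! Suc i} \<in> ?F" if "Suc i < length xs" for i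
      using xs(5) that by (auto simp: successively_conv_nth)
    have cyc: "{xs ! i, xs ! ((i + 1) mod length xs)} \<in> T" if "i < length xs" for i
    proof (cases "Suc i = length xs")
      case True
      then have "length xs - 1 = i" by linarith
      then have "xs ! i = u" "xs ! 0 = v"
        using xs(1-3) last_conv_nth[OF xs(1)] hd_conv_nth[OF xs(1)] by auto
      then show ?thesis using True e uv by simp
    next
      case False
      then show ?thesis using step[of i] FT that by auto
    qed
    have "xs ! i \<in> verts G" if "i < length xs" for i using cyc[OF that] RV by blast
    then have "is_cycle \<lparr>verts = verts G, edges = T\<rparr> xs"
      using len xs cyc by (auto simp: is_cycle_def in_set_conv_nth)
    then show False using tree by (auto simp: is_tree_def)
  qed
  then show ?thesis using f FT by blast
qed

lemma num_spanning_trees_eq_parent_maps: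
  assumes G: "simple_graph G" and r: "r \<in> verts G"
  shows "num_spanning_trees G = card (parent_maps G r)"
proof -
  have "{T. T \<subseteq> edges G \<and> is_tree \<lparr>verts = verts G, edges = T\<rparr>} = parent_edges G r ` parent_maps G r"
  proof (intro equalityI subsetI)
    fix T assume "T \<in> {T. T \<subseteq> edges G \<and> is_tree \<lparr>verts = verts G, edges = T\<rparr>}"
    then show "T \<in> parent_edges G r ` parent_maps G r"
      using spanning_tree_parent_map[OF G r, of T] by auto
  next
    fix T assume "T \<in> parent_edges G r ` parent_maps G r"
    then obtain f where f: "f \<in> parent_maps G r" "T = parent_edges G r f" by auto
    then show "T \<in> {T. T \<subseteq> edges G \<and> is_tree \<lparr>verts = verts G, edges = T\<rparr>}"
      using parent_edges_subset[OF f(1)] parent_edges_connected[OF f(1) r]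
        parent_edges_acyclic[OF f(1) r] G
      by (auto simp: is_tree_def simple_graph_def)
  qed
  then show ?thesis
    unfolding num_spanning_trees_def by (simp add: card_image[OF parent_edges_inj[OF r]])
qed

section \<open>Determinants of functional digraphs\<close>

text \<open>
  The determinant is linear in each row; for a Laplacian, row \<open>i\<close> is a sum over the neighbours of
  vertex \<open>i\<close>, and the expansion runs over the ways to choose a neighbour for every vertex.
\<close>

lemma det_sum_choices:
  fixes N :: "'c \<Rightarrow> nat \<Rightarrow> nat \<Rightarrow> 'b::comm_ring_1"
  assumes fin: "\<And>i. i < n \<Longrightarrow> finite (C i)"
  shows "det (mat n n (\<lambda>(i, k). \<Sum>u\<in>C i. N u i k))
    = (\<Sum>g\<in>Pi\<^sub>E {0..<n} C. det (mat n n (\<lambda>(i, k). N (g i) i k)))"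
proof -
  have "(\<Prod>i = 0..<n. mat n n (\<lambda>(i, k). \<Sum>u\<in>C i. N u i k) $$ (i, p i))
      = (\<Sum>g\<in>Pi\<^sub>E {0..<n} C. \<Prod>i = 0..<n. mat n n (\<lambda>(i, k). N (g i) i k) $$ (i, p i))"
    if p: "p permutes {0..<n}" for p
  proof -
    have pi: "p i < n" if "i < n" for i using permutes_in_image[OF p, of i] that by simp
    have "(\<Prod>i = 0..<n. mat n n (\<lambda>(i, k). \<Sum>u\<in>C i. N u i k) $$ (i, p i))
        = (\<Prod>i = 0..<n. \<Sum>u\<in>C i. N u i (p i))"
      using pi by (intro prod.cong) auto
    also have "\<dots> = (\<Sum>g\<in>Pi\<^sub>E {0..<n} C. \<Prod>i = 0..<n. N (g i) i (p i))"
      using fin by (intro prod_sum_PiE) auto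
    also have "\<dots> = (\<Sum>g\<in>Pi\<^sub>E {0..<n} C. \<Prod>i = 0..<n. mat n n (\<lambda>(i, k). N (g i) i k) $$ (i, p i))"
      using pi by (intro sum.cong prod.cong) auto
    finally show ?thesis .
  qed
  then have "det (mat n n (\<lambda>(i, k). \<Sum>u\<in>C i. N u i k))
    = (\<Sum>p | p permutes {0..<n}. \<Sum>g\<in>Pi\<^sub>E {0..<n} C.
        signof p * (\<Prod>i = 0..<n. mat n n (\<lambda>(i, k). N (g i) i k) $$ (i, p i)))"
    by (subst det_def'[of _ n]) (auto simp: sum_distrib_left intro!: sum.cong)
  also have "\<dots> = (\<Sum>g\<in>Pi\<^sub>E {0..<n} C. \<Sum>p | p permutes {0..<n}.
        signof p * (\<Prod>i = 0..<n. mat n n (\<lambda>(i, k). N (g i) i k) $$ (i, p i)))"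
    by (rule sum.swap)
  also have "\<dots> = (\<Sum>g\<in>Pi\<^sub>E {0..<n} C. det (mat n n (\<lambda>(i, k). N (g i) i k)))"
    by (intro sum.cong) (auto simp: det_def'[of _ n])
  finally show ?thesis .
qed

text \<open>
  The identity minus the matrix of \<open>f\<close>, where the entry of a fixed point is dropped: fixed points play
  the role of roots.
\<close>

definition functional_mat :: "'a list \<Rightarrow> ('a \<Rightarrow> 'a) \<Rightarrow> real mat" where
  "functional_mat vs f = mat (length vs) (length vs)
     (\<lambda>(i, k). (if i = k then 1 else 0) - (if vs ! k = f (vs ! i) \<and> f (vs ! i) \<noteq> vs ! i then 1 else 0))"

text \<open>
  Only the identity contributes to the Leibniz expansion. A permutation with a nonzero term follows \<open>f\<close>
  wherever it moves a point; the orbit of a moved point consists of moved points, so \<open>f\<close> would never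
  reach a fixed point from there.
\<close>

lemma det_functional_mat_terminating:
  assumes vs: "distinct vs"
    and stops: "\<And>v. v \<in> set vs \<Longrightarrow> \<exists>k. f ((f ^^ k) v) = (f ^^ k) v"
  shows "det (functional_mat vs f) = 1"
proof -
  let ?n = "length vs" and ?M = "functional_mat vs f"
  have zero: "signof p * (\<Prod>i = 0..<?n. ?M $$ (i, p i)) = 0"
    if p: "p permutes {0..<?n}" "p \<noteq> id" for p
  proof (rule ccontr)
    assume nz: "\<not> ?thesis"
    have entry: "p i < ?n \<and> ?M $$ (i, p i) \<noteq> 0" if "i < ?n" for i
      using nz that permutes_in_image[OF p(1), of i] by auto
    have step: "vs ! p i = f (vs ! i) \<and> f (vs ! i) \<noteq> vs ! i" if "i < ?n" "p i \<noteq> i" for i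
      using entry[OF that(1)] that by (auto simp: functional_mat_def split: if_splits)
    obtain i where i: "p i \<noteq> i" using p(2) by (auto simp: fun_eq_iff)
    then have i_n: "i < ?n" using permutes_not_in[OF p(1), of i] by auto
    have orbit: "(p ^^ k) i < ?n \<and> p ((p ^^ k) i) \<noteq> (p ^^ k) i \<and> vs ! ((p ^^ k) i) = (f ^^ k) (vs ! i)" for k
    proof (induction k)
      case (Suc k)
      then show ?case using step[of "(p ^^ k) i"] entry[of "(p ^^ k) i"]
        by (auto dest: injD[OF permutes_inj[OF p(1)]])
    qed (use i i_n in auto)
    obtain k where "f ((f ^^ k) (vs ! i)) = (f ^^ k) (vs ! i)" using stops[of "vs ! i"] i_n by auto
    then show False using orbit[of k] step[of "(p ^^ k) i"] by auto
  qed
  have "det ?M = (\<Sum>p | p permutes {0..<?n}. signof p * (\<Prod>i = 0..<?n. ?M $$ (i, p i)))"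
    by (rule det_def') (simp add: functional_mat_def)
  also have "\<dots> = (\<Sum>p\<in>{id}. signof p * (\<Prod>i = 0..<?n. ?M $$ (i, p i)))"
    using zero by (intro sum.mono_neutral_right) (auto simp: finite_permutations permutes_id)
  also have "\<dots> = (\<Prod>i = 0..<?n. ?M $$ (i, i))" by simp
  also have "\<dots> = 1" by (intro prod.neutral) (auto simp: functional_mat_def)
  finally show ?thesis .
qed

text \<open>
  The indicator vector of the points from which \<open>f\<close> never reaches a fixed point lies in the kernel.
\<close>

lemma det_functional_mat_nonterminating:
  assumes vs: "distinct vs" and f: "\<And>v. v \<in> set vs \<Longrightarrow> f v \<in> set vs"
    and w: "w \<in> set vs" "\<And>k. f ((f ^^ k) w) \<noteq> (f ^^ k) w"
  shows "det (functional_mat vs f) = 0"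
proof -
  let ?n = "length vs" and ?M = "functional_mat vs f"
  define never where "never v \<longleftrightarrow> (\<forall>k. f ((f ^^ k) v) \<noteq> (f ^^ k) v)" for v
  have never_step: "never v \<longleftrightarrow> f v \<noteq> v \<and> never (f v)" for v
  proof -
    have "never v \<longleftrightarrow> (\<forall>k. (f ^^ Suc k) v \<noteq> (f ^^ k) v)" by (simp add: never_def)
    also have "\<dots> \<longleftrightarrow> f v \<noteq> v \<and> (\<forall>k. (f ^^ Suc (Suc k)) v \<noteq> (f ^^ Suc k) v)"
      by (metis funpow_0 comp_def funpow.simps(2) not0_implies_Suc)
    also have "\<dots> \<longleftrightarrow> f v \<noteq> v \<and> never (f v)"
      by (simp add: never_def funpow_swap1)
    finally show ?thesis .
  qed
  let ?x = "vec ?n (\<lambda>i. if never (vs ! i) then 1 else 0 :: real)"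
  have "?M *\<^sub>v ?x = 0\<^sub>v ?n"
  proof (rule eq_vecI)
    fix i assume "i < dim_vec (0\<^sub>v ?n :: real vec)"
    then have i: "i < ?n" by simp
    obtain k where k: "k < ?n" "vs ! k = f (vs ! i)"
      using f[of "vs ! i"] i by (metis in_set_conv_nth nth_mem)
    have uniq: "vs ! m = f (vs ! i) \<longleftrightarrow> m = k" if "m < ?n" for m
      using k that vs by (metis nth_eq_iff_index_eq)
    have "(?M *\<^sub>v ?x) $ i = (\<Sum>m = 0..<?n. ?M $$ (i, m) * (if never (vs ! m) then 1 else 0))"
      using i by (simp add: functional_mat_def scalar_prod_def)
    also have "\<dots> = (\<Sum>m = 0..<?n. (if i = m then (if never (vs ! m) then 1 else 0) else 0)
        - (if m = k then (if never (vs ! m) \<and> f (vs ! i) \<noteq> vs ! i then 1 else 0) else 0))"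
      using i uniq by (intro sum.cong) (auto simp: functional_mat_def)
    also have "\<dots> = (if never (vs ! i) then 1 else 0)
        - (if never (vs ! k) \<and> f (vs ! i) \<noteq> vs ! i then 1 else 0)"
      using i k by (simp add: sum_subtractf)
    also have "\<dots> = 0" using never_step[of "vs ! i"] k(2) by auto
    finally show "(?M *\<^sub>v ?x) $ i = 0\<^sub>v ?n $ i" using i by simp
  qed (simp add: functional_mat_def)
  moreover have "?x \<noteq> 0\<^sub>v ?n"
  proof
    assume *: "?x = 0\<^sub>v ?n"
    obtain i where i: "i < ?n" "vs ! i = w" using w(1) by (auto simp: in_set_conv_nth)
    have "?x $ i = 0" using * i by simp
    then show False using i w(2) by (simp add: never_def)
  qed
  ultimately show ?thesis
    by (subst det_0_iff_vec_prod_zero[of _ ?n]) (auto simp: functional_mat_def intro!: exI[of _ ?x])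
qed

section \<open>The matrix-tree theorem\<close>

text \<open>
  The Laplacian indexed by vertices instead of positions and with integer entries: traces become
  visibly integral and independent of the enumeration.
\<close>

definition lap :: "'a sgraph \<Rightarrow> 'a \<Rightarrow> 'a \<Rightarrow> int" where
  "lap G u v = (if u = v then int (deg G u) else 0) - (if {u, v} \<in> edges G then 1 else 0)"

lemma vertex_list:
  assumes "finite (verts G)"
  shows "distinct (vertex_list G)" "set (vertex_list G) = verts G" "length (vertex_list G) = nv G"
proof -
  have "\<exists>vs. distinct vs \<and> set vs = verts G" using finite_distinct_list[OF assms] by auto
  from someI_ex[OF this] have "distinct (vertex_list G) \<and> set (vertex_list G) = verts G"
    unfolding vertex_list_def .
  then show "distinct (vertex_list G)" "set (vertex_list G) = verts G" by auto
  then show "length (vertex_list G) = nv G" by (metis nv_def distinct_card)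
qed

lemma deg_eq_card_nbrs:
  assumes "simple_graph G"
  shows "deg G v = card (nbrs G v)"
proof -
  have eq: "{e \<in> edges G. v \<in> e} = (\<lambda>u. {v, u}) ` nbrs G v"
  proof (intro equalityI subsetI)
    fix e assume e: "e \<in> {e \<in> edges G. v \<in> e}"
    then have "card e = 2" "e \<subseteq> verts G" using assms by (auto simp: simple_graph_def all_pairs_def)
    then obtain u where "e = {v, u}" using e by (auto simp: card_2_iff)
    then show "e \<in> (\<lambda>u. {v, u}) ` nbrs G v" using e \<open>e \<subseteq> verts G\<close> by (auto simp: nbrs_def)
  qed (auto simp: nbrs_def)
  have "inj_on (\<lambda>u. {v, u}) (nbrs G v)" by (auto simp: inj_on_def doubleton_eq_iff)
  then show ?thesis unfolding deg_def eq by (rule card_image)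
qed

lemma laplacian_mat_carrier [simp]: "laplacian_mat G \<in> carrier_mat (nv G) (nv G)"
  unfolding laplacian_mat_def degree_mat_def adjacency_mat_def by (intro minus_carrier_mat mat_carrier)

lemma laplacian_mat_dim [simp]: "dim_row (laplacian_mat G) = nv G" "dim_col (laplacian_mat G) = nv G"
  using carrier_matD[OF laplacian_mat_carrier] by blast+

lemma laplacian_mat_index:
  assumes "simple_graph G" "i < nv G" "j < nv G"
  shows "laplacian_mat G $$ (i, j) = of_int (lap G (vertex_list G ! i) (vertex_list G ! j))"
proof -
  note vs = vertex_list[of G]
  have fin: "finite (verts G)" using assms(1) by (simp add: simple_graph_def)
  have "vertex_list G ! i = vertex_list G ! j \<longleftrightarrow> i = j"
    using vs[OF fin] assms by (simp add: nth_eq_iff_index_eq)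
  then show ?thesis
    using assms by (simp add: laplacian_mat_def degree_mat_def adjacency_mat_def lap_def)
qed

lemma sum_vertex_list:
  assumes "finite (verts G)"
  shows "(\<Sum>i = 0..<nv G. h (vertex_list G ! i)) = (\<Sum>v\<in>verts G. h v)"
  using sum_list_sum_nth[of "map h (vertex_list G)"] vertex_list[OF assms]
    sum.distinct_set_conv_list[of "vertex_list G" h] by simp

lemma lap_sym: "lap G u v = lap G v u"
  by (simp add: lap_def insert_commute)

lemma lap_row_sum:
  assumes G: "simple_graph G" and u: "u \<in> verts G"
  shows "(\<Sum>v\<in>verts G. lap G u v) = 0"
proof -
  have fin: "finite (verts G)" using G by (simp add: simple_graph_def)
  have "(\<Sum>v\<in>verts G. lap G u v) = int (deg G u) - (\<Sum>v\<in>verts G. if {u, v} \<in> edges G then 1 else 0)"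
    using fin u by (simp add: lap_def sum_subtractf)
  also have "(\<Sum>v\<in>verts G. if {u, v} \<in> edges G then 1 else 0 :: int) = int (card (nbrs G u))"
    using fin by (simp add: sum.If_cases nbrs_def Int_def)
  finally show ?thesis by (simp add: deg_eq_card_nbrs[OF G])
qed

lemma laplacian_mat_sym:
  assumes "simple_graph G" "i < nv G" "j < nv G"
  shows "laplacian_mat G $$ (i, j) = laplacian_mat G $$ (j, i)"
  using assms by (simp add: laplacian_mat_index lap_sym)

lemma laplacian_mat_row_sum:
  assumes G: "simple_graph G" and i: "i < nv G"
  shows "(\<Sum>j = 0..<nv G. laplacian_mat G $$ (i, j)) = 0"
proof -
  have fin: "finite (verts G)" using G by (simp add: simple_graph_def)
  have "vertex_list G ! i \<in> verts G" using vertex_list[OF fin] i by (metis nth_mem)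
  from lap_row_sum[OF G this] have "(\<Sum>v\<in>verts G. real_of_int (lap G (vertex_list G ! i) v)) = 0"
    by (metis of_int_0 of_int_sum)
  then show ?thesis using i sum_vertex_list[OF fin, of "\<lambda>v. real_of_int (lap G (vertex_list G ! i) v)"]
    by (simp add: laplacian_mat_index[OF G])
qed

definition root_mat :: "nat \<Rightarrow> real mat" where
  "root_mat n = mat n n (\<lambda>(i, j). if i = 0 \<and> j = 0 then 1 else 0)"

definition ones_mat :: "nat \<Rightarrow> real mat" where
  "ones_mat n = mat n n (\<lambda>_. 1)"

text \<open>
  Adding \<open>1\<close> at a diagonal entry lets the corresponding vertex choose to be the root. A choice of
  neighbours contributes \<open>1\<close> if it leads every vertex to that root and \<open>0\<close> otherwise.
\<close>

lemma det_rooted_laplacian: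
  assumes G: "simple_graph G" and n: "nv G > 0"
  shows "det (laplacian_mat G + root_mat (nv G)) = real (num_spanning_trees G)"
proof -
  let ?n = "nv G" and ?V = "verts G"
  define vs where "vs = vertex_list G"
  have fin: "finite ?V" using G by (simp add: simple_graph_def)
  have vs: "distinct vs" "set vs = ?V" "length vs = ?n"
    using vertex_list[OF fin] by (simp_all add: vs_def)
  define r where "r = vs ! 0"
  have r: "r \<in> ?V" using n vs by (metis nth_mem r_def)
  define C where "C v = nbrs G v \<union> (if v = r then {r} else {})" for v
  have finC: "finite (C v)" for v using finite_nbrs[OF G] by (simp add: C_def)
  define N :: "'a \<Rightarrow> nat \<Rightarrow> nat \<Rightarrow> real" where
    "N u i k = (if i = k then 1 else 0) - (if vs ! k = u \<and> u \<noteq> vs ! i then 1 else 0)" for u i k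
  have entry: "(laplacian_mat G + root_mat ?n) $$ (i, k) = (\<Sum>u\<in>C (vs ! i). N u i k)"
    if i: "i < ?n" and k: "k < ?n" for i k
  proof -
    have eq: "vs ! i = vs ! k \<longleftrightarrow> i = k" if "i < ?n" "k < ?n" for i k
      using vs that by (simp add: nth_eq_iff_index_eq)
    have loop: "vs ! i \<notin> nbrs G (vs ! i)" using edge_in_verts(3)[OF G, of "vs ! i" "vs ! i"] unfolding nbrs_def by blast
    have kV: "vs ! k \<in> ?V" using vs k nth_mem[of k vs] by simp
    have nb: "(\<Sum>u\<in>nbrs G (vs ! i). N u i k) = lap G (vs ! i) (vs ! k)"
    proof -
      have "(\<Sum>u\<in>nbrs G (vs ! i). N u i k)
          = (\<Sum>u\<in>nbrs G (vs ! i). (if i = k then 1 else 0) - (if u = vs ! k then 1 else 0))"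
        using loop by (intro sum.cong) (auto simp: N_def)
      also have "\<dots> = real (if i = k then card (nbrs G (vs ! i)) else 0)
          - (if vs ! k \<in> nbrs G (vs ! i) then 1 else 0)"
        using finite_nbrs[OF G] by (simp add: sum_subtractf)
      also have "\<dots> = lap G (vs ! i) (vs ! k)"
        using kV eq[OF i k] by (simp add: lap_def nbrs_def deg_eq_card_nbrs[OF G])
      finally show ?thesis .
    qed
    have root: "vs ! i = r \<longleftrightarrow> i = 0" using eq[OF i n] by (simp add: r_def)
    have "(\<Sum>u\<in>C (vs ! i). N u i k) = (\<Sum>u\<in>nbrs G (vs ! i). N u i k) + (if i = 0 \<and> k = 0 then 1 else 0)"
    proof (cases "i = 0")
      case True
      then have "C (vs ! i) = insert (vs ! i) (nbrs G (vs ! i))" using root by (auto simp: C_def)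
      then show ?thesis using loop finite_nbrs[OF G] True by (simp add: N_def)
    qed (simp add: C_def root)
    then show ?thesis using nb i k by (simp add: laplacian_mat_index[OF G] root_mat_def vs_def)
  qed
  have "laplacian_mat G + root_mat ?n = mat ?n ?n (\<lambda>(i, k). \<Sum>u\<in>C (vs ! i). N u i k)"
    using entry by (intro eq_matI) (auto simp: root_mat_def)
  then have "det (laplacian_mat G + root_mat ?n)
      = (\<Sum>g\<in>Pi\<^sub>E {0..<?n} (\<lambda>i. C (vs ! i)). det (mat ?n ?n (\<lambda>(i, k). N (g i) i k)))"
    using det_sum_choices[of ?n "\<lambda>i. C (vs ! i)" N] finC by simp
  also have "\<dots> = (\<Sum>f\<in>Pi\<^sub>E ?V C. det (functional_mat vs f))"
  proof -
    define idx where "idx v = (THE i. i < ?n \<and> vs ! i = v)" for v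
    have idx: "idx (vs ! i) = i" if "i < ?n" for i
      unfolding idx_def using vs that by (intro the_equality) (auto simp: nth_eq_iff_index_eq)
    have idxV: "idx v < ?n" "vs ! idx v = v" if "v \<in> ?V" for v
      using that idx vs by (metis in_set_conv_nth)+
    show ?thesis
    proof (rule sum.reindex_bij_witness[of _ "\<lambda>f. \<lambda>i\<in>{0..<?n}. f (vs ! i)" "\<lambda>g. \<lambda>v\<in>?V. g (idx v)"], goal_cases)
      case (1 g)
      then show ?case using vs idx idxV by (intro ext) (auto simp: PiE_iff extensional_def restrict_def)
    next
      case (2 g)
      have "g (idx v) \<in> C v" if "v \<in> ?V" for v
        using PiE_mem[OF 2, of "idx v"] idxV[OF that] by simp
      then show ?case by simp
    next
      case (3 f)
      then show ?case using idxV vs by (intro ext) (auto simp: PiE_iff extensional_def restrict_def)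
    next
      case (4 f)
      then show ?case using vs by (auto simp: PiE_iff)
    next
      case (5 g)
      have "vs ! i \<in> ?V" if "i < ?n" for i using vs(2,3) nth_mem[of i vs] that by simp
      then have "mat ?n ?n (\<lambda>(i, k). N (g i) i k) = functional_mat vs (\<lambda>v\<in>?V. g (idx v))"
        using vs idx by (intro eq_matI) (auto simp: functional_mat_def N_def)
      then show ?case by simp
    qed
  qed
  also have "\<dots> = (\<Sum>f\<in>Pi\<^sub>E ?V C. if f \<in> parent_maps G r then 1 else 0)"
  proof (intro sum.cong refl)
    fix f assume f: "f \<in> Pi\<^sub>E ?V C"
    have fV: "f v \<in> ?V" if "v \<in> ?V" for v
      using PiE_mem[OF f that] r by (auto simp: C_def nbrs_def split: if_splits)
    have iter: "(f ^^ k) v \<in> ?V" if "v \<in> ?V" for k v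
      using that fV by (induction k) auto
    have fixpt: "v = r" if "f v = v" "v \<in> ?V" for v
      using PiE_mem[OF f that(2)] that edge_in_verts(3)[OF G, of v v]
      by (auto simp: C_def nbrs_def split: if_splits)
    show "det (functional_mat vs f) = (if f \<in> parent_maps G r then 1 else 0)"
    proof (cases "f \<in> parent_maps G r")
      case True
      then have "\<exists>k. f ((f ^^ k) v) = (f ^^ k) v" if "v \<in> set vs" for v
        using parent_map_root[OF True r] that vs(2) unfolding parent_maps_def by fastforce
      then show ?thesis using det_functional_mat_terminating[OF vs(1), of f] True by simp
    next
      case False
      have "\<exists>w\<in>?V. \<forall>k. f ((f ^^ k) w) \<noteq> (f ^^ k) w"
      proof (rule ccontr)
        assume "\<not> ?thesis"
        then have ex: "\<exists>k. f ((f ^^ k) w) = (f ^^ k) w" if "w \<in> ?V" for w using that by auto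
        have reach: "\<exists>k. (f ^^ k) w = r" if "w \<in> ?V" for w
          using ex[OF that] fixpt iter[OF that] by blast
        have "f r = r" using ex[OF r] fixpt iter[OF r] by metis
        then have "f \<in> parent_maps G r"
          using f reach by (auto simp: parent_maps_def PiE_iff C_def)
        then show False using False by simp
      qed
      then obtain w where "w \<in> ?V" "\<And>k. f ((f ^^ k) w) \<noteq> (f ^^ k) w" by blast
      then show ?thesis using det_functional_mat_nonterminating[OF vs(1), of f w] fV vs(2) False by simp
    qed
  qed
  also have "\<dots> = real (card (Pi\<^sub>E ?V C \<inter> parent_maps G r))"
    using fin finC by (simp add: sum.If_cases finite_PiE Int_def)
  also have "Pi\<^sub>E ?V C \<inter> parent_maps G r = parent_maps G r"
    by (auto simp: parent_maps_def PiE_iff C_def extensional_def)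
  finally show ?thesis using num_spanning_trees_eq_parent_maps[OF G r] by simp
qed

text \<open>
  This is \<open>P = I + a 1\<^sup>T\<close> with \<open>a = 1 - e\<^sub>0\<close>. Because the rows and columns of a Laplacian \<open>L\<close> sum to zero,
  \<open>P L P\<^sup>T = L\<close>, while \<open>P e\<^sub>0 = 1\<close>; so \<open>P\<close> turns the rank-one matrix at the root into the all-ones matrix.
\<close>

definition spread_mat :: "nat \<Rightarrow> real mat" where
  "spread_mat n = mat n n (\<lambda>(i, j). (if i = j then 1 else 0) + (if i = 0 then 0 else 1))"

text \<open>
  The inverse is \<open>I - a 1\<^sup>T / n\<close>.
\<close>

lemma det_spread_mat_nonzero: "det (spread_mat n) \<noteq> 0"
proof (cases "n = 0")
  case False
  define Q :: "real mat" where
    "Q = mat n n (\<lambda>(i, j). (if i = j then 1 else 0) - (if i = 0 then 0 else 1 / n))"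
  have "spread_mat n * Q = 1\<^sub>m n"
  proof (rule eq_matI)
    fix i j assume "i < dim_row (1\<^sub>m n :: real mat)" "j < dim_col (1\<^sub>m n :: real mat)"
    then have ij: "i < n" "j < n" by auto
    define a :: "nat \<Rightarrow> real" where "a i = (if i = 0 then 0 else 1)" for i
    have sa: "(\<Sum>k = 0..<n. a k) = real n - 1"
    proof -
      have "(\<Sum>k = 0..<n. a k) = (\<Sum>k = 0..<n. 1 - (if k = 0 then 1 else 0))"
        by (intro sum.cong) (auto simp: a_def)
      also have "\<dots> = real n - 1" using False by (simp add: sum_subtractf)
      finally show ?thesis .
    qed
    have sa': "(\<Sum>k = 0..<n. a i * a k / real n) = a i * (real n - 1) / real n" for i
      by (simp only: sum_divide_distrib[symmetric] sum_distrib_left[symmetric] sa)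
    have "(spread_mat n * Q) $$ (i, j) = (\<Sum>k = 0..<n. ((if i = k then 1 else 0) + a i) * ((if k = j then 1 else 0) - a k / n))"
      using ij by (auto simp: spread_mat_def Q_def a_def scalar_prod_def times_mat_def intro!: sum.cong)
    also have "\<dots> = (\<Sum>k = 0..<n. (if i = k then (if k = j then 1 else 0) - a k / n else 0)
        + (if k = j then a i else 0) - a i / n * a k)"
      by (intro sum.cong) (auto simp: algebra_simps)
    also have "\<dots> = (if i = j then 1 else 0) - a i / n + a i - a i / n * (real n - 1)"
      using ij by (simp add: sum.distrib sum_subtractf sa')
    also have "\<dots> = (if i = j then 1 else 0)" using False by (simp add: field_simps)
    finally show "(spread_mat n * Q) $$ (i, j) = 1\<^sub>m n $$ (i, j)" using ij by simp
  qed (simp_all add: spread_mat_def Q_def)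
  then have "det (spread_mat n) * det Q = 1"
    using det_mult[of "spread_mat n" n Q] by (simp add: spread_mat_def Q_def)
  then show ?thesis by auto
qed (simp add: spread_mat_def)

lemma laplacian_ones_eq_spread:
  assumes G: "simple_graph G" and n: "nv G > 0"
  shows "laplacian_mat G + ones_mat (nv G)
    = spread_mat (nv G) * (laplacian_mat G + root_mat (nv G)) * transpose_mat (spread_mat (nv G))"
proof (rule eq_matI)
  let ?n = "nv G" and ?L = "laplacian_mat G"
  let ?P = "spread_mat ?n" and ?M = "?L + root_mat ?n"
  have row: "(\<Sum>j = 0..<?n. ?L $$ (i, j)) = 0" if "i < ?n" for i
    by (rule laplacian_mat_row_sum[OF G that])
  have col: "(\<Sum>i = 0..<?n. ?L $$ (i, j)) = 0" if "j < ?n" for j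
    using row[OF that] laplacian_mat_sym[OF G that] by simp
  define a :: "nat \<Rightarrow> real" where "a i = (if i = 0 then 0 else 1)" for i
  have P_entry: "?P $$ (i, j) = (if i = j then 1 else 0) + a i" if "i < ?n" "j < ?n" for i j
    using that by (simp add: spread_mat_def a_def)
  have PM: "(?P * ?M) $$ (i, j) = ?L $$ (i, j) + (if j = 0 then 1 else 0)" if ij: "i < ?n" "j < ?n" for i j
  proof -
    have "(?P * ?M) $$ (i, j) = (\<Sum>k = 0..<?n. ((if i = k then 1 else 0) + a i) *
        (?L $$ (k, j) + (if k = 0 \<and> j = 0 then 1 else 0)))"
      using ij by (auto simp: spread_mat_def root_mat_def scalar_prod_def a_def times_mat_def intro!: sum.cong)
    also have "\<dots> = (\<Sum>k = 0..<?n. (if i = k then ?L $$ (k, j) else 0) + a i * ?L $$ (k, j)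
        + (if k = 0 then (if j = 0 then (if i = 0 then 1 else 0) + a i else 0) else 0))"
      by (intro sum.cong) (auto simp: algebra_simps)
    also have "\<dots> = ?L $$ (i, j) + (if j = 0 then 1 else 0)"
      using ij n by (simp add: sum.distrib sum_distrib_left[symmetric] col a_def)
    finally show ?thesis .
  qed
  fix i j assume "i < dim_row (?P * ?M * transpose_mat ?P)" "j < dim_col (?P * ?M * transpose_mat ?P)"
  then have ij: "i < ?n" "j < ?n" by (auto simp: spread_mat_def)
  have "(?P * ?M * transpose_mat ?P) $$ (i, j) = (\<Sum>k = 0..<?n. (?P * ?M) $$ (i, k) * ?P $$ (j, k))"
    using ij by (auto simp: scalar_prod_def times_mat_def spread_mat_def root_mat_def intro!: sum.cong)
  also have "\<dots> = (\<Sum>k = 0..<?n. (?L $$ (i, k) + (if k = 0 then 1 else 0)) * ((if j = k then 1 else 0) + a j))"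
    using ij by (intro sum.cong) (simp_all add: PM P_entry)
  also have "\<dots> = (\<Sum>k = 0..<?n. (if j = k then ?L $$ (i, k) else 0) + a j * ?L $$ (i, k)
      + (if k = 0 then (if j = 0 then 1 else 0) + a j else 0))"
    by (intro sum.cong) (auto simp: algebra_simps)
  also have "\<dots> = ?L $$ (i, j) + 1"
    using ij n by (simp add: sum.distrib sum_distrib_left[symmetric] row a_def)
  finally show "(?L + ones_mat ?n) $$ (i, j) = (?P * ?M * transpose_mat ?P) $$ (i, j)"
    using ij by (simp add: ones_mat_def)
qed (simp_all add: spread_mat_def ones_mat_def)

theorem matrix_tree:
  assumes G: "simple_graph G" and n: "nv G > 0"
  shows "det (laplacian_mat G + ones_mat (nv G)) = (det (spread_mat (nv G)))\<^sup>2 * real (num_spanning_trees G)"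
proof -
  let ?P = "spread_mat (nv G)"
  have P: "?P \<in> carrier_mat (nv G) (nv G)" by (simp add: spread_mat_def)
  have M: "laplacian_mat G + root_mat (nv G) \<in> carrier_mat (nv G) (nv G)" by (simp add: root_mat_def)
  have "det (?P * (laplacian_mat G + root_mat (nv G)) * transpose_mat ?P)
      = det ?P * det (laplacian_mat G + root_mat (nv G)) * det ?P"
    using P M by (simp add: det_mult[of _ "nv G"] det_transpose)
  then show ?thesis
    by (simp add: laplacian_ones_eq_spread[OF G n] det_rooted_laplacian[OF G n] power2_eq_square)
qed

section \<open>Traces and determinants from the spectrum\<close>

lemma trace_mult_commute:
  fixes A B :: "'a::comm_semiring_0 mat"
  assumes A: "A \<in> carrier_mat n n" and B: "B \<in> carrier_mat n n"
  shows "(\<Sum>i<n. (A * B) $$ (i, i)) = (\<Sum>i<n. (B * A) $$ (i, i))"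
proof -
  have e: "(X * Y) $$ (i, i) = (\<Sum>k<n. X $$ (i, k) * Y $$ (k, i))"
    if "X \<in> carrier_mat n n" "Y \<in> carrier_mat n n" "i < n" for X Y :: "'a mat" and i
    using that by (auto simp: scalar_prod_def lessThan_atLeast0 intro!: sum.cong)
  have "(\<Sum>i<n. (A * B) $$ (i, i)) = (\<Sum>i<n. \<Sum>k<n. A $$ (i, k) * B $$ (k, i))"
    using e[OF A B] by simp
  also have "\<dots> = (\<Sum>k<n. \<Sum>i<n. B $$ (k, i) * A $$ (i, k))"
    by (subst sum.swap) (simp add: mult.commute)
  also have "\<dots> = (\<Sum>k<n. (B * A) $$ (k, k))" using e[OF B A] by simp
  finally show ?thesis .
qed

lemma upper_triangular_mult:
  fixes A B :: "'a::semiring_0 mat"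
  assumes A: "A \<in> carrier_mat n n" "upper_triangular A" and B: "B \<in> carrier_mat n n" "upper_triangular B"
  shows "upper_triangular (A * B)" "i < n \<Longrightarrow> (A * B) $$ (i, i) = A $$ (i, i) * B $$ (i, i)"
proof -
  have e: "(A * B) $$ (i, j) = (\<Sum>k<n. A $$ (i, k) * B $$ (k, j))" if "i < n" "j < n" for i j
    using that A(1) B(1) by (auto simp: scalar_prod_def lessThan_atLeast0 intro!: sum.cong)
  have z: "A $$ (i, k) * B $$ (k, j) = 0" if "i < n" "k < n" "k < i \<or> j < k" for i j k
    using that upper_triangularD[OF A(2), of k i] upper_triangularD[OF B(2), of j k] A(1) B(1) by auto
  show "upper_triangular (A * B)"
  proof (rule upper_triangularI)
    fix i j assume "j < i" "i < dim_row (A * B)"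
    then have "j < i" "i < n" using A(1) by auto
    moreover have "A $$ (i, k) * B $$ (k, j) = 0" if "k < n" for k
      using z[of i k j] that calculation by linarith
    ultimately show "(A * B) $$ (i, j) = 0" by (simp add: e)
  qed
  assume i: "i < n"
  have "(A * B) $$ (i, i) = (\<Sum>k\<in>{i}. A $$ (i, k) * B $$ (k, i))"
    unfolding e[OF i i] using i z[of i _ i] by (intro sum.mono_neutral_right) (auto simp: nat_neq_iff)
  then show "(A * B) $$ (i, i) = A $$ (i, i) * B $$ (i, i)" by simp
qed

lemma upper_triangular_pow:
  fixes A :: "'a::semiring_1 mat"
  assumes A: "A \<in> carrier_mat n n" "upper_triangular A"
  shows "upper_triangular (A ^\<^sub>m k) \<and> (\<forall>i<n. (A ^\<^sub>m k) $$ (i, i) = A $$ (i, i) ^ k)"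
proof (induction k)
  case 0
  then show ?case using A(1) by auto
next
  case (Suc k)
  then show ?case
    using upper_triangular_mult[OF pow_carrier_mat[OF A(1)] _ A, of k] by (simp add: power_commutes)
qed

text \<open>
  One triangularization serves all polynomials of degree one in \<open>A\<close>, so that a single list of
  eigenvalues computes every trace and determinant below.
\<close>

lemma affine_similar:
  fixes A :: "'a::comm_ring_1 mat"
  assumes A: "A \<in> carrier_mat n n" and s: "similar_mat_wit A B P Q"
  shows "similar_mat_wit (a \<cdot>\<^sub>m A + c \<cdot>\<^sub>m 1\<^sub>m n) (a \<cdot>\<^sub>m B + c \<cdot>\<^sub>m 1\<^sub>m n) P Q"
proof -
  note w = similar_mat_witD2[OF A s]
  have "P * (a \<cdot>\<^sub>m B + c \<cdot>\<^sub>m 1\<^sub>m n) * Q = (a \<cdot>\<^sub>m (P * B) + c \<cdot>\<^sub>m P) * Q"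
    using w by (simp add: mult_add_distrib_mat[of _ n n _ n] mult_smult_distrib[of _ n n _ n])
  also have "\<dots> = a \<cdot>\<^sub>m (P * B * Q) + c \<cdot>\<^sub>m (P * Q)"
    using w mult_carrier_mat[OF w(6) w(5)]
    by (simp add: add_mult_distrib_mat[of _ n n] mult_smult_assoc_mat[of _ n n _ n])
  finally show ?thesis
    using w by (intro similar_mat_witI[of _ _ n]) auto
qed

lemma complex_spectrum:
  fixes A :: "complex mat"
  assumes A: "A \<in> carrier_mat n n"
  obtains es where "length es = n" "char_poly A = (\<Prod>e\<leftarrow>es. [:- e, 1:])"
    "\<And>a c k. (\<Sum>i<n. ((a \<cdot>\<^sub>m A + c \<cdot>\<^sub>m 1\<^sub>m n) ^\<^sub>m k) $$ (i, i)) = (\<Sum>e\<leftarrow>es. (a * e + c) ^ k)"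
    "\<And>a c. det (a \<cdot>\<^sub>m A + c \<cdot>\<^sub>m 1\<^sub>m n) = (\<Prod>e\<leftarrow>es. a * e + c)"
proof -
  obtain es0 where "char_poly A = (\<Prod>e\<leftarrow>es0. [:- e, 1:])" using char_poly_factorized[OF A] by auto
  from schur_decomposition_exists[OF A this]
  obtain B where B: "B \<in> carrier_mat n n" "upper_triangular B" and sim: "similar_mat A B" by auto
  obtain P Q where s: "similar_mat_wit A B P Q" using sim by (auto simp: similar_mat_def)
  define es where "es = diag_mat B"
  have es: "length es = n" "\<And>i. i < n \<Longrightarrow> es ! i = B $$ (i, i)" using B(1) by (auto simp: es_def diag_mat_def)
  show thesis
  proof (rule that[of es])
    show "length es = n" by fact
    show "char_poly A = (\<Prod>e\<leftarrow>es. [:- e, 1:])"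
      using char_poly_similar[OF sim] char_poly_upper_triangular[OF B] by (simp add: es_def)
    fix a c :: complex
    let ?A = "a \<cdot>\<^sub>m A + c \<cdot>\<^sub>m 1\<^sub>m n" and ?B = "a \<cdot>\<^sub>m B + c \<cdot>\<^sub>m 1\<^sub>m n"
    have cA: "?A \<in> carrier_mat n n" and cB: "?B \<in> carrier_mat n n" using A B by auto
    have tB: "upper_triangular ?B" using B by (auto intro!: upper_triangularI dest: upper_triangularD)
    have dB: "?B $$ (i, i) = a * es ! i + c" if "i < n" for i using that B(1) es by simp
    note sAB = affine_similar[OF A s, of a c]
    have "det ?A = det ?B" using sAB by (intro det_similar) (auto simp: similar_mat_def)
    also have "\<dots> = prod_list (diag_mat ?B)" by (rule det_upper_triangular[OF tB cB])
    also have "diag_mat ?B = map (\<lambda>e. a * e + c) es"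
      using dB B(1) es by (intro nth_equalityI) (auto simp: diag_mat_def)
    finally show "det ?A = (\<Prod>e\<leftarrow>es. a * e + c)" .
    fix k
    note w = similar_mat_witD2[OF pow_carrier_mat[OF cA, of k] similar_mat_wit_pow[OF sAB, of k]]
    have "(\<Sum>i<n. (?A ^\<^sub>m k) $$ (i, i)) = (\<Sum>i<n. (P * ?B ^\<^sub>m k * Q) $$ (i, i))" using w(3) by simp
    also have "\<dots> = (\<Sum>i<n. (Q * (P * ?B ^\<^sub>m k)) $$ (i, i))"
      using w by (intro trace_mult_commute) auto
    also have "Q * (P * ?B ^\<^sub>m k) = ?B ^\<^sub>m k"
      using w by (simp flip: assoc_mult_mat[of Q n n P n _ n])
    also have "(\<Sum>i<n. (?B ^\<^sub>m k) $$ (i, i)) = (\<Sum>i<n. (a * es ! i + c) ^ k)"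
      using upper_triangular_pow[OF cB tB, of k] dB by auto
    also have "\<dots> = (\<Sum>e\<leftarrow>es. (a * e + c) ^ k)"
      by (simp add: sum_list_sum_nth es lessThan_atLeast0)
    finally show "(\<Sum>i<n. (?A ^\<^sub>m k) $$ (i, i)) = (\<Sum>e\<leftarrow>es. (a * e + c) ^ k)" .
  qed
qed

section \<open>The Laplacian spectrum\<close>

text \<open>
  For \<open>s = 1\<close> the right-hand side is twice the quadratic form of the weighted Laplacian, for \<open>s = -1\<close>
  that of the signless one; the left-hand side shows that both are nonnegative for nonnegative weights.
\<close>

lemma weighted_quadratic_form:
  fixes x :: "nat \<Rightarrow> complex" and w :: "nat \<Rightarrow> nat \<Rightarrow> real"
  assumes sym: "\<And>i j. w i j = w j i" and s: "s * s = 1"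
  shows "(\<Sum>i<n. \<Sum>j<n. complex_of_real (w i j * (cmod (x i - of_real s * x j))\<^sup>2))
    = 2 * (\<Sum>i<n. cnj (x i) * (of_real (\<Sum>j<n. w i j) * x i - of_real s * (\<Sum>j<n. of_real (w i j) * x j)))"
proof -
  let ?T = "\<lambda>i j. of_real (w i j) * (cnj (x i) * x i - of_real s * cnj (x i) * x j)"
  have "complex_of_real (w i j * (cmod (x i - of_real s * x j))\<^sup>2) = ?T i j + ?T j i" for i j
  proof -
    have ss: "complex_of_real s * (complex_of_real s * z) = z" for z
      using s by (metis mult.assoc mult_1 of_real_1 of_real_mult)
    have "complex_of_real (w i j * (cmod (x i - of_real s * x j))\<^sup>2)
        = of_real (w i j) * ((x i - of_real s * x j) * cnj (x i - of_real s * x j))"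
      by (simp only: of_real_mult complex_norm_square)
    also have "\<dots> = of_real (w i j) * (x i * cnj (x i) + of_real s * (of_real s * (x j * cnj (x j)))
        - of_real s * x j * cnj (x i) - of_real s * x i * cnj (x j))"
      by (simp add: algebra_simps)
    also have "\<dots> = ?T i j + ?T j i" unfolding ss sym[of j i] by (simp add: algebra_simps)
    finally show ?thesis .
  qed
  then have "(\<Sum>i<n. \<Sum>j<n. complex_of_real (w i j * (cmod (x i - of_real s * x j))\<^sup>2))
      = (\<Sum>i<n. \<Sum>j<n. ?T i j) + (\<Sum>i<n. \<Sum>j<n. ?T j i)"
    by (simp add: sum.distrib)
  also have "(\<Sum>i<n. \<Sum>j<n. ?T j i) = (\<Sum>i<n. \<Sum>j<n. ?T i j)" by (rule sum.swap)
  finally have "(\<Sum>i<n. \<Sum>j<n. complex_of_real (w i j * (cmod (x i - of_real s * x j))\<^sup>2))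
      = 2 * (\<Sum>i<n. \<Sum>j<n. ?T i j)" by simp
  moreover have "(\<Sum>j<n. ?T i j) = cnj (x i) * (of_real (\<Sum>j<n. w i j) * x i - of_real s * (\<Sum>j<n. of_real (w i j) * x j))" for i
    by (simp add: algebra_simps sum_distrib_left sum_subtractf)
  ultimately show ?thesis by simp
qed

definition index_adj :: "'a sgraph \<Rightarrow> nat \<Rightarrow> nat \<Rightarrow> real" where
  "index_adj G i j = (if {vertex_list G ! i, vertex_list G ! j} \<in> edges G then 1 else 0)"

lemma index_adj_sym: "index_adj G i j = index_adj G j i"
  by (simp add: index_adj_def insert_commute)

lemma sum_index_adj:
  assumes G: "simple_graph G" and i: "i < nv G"
  shows "(\<Sum>j<nv G. index_adj G i j) = real (deg G (vertex_list G ! i))"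
proof -
  have fin: "finite (verts G)" using G by (simp add: simple_graph_def)
  let ?u = "vertex_list G ! i"
  have "(\<Sum>j<nv G. index_adj G i j) = (\<Sum>v\<in>verts G. if {?u, v} \<in> edges G then 1 else 0)"
    unfolding index_adj_def lessThan_atLeast0
    by (rule sum_vertex_list[OF fin, of "\<lambda>v. if {?u, v} \<in> edges G then 1 else 0"])
  also have "\<dots> = real (card (nbrs G ?u))" using fin by (simp add: sum.If_cases nbrs_def Int_def)
  finally show ?thesis by (simp add: deg_eq_card_nbrs[OF G])
qed

text \<open>
  Rayleigh quotients. The lower bound is positivity of the Laplacian, the bound \<open>n\<close> compares
  with the complete graph, and the bound \<open>2d\<close> is positivity of the signless Laplacian.
\<close>

lemma laplacian_eigenvalue_bounds:
  assumes G: "simple_graph G"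
    and ev: "eigenvector (map_mat complex_of_real (laplacian_mat G)) v e"
  shows "e \<in> \<real>" "0 \<le> Re e" "Re e \<le> real (nv G)" "regular_graph d G \<Longrightarrow> Re e \<le> 2 * real d"
proof -
  let ?n = "nv G"
  define x where "x i = v $ i" for i
  define w where "w = index_adj G"
  have v: "v \<in> carrier_vec ?n" "v \<noteq> 0\<^sub>v ?n"
    and eq: "map_mat complex_of_real (laplacian_mat G) *\<^sub>v v = e \<cdot>\<^sub>v v"
    using ev by (auto simp: eigenvector_def)
  define Q where "Q = (\<Sum>i<?n. (cmod (x i))\<^sup>2)"
  have Q0: "Q > 0"
  proof -
    have "\<exists>i<?n. x i \<noteq> 0"
    proof (rule ccontr)
      assume "\<not> ?thesis"
      then have "v = 0\<^sub>v ?n" using v(1) by (intro eq_vecI) (auto simp: x_def)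
      then show False using v(2) by simp
    qed
    then obtain i where "i < ?n" "x i \<noteq> 0" by blast
    then show ?thesis unfolding Q_def by (intro sum_pos2[of _ i]) auto
  qed
  have fin: "finite (verts G)" using G by (simp add: simple_graph_def)
  have row: "of_real (\<Sum>j<?n. w i j) * x i - (\<Sum>j<?n. of_real (w i j) * x j) = e * x i" if i: "i < ?n" for i
  proof -
    have vs: "vertex_list G ! i = vertex_list G ! j \<longleftrightarrow> i = j" if "j < ?n" for j
      using vertex_list[OF fin] i that by (simp add: nth_eq_iff_index_eq)
    have L: "laplacian_mat G $$ (i, j) = (if i = j then (\<Sum>j<?n. w i j) else 0) - w i j" if "j < ?n" for j
      using i that vs[OF that]
      by (simp add: laplacian_mat_index[OF G] lap_def w_def sum_index_adj[OF G]) (simp add: index_adj_def)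
    have "e * x i = (e \<cdot>\<^sub>v v) $ i" using i v(1) by (simp add: x_def)
    also have "\<dots> = (map_mat complex_of_real (laplacian_mat G) *\<^sub>v v) $ i" by (simp only: eq)
    also have "\<dots> = (\<Sum>j<?n. complex_of_real (laplacian_mat G $$ (i, j)) * x j)"
      using i v(1) by (auto simp: scalar_prod_def x_def lessThan_atLeast0 intro!: sum.cong)
    also have "\<dots> = (\<Sum>j<?n. (if i = j then of_real (\<Sum>j<?n. w i j) * x j else 0) - of_real (w i j) * x j)"
      by (intro sum.cong refl) (simp add: L left_diff_distrib)
    also have "\<dots> = of_real (\<Sum>j<?n. w i j) * x i - (\<Sum>j<?n. of_real (w i j) * x j)"
      using i by (simp add: sum_subtractf)
    finally show ?thesis by simp
  qed
  have xQ: "(\<Sum>i<?n. cnj (x i) * (z * x i)) = z * of_real Q" for z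
  proof -
    have "cnj (x i) * (z * x i) = z * of_real ((cmod (x i))\<^sup>2)" for i
      using complex_norm_square[of "x i"] by (simp add: algebra_simps del: of_real_power)
    then have "(\<Sum>i<?n. cnj (x i) * (z * x i)) = (\<Sum>i<?n. z * of_real ((cmod (x i))\<^sup>2))"
      by (intro sum.cong refl)
    then show ?thesis by (simp add: Q_def sum_distrib_left)
  qed
  have wsym: "w i j = w j i" for i j by (simp add: w_def index_adj_sym)
  define D where "D = (\<Sum>i<?n. \<Sum>j<?n. w i j * (cmod (x i - x j))\<^sup>2)"
  have D: "complex_of_real D = 2 * (e * of_real Q)"
    using weighted_quadratic_form[of w 1 x ?n, OF wsym] row xQ[of e] by (simp add: D_def)
  have w01: "0 \<le> w i j" "w i j \<le> 1" for i j by (simp_all add: w_def index_adj_def)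
  have e_eq: "e = of_real (D / (2 * Q))" using D Q0 by (simp add: field_simps)
  show "e \<in> \<real>" unfolding e_eq by (rule Reals_of_real)
  have Re: "Re e = D / (2 * Q)" unfolding e_eq by (rule Re_complex_of_real)
  have "0 \<le> D" unfolding D_def using w01 by (intro sum_nonneg) auto
  then show "0 \<le> Re e" using Q0 Re by simp
  show "Re e \<le> real ?n"
  proof -
    define F where "F = (\<Sum>i<?n. \<Sum>j<?n. (cmod (x i - x j))\<^sup>2)"
    define S where "S = (\<Sum>i<?n. x i)"
    have "complex_of_real F = 2 * (\<Sum>i<?n. cnj (x i) * (of_nat ?n * x i - S))"
      using weighted_quadratic_form[of "\<lambda>_ _. 1" 1 x ?n] by (simp add: F_def S_def)
    also have "\<dots> = 2 * (of_nat ?n * of_real Q - cnj S * S)"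
      using xQ[of "of_nat ?n"]
      by (simp add: right_diff_distrib sum_subtractf sum_distrib_right[symmetric]) (simp add: S_def)
    also have "\<dots> = of_real (2 * (real ?n * Q - (cmod S)\<^sup>2))"
      using complex_norm_square[of S] by (simp add: mult.commute)
    finally have "F = 2 * (real ?n * Q - (cmod S)\<^sup>2)" by (simp only: of_real_eq_iff)
    moreover have "D \<le> F" unfolding D_def F_def using w01
      by (intro sum_mono) (simp add: mult_left_le_one_le)
    ultimately have "D \<le> 2 * (real ?n * Q)" by (smt (verit) zero_le_power2)
    then have "D / (2 * Q) \<le> real ?n"
      using Q0 by (subst pos_divide_le_eq) (simp_all add: mult_ac)
    then show ?thesis by (simp add: Re)
  qed
  assume reg: "regular_graph d G"
  define P where "P = (\<Sum>i<?n. \<Sum>j<?n. w i j * (cmod (x i + x j))\<^sup>2)"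
  have dg: "(\<Sum>j<?n. w i j) = real d" if "i < ?n" for i
    using reg that vertex_list[OF fin] nth_mem[of i "vertex_list G"]
    by (simp add: w_def sum_index_adj[OF G] regular_graph_def)
  have "complex_of_real P = 2 * (\<Sum>i<?n. cnj (x i) * (of_real (\<Sum>j<?n. w i j) * x i + (\<Sum>j<?n. of_real (w i j) * x j)))"
    using weighted_quadratic_form[of w "-1" x ?n, OF wsym] by (simp add: P_def)
  also have "\<dots> = 2 * (\<Sum>i<?n. cnj (x i) * ((2 * of_nat d - e) * x i))"
  proof (intro arg_cong[where f = "\<lambda>t. 2 * t"] sum.cong refl)
    fix i assume "i \<in> {..<?n}"
    then have i: "i < ?n" by simp
    have wx: "(\<Sum>j<?n. of_real (w i j) * x j) = of_nat d * x i - e * x i"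
      using row[OF i] dg[OF i] by (simp add: algebra_simps)
    show "cnj (x i) * (of_real (\<Sum>j<?n. w i j) * x i + (\<Sum>j<?n. of_real (w i j) * x j))
        = cnj (x i) * ((2 * of_nat d - e) * x i)"
      unfolding wx dg[OF i] by (simp add: algebra_simps)
  qed
  also have "\<dots> = 2 * ((2 * of_nat d - of_real (Re e)) * of_real Q)" using xQ e_eq Re by simp
  also have "\<dots> = of_real (2 * ((2 * real d - Re e) * Q))" by simp
  finally have "P = 2 * ((2 * real d - Re e) * Q)" by (simp only: of_real_eq_iff)
  moreover have "0 \<le> P" unfolding P_def using w01 by (intro sum_nonneg) auto
  ultimately show "Re e \<le> 2 * real d" using Q0 by (simp add: zero_le_mult_iff)
qed

definition int_laplacian :: "'a sgraph \<Rightarrow> int mat" where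
  "int_laplacian G = mat (nv G) (nv G) (\<lambda>(i, j). lap G (vertex_list G ! i) (vertex_list G ! j))"

lemma laplacian_eq_int_laplacian:
  assumes "simple_graph G"
  shows "laplacian_mat G = map_mat real_of_int (int_laplacian G)"
  using laplacian_mat_index[OF assms] by (intro eq_matI) (auto simp: int_laplacian_def)

text \<open>
  The Laplacian eigenvalues with multiplicity. The characteristic polynomial is recorded over the integers
  because the bound on the number of exceptional eigenvalues rests on the integrality of its coefficients;
  the shift \<open>c\<close> in the traces is there for the adjacency matrices of complements.
\<close>

definition laplacian_spectrum :: "'a sgraph \<Rightarrow> real list \<Rightarrow> bool" where
  "laplacian_spectrum G es \<longleftrightarrow> length es = nv G
     \<and> (\<forall>e\<in>set es. 0 \<le> e \<and> e \<le> real (nv G))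
     \<and> (\<forall>d. regular_graph d G \<longrightarrow> (\<forall>e\<in>set es. e \<le> 2 * real d))
     \<and> map_poly real_of_int (char_poly (int_laplacian G)) = (\<Prod>e\<leftarrow>es. [:- e, 1:])
     \<and> (\<forall>c k. mat_trace ((laplacian_mat G + c \<cdot>\<^sub>m 1\<^sub>m (nv G)) ^\<^sub>m k) = (\<Sum>e\<leftarrow>es. (e + c) ^ k))
     \<and> (\<forall>c. det (c \<cdot>\<^sub>m 1\<^sub>m (nv G) - laplacian_mat G) = (\<Prod>e\<leftarrow>es. c - e))"

lemma laplacian_spectrum_exists:
  assumes G: "simple_graph G"
  shows "\<exists>es. laplacian_spectrum G es"
proof -
  let ?n = "nv G" and ?L = "laplacian_mat G"
  define A where "A = map_mat complex_of_real ?L"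
  have A: "A \<in> carrier_mat ?n ?n" by (simp add: A_def)
  obtain cs where len: "length cs = ?n" and cp: "char_poly A = (\<Prod>e\<leftarrow>cs. [:- e, 1:])"
    and tr: "\<And>a c k. (\<Sum>i<?n. ((a \<cdot>\<^sub>m A + c \<cdot>\<^sub>m 1\<^sub>m ?n) ^\<^sub>m k) $$ (i, i)) = (\<Sum>e\<leftarrow>cs. (a * e + c) ^ k)"
    and dt: "\<And>a c. det (a \<cdot>\<^sub>m A + c \<cdot>\<^sub>m 1\<^sub>m ?n) = (\<Prod>e\<leftarrow>cs. a * e + c)"
    by (rule complex_spectrum[OF A]) (erule meta_allE, (erule meta_impE, assumption)+, assumption)
  have bounds: "e \<in> \<real> \<and> 0 \<le> Re e \<and> Re e \<le> real ?n \<and> (\<forall>d. regular_graph d G \<longrightarrow> Re e \<le> 2 * real d)"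
    if "e \<in> set cs" for e
  proof -
    have "poly (char_poly A) e = 0" unfolding cp using that by (induction cs) auto
    then obtain v where "eigenvector A v e"
      using eigenvalue_root_char_poly[OF A] by (auto simp: eigenvalue_def)
    from laplacian_eigenvalue_bounds[OF G this[unfolded A_def]] show ?thesis by blast
  qed
  define es where "es = map Re cs"
  have cs: "cs = map complex_of_real es"
    using bounds by (auto simp: es_def o_def intro!: map_idI[symmetric])
  have affine: "complex_of_real a \<cdot>\<^sub>m A + complex_of_real c \<cdot>\<^sub>m 1\<^sub>m ?n
      = map_mat complex_of_real (a \<cdot>\<^sub>m ?L + c \<cdot>\<^sub>m 1\<^sub>m ?n)" for a c
    by (rule eq_matI) (auto simp: A_def)
  have sum_of_real: "(\<Sum>e\<leftarrow>cs. (of_real a * e + of_real c) ^ k) = complex_of_real (\<Sum>e\<leftarrow>es. (a * e + c) ^ k)" for a c k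
    unfolding cs by (induction es) simp_all
  have prod_of_real: "(\<Prod>e\<leftarrow>cs. of_real a * e + of_real c) = complex_of_real (\<Prod>e\<leftarrow>es. a * e + c)" for a c
    unfolding cs by (induction es) simp_all
  have car: "a \<cdot>\<^sub>m ?L + c \<cdot>\<^sub>m 1\<^sub>m ?n \<in> carrier_mat ?n ?n" for a c by simp
  have tr': "mat_trace ((?L + c \<cdot>\<^sub>m 1\<^sub>m ?n) ^\<^sub>m k) = (\<Sum>e\<leftarrow>es. (e + c) ^ k)" for c k
  proof -
    let ?M = "1 \<cdot>\<^sub>m ?L + c \<cdot>\<^sub>m 1\<^sub>m ?n"
    have pc: "?M ^\<^sub>m k \<in> carrier_mat ?n ?n" by (rule pow_carrier_mat[OF car])
    have "complex_of_real (mat_trace (?M ^\<^sub>m k)) = (\<Sum>i<?n. map_mat complex_of_real (?M ^\<^sub>m k) $$ (i, i))"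
      using pc by (auto simp: mat_trace_def)
    also have "\<dots> = (\<Sum>e\<leftarrow>cs. (of_real 1 * e + of_real c) ^ k)"
      unfolding of_real_hom.mat_hom_pow[OF car] affine[symmetric] by (rule tr)
    also have "\<dots> = complex_of_real (\<Sum>e\<leftarrow>es. (1 * e + c) ^ k)" by (rule sum_of_real)
    finally have "mat_trace (?M ^\<^sub>m k) = (\<Sum>e\<leftarrow>es. (1 * e + c) ^ k)" by (simp only: of_real_eq_iff)
    moreover have "1 \<cdot>\<^sub>m ?L = ?L" by (rule eq_matI) auto
    ultimately show ?thesis by simp
  qed
  have dt': "det (c \<cdot>\<^sub>m 1\<^sub>m ?n - ?L) = (\<Prod>e\<leftarrow>es. c - e)" for c
  proof -
    have "complex_of_real (det ((-1) \<cdot>\<^sub>m ?L + c \<cdot>\<^sub>m 1\<^sub>m ?n)) = (\<Prod>e\<leftarrow>cs. of_real (-1) * e + of_real c)"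
      unfolding of_real_hom.hom_det[symmetric] affine[symmetric] by (rule dt)
    also have "\<dots> = complex_of_real (\<Prod>e\<leftarrow>es. (-1) * e + c)" by (rule prod_of_real)
    finally have "det ((-1) \<cdot>\<^sub>m ?L + c \<cdot>\<^sub>m 1\<^sub>m ?n) = (\<Prod>e\<leftarrow>es. (-1) * e + c)" by (simp only: of_real_eq_iff)
    moreover have "(-1) \<cdot>\<^sub>m ?L + c \<cdot>\<^sub>m 1\<^sub>m ?n = c \<cdot>\<^sub>m 1\<^sub>m ?n - ?L" by (rule eq_matI) auto
    ultimately show ?thesis by simp
  qed
  have I: "int_laplacian G \<in> carrier_mat ?n ?n" by (simp add: int_laplacian_def)
  have "A = map_mat complex_of_int (int_laplacian G)"
    unfolding A_def laplacian_eq_int_laplacian[OF G] by (rule eq_matI) auto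
  then have "char_poly A = map_poly complex_of_int (char_poly (int_laplacian G))"
    using of_int_hom.char_poly_hom[OF I] by simp
  also have "\<dots> = map_poly complex_of_real (map_poly real_of_int (char_poly (int_laplacian G)))"
    by (subst map_poly_map_poly) (auto simp: o_def)
  finally have cpA: "char_poly A = map_poly complex_of_real (map_poly real_of_int (char_poly (int_laplacian G)))" .
  then have "map_poly complex_of_real (map_poly real_of_int (char_poly (int_laplacian G)))
      = map_poly complex_of_real (\<Prod>e\<leftarrow>es. [:- e, 1:])"
  proof -
    interpret mp: map_poly_comm_ring_hom complex_of_real ..
    have "(\<Prod>e\<leftarrow>map complex_of_real es. [:- e, 1:]) = map_poly complex_of_real (\<Prod>e\<leftarrow>es. [:- e, 1:])"
      by (induction es) (simp_all add: mp.hom_mult del: mult_pCons_left)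
    then show ?thesis using cpA unfolding cp cs by simp
  qed
  then have cp': "map_poly real_of_int (char_poly (int_laplacian G)) = (\<Prod>e\<leftarrow>es. [:- e, 1:])"
    by (simp add: poly_eq_iff coeff_map_poly del: of_real_of_int_eq)
  show ?thesis
    unfolding laplacian_spectrum_def
    using len bounds tr' dt' cp' by (intro exI[of _ es]) (auto simp: es_def)
qed

section \<open>Laplacian traces as integers\<close>

lemma lap_trace_spectrum:
  assumes "laplacian_spectrum G es"
  shows "lap_trace G k = (\<Sum>e\<leftarrow>es. e ^ k)"
proof -
  have "laplacian_mat G + 0 \<cdot>\<^sub>m 1\<^sub>m (nv G) = laplacian_mat G" by (rule eq_matI) auto
  moreover have "mat_trace ((laplacian_mat G + 0 \<cdot>\<^sub>m 1\<^sub>m (nv G)) ^\<^sub>m k) = (\<Sum>e\<leftarrow>es. (e + 0) ^ k)"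
    using assms unfolding laplacian_spectrum_def by blast
  ultimately show ?thesis by (simp add: lap_trace_def)
qed

text \<open>
  Matrix powers with rows and columns indexed by \<open>V\<close>, which makes disjoint unions and isomorphisms
  easy to follow.
\<close>

fun kernel_power :: "'a set \<Rightarrow> ('a \<Rightarrow> 'a \<Rightarrow> int) \<Rightarrow> nat \<Rightarrow> 'a \<Rightarrow> 'a \<Rightarrow> int" where
  "kernel_power V M 0 u v = (if u = v then 1 else 0)"
| "kernel_power V M (Suc k) u v = (\<Sum>w\<in>V. kernel_power V M k u w * M w v)"

definition walk_trace :: "'a sgraph \<Rightarrow> nat \<Rightarrow> int" where
  "walk_trace G k = (\<Sum>v\<in>verts G. kernel_power (verts G) (lap G) k v v)"

lemma laplacian_pow_index:
  assumes G: "simple_graph G" and i: "i < nv G" and j: "j < nv G"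
  shows "(laplacian_mat G ^\<^sub>m k) $$ (i, j)
    = of_int (kernel_power (verts G) (lap G) k (vertex_list G ! i) (vertex_list G ! j))"
  using j
proof (induction k arbitrary: j)
  case 0
  have fin: "finite (verts G)" using G by (simp add: simple_graph_def)
  have "vertex_list G ! i = vertex_list G ! j \<longleftrightarrow> i = j"
    using vertex_list[OF fin] i 0 by (simp add: nth_eq_iff_index_eq)
  then show ?case using i 0 by simp
next
  case (Suc k)
  have fin: "finite (verts G)" using G by (simp add: simple_graph_def)
  have "(laplacian_mat G ^\<^sub>m Suc k) $$ (i, j)
      = (\<Sum>l = 0..<nv G. (laplacian_mat G ^\<^sub>m k) $$ (i, l) * laplacian_mat G $$ (l, j))"
    using i Suc.prems pow_carrier_mat[OF laplacian_mat_carrier[of G], of k]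
    by (auto simp: scalar_prod_def intro!: sum.cong)
  also have "\<dots> = (\<Sum>l = 0..<nv G. of_int (kernel_power (verts G) (lap G) k (vertex_list G ! i) (vertex_list G ! l)
      * lap G (vertex_list G ! l) (vertex_list G ! j)))"
    using Suc by (intro sum.cong) (auto simp: laplacian_mat_index[OF G])
  also have "\<dots> = (\<Sum>w\<in>verts G. of_int (kernel_power (verts G) (lap G) k (vertex_list G ! i) w
      * lap G w (vertex_list G ! j)))"
    by (rule sum_vertex_list[OF fin])
  finally show ?case by simp
qed

lemma lap_trace_eq_walk_trace:
  assumes G: "simple_graph G"
  shows "lap_trace G k = of_int (walk_trace G k)"
proof -
  have fin: "finite (verts G)" using G by (simp add: simple_graph_def)
  have "lap_trace G k = (\<Sum>i = 0..<nv G. (laplacian_mat G ^\<^sub>m k) $$ (i, i))"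
    using pow_carrier_mat[OF laplacian_mat_carrier[of G], of k]
    by (auto simp: lap_trace_def mat_trace_def lessThan_atLeast0)
  also have "\<dots> = (\<Sum>i = 0..<nv G. of_int (kernel_power (verts G) (lap G) k (vertex_list G ! i) (vertex_list G ! i)))"
    using laplacian_pow_index[OF G] by simp
  also have "\<dots> = (\<Sum>v\<in>verts G. of_int (kernel_power (verts G) (lap G) k v v))"
    by (rule sum_vertex_list[OF fin])
  finally show ?thesis by (simp add: walk_trace_def)
qed

lemma sum_deg:
  assumes G: "simple_graph G"
  shows "(\<Sum>v\<in>verts G. deg G v) = 2 * ne G"
proof -
  have fin: "finite (verts G)" and E: "edges G \<subseteq> all_pairs (verts G)" using G by (auto simp: simple_graph_def)
  have finE: "finite (edges G)"
    by (rule finite_subset[OF E]) (simp add: all_pairs_def fin)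
  have "(\<Sum>v\<in>verts G. deg G v) = (\<Sum>v\<in>verts G. \<Sum>e\<in>edges G. if v \<in> e then 1 else 0)"
    using finE by (simp add: deg_def sum.If_cases Int_def)
  also have "\<dots> = (\<Sum>e\<in>edges G. \<Sum>v\<in>verts G. if v \<in> e then 1 else 0)" by (rule sum.swap)
  also have "\<dots> = (\<Sum>e\<in>edges G. 2)"
  proof (intro sum.cong refl)
    fix e assume "e \<in> edges G"
    then have e: "e \<subseteq> verts G" "card e = 2" using E by (auto simp: all_pairs_def)
    have "(\<Sum>v\<in>verts G. if v \<in> e then 1 else 0 :: nat) = card (verts G \<inter> e)"
      using fin by (simp add: sum.If_cases)
    also have "verts G \<inter> e = e" using e(1) by blast
    finally show "(\<Sum>v\<in>verts G. if v \<in> e then 1 else 0 :: nat) = 2" using e(2) by simp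
  qed
  finally show ?thesis by (simp add: ne_def)
qed

lemma lap_diag:
  assumes "simple_graph G"
  shows "lap G v v = int (deg G v)"
  using edge_in_verts(3)[OF assms, of v v] by (auto simp: lap_def)

lemma walk_trace_1:
  assumes G: "simple_graph G"
  shows "walk_trace G 1 = 2 * int (ne G)"
proof -
  have fin: "finite (verts G)" using G by (simp add: simple_graph_def)
  have "kernel_power (verts G) (lap G) 1 v v = int (deg G v)" if "v \<in> verts G" for v
  proof -
    have "kernel_power (verts G) (lap G) 1 v v = (\<Sum>w\<in>verts G. if v = w then lap G w v else 0)"
      by (auto intro!: sum.cong)
    also have "\<dots> = int (deg G v)" using fin that by (simp add: lap_diag[OF G])
    finally show ?thesis .
  qed
  then have "walk_trace G 1 = (\<Sum>v\<in>verts G. int (deg G v))" by (simp add: walk_trace_def)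
  also have "\<dots> = 2 * int (ne G)" using arg_cong[OF sum_deg[OF G], of int] by simp
  finally show ?thesis .
qed

lemma walk_trace_2:
  assumes G: "simple_graph G"
  shows "walk_trace G 2 = (\<Sum>v\<in>verts G. (int (deg G v))\<^sup>2) + 2 * int (ne G)"
proof -
  have fin: "finite (verts G)" using G by (simp add: simple_graph_def)
  have "kernel_power (verts G) (lap G) 2 v v = (int (deg G v))\<^sup>2 + int (deg G v)" if v: "v \<in> verts G" for v
  proof -
    have "kernel_power (verts G) (lap G) 1 v w = lap G v w" if "w \<in> verts G" for w
    proof -
      have "kernel_power (verts G) (lap G) 1 v w = (\<Sum>u\<in>verts G. if v = u then lap G u w else 0)"
        by (auto intro!: sum.cong)
      then show ?thesis using fin v by simp
    qed
    then have "kernel_power (verts G) (lap G) 2 v v = (\<Sum>w\<in>verts G. lap G v w * lap G w v)"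
      by (simp add: numeral_2_eq_2)
    also have "\<dots> = (\<Sum>w\<in>verts G. (if v = w then (int (deg G v))\<^sup>2 else 0) + (if {v, w} \<in> edges G then 1 else 0))"
      using edge_in_verts(3)[OF G, of v v]
      by (intro sum.cong refl) (auto simp: lap_def insert_commute power2_eq_square)
    also have "\<dots> = (int (deg G v))\<^sup>2 + int (card (nbrs G v))"
      using fin v by (simp add: sum.distrib sum.If_cases nbrs_def Int_def)
    finally show ?thesis by (simp add: deg_eq_card_nbrs[OF G])
  qed
  then have "walk_trace G 2 = (\<Sum>v\<in>verts G. (int (deg G v))\<^sup>2) + (\<Sum>v\<in>verts G. int (deg G v))"
    by (simp add: walk_trace_def sum.distrib)
  also have "(\<Sum>v\<in>verts G. int (deg G v)) = 2 * int (ne G)"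
    using arg_cong[OF sum_deg[OF G], of int] by simp
  finally show ?thesis .
qed

lemma regular_ne:
  assumes "regular_graph d G"
  shows "2 * ne G = nv G * d"
proof -
  have "(\<Sum>v\<in>verts G. deg G v) = (\<Sum>v\<in>verts G. d)"
    using assms by (intro sum.cong) (auto simp: regular_graph_def)
  then show ?thesis using sum_deg[of G] assms by (simp add: regular_graph_def nv_def)
qed

lemma regular_walk_trace_2:
  assumes "regular_graph d G"
  shows "walk_trace G 2 = int (nv G * d * (d + 1))"
proof -
  have G: "simple_graph G" and "\<And>v. v \<in> verts G \<Longrightarrow> deg G v = d" using assms by (auto simp: regular_graph_def)
  then have "walk_trace G 2 = int (nv G) * (int d)\<^sup>2 + int (2 * ne G)"
    by (simp add: walk_trace_2 nv_def)
  then show ?thesis unfolding regular_ne[OF assms] by (simp add: power2_eq_square algebra_simps)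
qed

text \<open>
  The sum of \<open>(deg v - d)\<^sup>2\<close> is positive.
\<close>

lemma irregular_walk_trace_2:
  assumes H: "simple_graph H" and ne: "2 * ne H = nv H * d" and irr: "\<not> regular_graph d H"
  shows "int (nv H * d * (d + 1)) < walk_trace H 2"
proof -
  let ?x = "\<lambda>v. int (deg H v)"
  have fin: "finite (verts H)" using H by (simp add: simple_graph_def)
  obtain v where v: "v \<in> verts H" "deg H v \<noteq> d" using irr H by (auto simp: regular_graph_def)
  have s1: "(\<Sum>v\<in>verts H. ?x v) = int (nv H * d)"
    using arg_cong[OF sum_deg[OF H], of int] ne by simp
  have "0 < (\<Sum>v\<in>verts H. (?x v - int d)\<^sup>2)"
    using fin v by (intro sum_pos2[of _ v]) auto
  also have "\<dots> = (\<Sum>v\<in>verts H. (?x v)\<^sup>2 - 2 * int d * ?x v + (int d)\<^sup>2)"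
    by (intro sum.cong) (auto simp: power2_eq_square algebra_simps)
  also have "\<dots> = (\<Sum>v\<in>verts H. (?x v)\<^sup>2) - 2 * int d * int (nv H * d) + int (nv H) * (int d)\<^sup>2"
    by (simp add: sum.distrib sum_subtractf sum_distrib_left[symmetric] s1 nv_def)
  finally have "int (nv H) * (int d)\<^sup>2 < (\<Sum>v\<in>verts H. (?x v)\<^sup>2)"
    by (simp add: power2_eq_square mult_ac)
  moreover have "2 * int (ne H) = int (nv H * d)" using arg_cong[OF ne, of int] by simp
  ultimately show ?thesis by (simp add: walk_trace_2[OF H] power2_eq_square algebra_simps)
qed

section \<open>Adding disjoint cliques\<close>

lemma pair_image_iff:
  assumes "inj f"
  shows "{f u, f v} \<in> (\<lambda>e. f ` e) ` E \<longleftrightarrow> {u, v} \<in> E"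
proof
  assume "{f u, f v} \<in> (\<lambda>e. f ` e) ` E"
  then obtain e where e: "{f u, f v} = f ` e" "e \<in> E" by (elim imageE)
  then have "f ` {u, v} = f ` e" by simp
  then have "{u, v} = e" by (simp only: inj_image_eq_iff[OF assms])
  then show "{u, v} \<in> E" using e(2) by simp
next
  assume "{u, v} \<in> E"
  then have "f ` {u, v} \<in> (\<lambda>e. f ` e) ` E" by (rule imageI)
  then show "{f u, f v} \<in> (\<lambda>e. f ` e) ` E" by simp
qed

lemma add_cliques_verts: "verts (add_cliques G0 d p) = verts G0 <+> {..<p} \<times> {..<d + 1}"
  by (simp add: add_cliques_def disjoint_union_def copies_def complete_graph_def)

lemma add_cliques_edges:
  "{Inl u, Inl v} \<in> edges (add_cliques G0 d p) \<longleftrightarrow> {u, v} \<in> edges G0"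
  "{Inl u, Inr y} \<notin> edges (add_cliques G0 d p)"
  "{Inr y, Inl u} \<notin> edges (add_cliques G0 d p)"
  "{Inr (i, a), Inr (j, b)} \<in> edges (add_cliques G0 d p)
     \<longleftrightarrow> i = j \<and> i < p \<and> a < d + 1 \<and> b < d + 1 \<and> a \<noteq> b"
proof -
  let ?C = "edges (copies p (complete_graph (d + 1)))"
  have E: "edges (add_cliques G0 d p) = (\<lambda>e. Inl ` e) ` edges G0 \<union> (\<lambda>e. Inr ` e) ` ?C"
    by (simp add: add_cliques_def disjoint_union_def)
  have inl: "{Inl u, x} \<notin> (\<lambda>e. Inr ` e) ` ?C" for u :: 'a and x by auto
  have inr: "{Inr y, x} \<notin> (\<lambda>e. Inl ` e) ` edges G0" for y :: "nat \<times> nat" and x by auto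
  show "{Inl u, Inl v} \<in> edges (add_cliques G0 d p) \<longleftrightarrow> {u, v} \<in> edges G0"
    unfolding E using inl pair_image_iff[of Inl u v "edges G0"] by auto
  show *: "{Inr y, Inl u} \<notin> edges (add_cliques G0 d p)"
    unfolding E using inl[of u "Inr y"] inr[of y "Inl u"] by (auto simp: insert_commute)
  then show "{Inl u, Inr y} \<notin> edges (add_cliques G0 d p)" by (simp add: insert_commute)
  have "{Inr (i, a), Inr (j, b)} \<in> edges (add_cliques G0 d p) \<longleftrightarrow> {(i, a), (j, b)} \<in> ?C"
    unfolding E using inr pair_image_iff[of Inr "(i, a)" "(j, b)" ?C] by auto
  also have "\<dots> \<longleftrightarrow> (\<exists>l<p. {(i, a), (j, b)} \<in> (\<lambda>e. Pair l ` e) ` all_pairs {..<d + 1})"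
    by (auto simp: copies_def complete_graph_def)
  also have "\<dots> \<longleftrightarrow> i = j \<and> i < p \<and> {a, b} \<in> all_pairs {..<d + 1}"
  proof
    assume "\<exists>l<p. {(i, a), (j, b)} \<in> (\<lambda>e. Pair l ` e) ` all_pairs {..<d + 1}"
    then obtain l where l: "l < p" "{(i, a), (j, b)} \<in> (\<lambda>e. Pair l ` e) ` all_pairs {..<d + 1}" by blast
    then have "i = l" "j = l" by auto
    then show "i = j \<and> i < p \<and> {a, b} \<in> all_pairs {..<d + 1}"
      using l pair_image_iff[of "Pair l" a b "all_pairs {..<d + 1}"] by (simp add: inj_on_def)
  next
    assume "i = j \<and> i < p \<and> {a, b} \<in> all_pairs {..<d + 1}"
    then show "\<exists>l<p. {(i, a), (j, b)} \<in> (\<lambda>e. Pair l ` e) ` all_pairs {..<d + 1}"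
      using pair_image_iff[of "Pair i" a b "all_pairs {..<d + 1}"] by (auto simp: inj_on_def)
  qed
  also have "\<dots> \<longleftrightarrow> i = j \<and> i < p \<and> a < d + 1 \<and> b < d + 1 \<and> a \<noteq> b"
    by (auto simp: all_pairs_def card_insert_if)
  finally show "{Inr (i, a), Inr (j, b)} \<in> edges (add_cliques G0 d p)
     \<longleftrightarrow> i = j \<and> i < p \<and> a < d + 1 \<and> b < d + 1 \<and> a \<noteq> b" .
qed

lemma add_cliques_simple:
  assumes "simple_graph G0"
  shows "simple_graph (add_cliques G0 d p)"
proof -
  have "edges (add_cliques G0 d p) \<subseteq> all_pairs (verts (add_cliques G0 d p))"
  proof
    fix e assume e: "e \<in> edges (add_cliques G0 d p)"
    then consider f where "f \<in> edges G0" "e = Inl ` f"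
      | i f where "i < p" "f \<in> all_pairs {..<d + 1}" "e = Inr ` Pair i ` f"
      by (auto simp: add_cliques_def disjoint_union_def copies_def complete_graph_def)
    then show "e \<in> all_pairs (verts (add_cliques G0 d p))"
    proof cases
      case 1
      then show ?thesis using assms
        by (auto simp: simple_graph_def all_pairs_def add_cliques_verts card_image)
    next
      case 2
      then show ?thesis
        by (auto simp: all_pairs_def add_cliques_verts card_image inj_on_def)
    qed
  qed
  then show ?thesis using assms by (simp add: simple_graph_def add_cliques_verts)
qed

lemma add_cliques_nbrs:
  "nbrs (add_cliques G0 d p) (Inl u) = Inl ` nbrs G0 u"
  "i < p \<Longrightarrow> a < d + 1 \<Longrightarrow> nbrs (add_cliques G0 d p) (Inr (i, a)) = (\<lambda>b. Inr (i, b)) ` ({..<d + 1} - {a})"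
  by (auto simp: nbrs_def add_cliques_verts add_cliques_edges simp del: One_nat_def add_Suc_right)

lemma add_cliques_deg:
  assumes "simple_graph G0"
  shows "deg (add_cliques G0 d p) (Inl u) = deg G0 u"
    "i < p \<Longrightarrow> a < d + 1 \<Longrightarrow> deg (add_cliques G0 d p) (Inr (i, a)) = d"
  using assms by (simp_all add: deg_eq_card_nbrs add_cliques_simple add_cliques_nbrs card_image inj_on_def
      del: One_nat_def add_Suc_right)

lemma add_cliques_regular:
  assumes "regular_graph d G0"
  shows "regular_graph d (add_cliques G0 d p)"
  using assms
  by (auto simp: regular_graph_def add_cliques_simple add_cliques_verts add_cliques_deg
      simp del: One_nat_def add_Suc_right)

lemma nv_add_cliques:
  assumes "simple_graph G0"
  shows "nv (add_cliques G0 d p) = nv G0 + p * (d + 1)"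
  using assms by (simp add: nv_def add_cliques_verts card_Plus simple_graph_def)

text \<open>
  The Laplacian of disjoint copies of \<open>K\<^sub>d\<^sub>+\<^sub>1\<close>; the first component of a vertex is the number of
  its copy.
\<close>

definition clique_kernel :: "nat \<Rightarrow> nat \<times> nat \<Rightarrow> nat \<times> nat \<Rightarrow> int" where
  "clique_kernel d x y = (if fst x = fst y then (if snd x = snd y then int d + 1 else 0) - 1 else 0)"

lemma add_cliques_lap:
  assumes "simple_graph G0"
  shows "lap (add_cliques G0 d p) (Inl u) (Inl v) = lap G0 u v"
    "lap (add_cliques G0 d p) (Inl u) (Inr y) = 0"
    "lap (add_cliques G0 d p) (Inr y) (Inl u) = 0"
    "x \<in> {..<p} \<times> {..<d + 1} \<Longrightarrow> y \<in> {..<p} \<times> {..<d + 1} \<Longrightarrow>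
       lap (add_cliques G0 d p) (Inr x) (Inr y) = clique_kernel d x y"
proof -
  have "{Inr y} \<notin> edges (add_cliques G0 d p)" for y
    using add_cliques_edges(4)[of "fst y" "snd y" "fst y" "snd y" G0 d p] by simp
  then show "lap (add_cliques G0 d p) (Inl u) (Inl v) = lap G0 u v"
    "lap (add_cliques G0 d p) (Inl u) (Inr y) = 0"
    "lap (add_cliques G0 d p) (Inr y) (Inl u) = 0"
    "x \<in> {..<p} \<times> {..<d + 1} \<Longrightarrow> y \<in> {..<p} \<times> {..<d + 1} \<Longrightarrow>
       lap (add_cliques G0 d p) (Inr x) (Inr y) = clique_kernel d x y"
    using assms
    by (auto simp: lap_def add_cliques_edges add_cliques_deg clique_kernel_def simp del: One_nat_def add_Suc_right)
qed

text \<open>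
  On each clique the Laplacian is \<open>d + 1\<close> times a projection.
\<close>

lemma clique_kernel_square:
  assumes x: "x \<in> {..<p} \<times> {..<d + 1}" and y: "y \<in> {..<p} \<times> {..<d + 1}"
  shows "(\<Sum>w\<in>{..<p} \<times> {..<d + 1}. clique_kernel d x w * clique_kernel d w y) = (int d + 1) * clique_kernel d x y"
proof -
  obtain i a j b where xy: "x = (i, a)" "y = (j, b)" by (cases x, cases y) auto
  have i: "i < p" and a: "a < d + 1" and b: "b < d + 1" using x y xy by auto
  let ?D = "int d + 1"
  have "(\<Sum>w\<in>{..<p} \<times> {..<d + 1}. clique_kernel d x w * clique_kernel d w y)
      = (\<Sum>l<p. \<Sum>c<d + 1. clique_kernel d x (l, c) * clique_kernel d (l, c) y)"
    unfolding sum.cartesian_product by (simp only: case_prod_unfold prod.collapse)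
  also have "\<dots> = (\<Sum>l<p. if i = l then (\<Sum>c<d + 1. clique_kernel d x (l, c) * clique_kernel d (l, c) y) else 0)"
    by (intro sum.cong refl) (auto simp: clique_kernel_def xy)
  also have "\<dots> = (\<Sum>c<d + 1. clique_kernel d x (i, c) * clique_kernel d (i, c) y)" using i by simp
  also have "\<dots> = ?D * clique_kernel d x y"
  proof (cases "i = j")
    case True
    have "(\<Sum>c<d + 1. clique_kernel d x (i, c) * clique_kernel d (i, c) y)
        = (\<Sum>c<d + 1. (if a = c then (if c = b then ?D * ?D else 0) - ?D else 0) - (if c = b then ?D else 0) + 1)"
      using True by (intro sum.cong refl) (auto simp: clique_kernel_def xy algebra_simps)
    also have "\<dots> = ((if a = b then ?D * ?D else 0) - ?D) - ?D + ?D"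
      using a b by (simp add: sum.distrib sum_subtractf del: sum.lessThan_Suc)
    finally show ?thesis using True by (simp add: clique_kernel_def xy algebra_simps)
  qed (simp add: clique_kernel_def xy)
  finally show ?thesis .
qed

lemma walk_trace_add_cliques:
  assumes G: "simple_graph G0"
  shows "walk_trace (add_cliques G0 d p) (Suc k) = walk_trace G0 (Suc k) + int (p * d * (d + 1) ^ Suc k)"
proof -
  let ?G = "add_cliques G0 d p" and ?W = "{..<p} \<times> {..<d + 1}"
  let ?K = "kernel_power (verts ?G) (lap ?G)"
  have fin: "finite (verts G0)" using G by (simp add: simple_graph_def)
  have split: "(\<Sum>w\<in>verts ?G. h w) = (\<Sum>u\<in>verts G0. h (Inl u)) + (\<Sum>x\<in>?W. h (Inr x))" for h :: "_ \<Rightarrow> int"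
    using sum.Plus[of "verts G0" ?W h] fin by (simp only: add_cliques_verts o_def finite_SigmaI finite_lessThan)
  note lap = add_cliques_lap[OF G]
  have zero: "?K k (Inl u) (Inr x) = 0 \<and> ?K k (Inr x) (Inl u) = 0" if "x \<in> ?W" for k u x
    using that by (induction k arbitrary: u x) (simp_all add: split lap del: One_nat_def add_Suc_right)
  have left: "?K k (Inl u) (Inl v) = kernel_power (verts G0) (lap G0) k u v" for k u v
    by (induction k arbitrary: v) (simp_all add: split lap zero del: One_nat_def add_Suc_right)
  have right: "?K (Suc k) (Inr x) (Inr y) = (int d + 1) ^ k * clique_kernel d x y"
    if "x \<in> ?W" "y \<in> ?W" for k x y
    using that
  proof (induction k arbitrary: y)
    case 0
    have "?K (Suc 0) (Inr x) (Inr y) = (\<Sum>w\<in>?W. (if x = w then 1 else 0) * clique_kernel d w y)"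
      using 0 by (simp add: split lap del: One_nat_def add_Suc_right)
    also have "\<dots> = (\<Sum>w\<in>?W. if x = w then clique_kernel d w y else 0)"
      by (intro sum.cong refl) simp
    also have "\<dots> = clique_kernel d x y" using 0 by (simp del: One_nat_def add_Suc_right)
    finally show ?case by simp
  next
    case (Suc k)
    have "?K (Suc (Suc k)) (Inr x) (Inr y) = (\<Sum>w\<in>?W. ?K (Suc k) (Inr x) (Inr w) * clique_kernel d w y)"
      unfolding kernel_power.simps(2)[of _ _ "Suc k"] split using Suc.prems
      by (simp add: lap zero del: One_nat_def add_Suc_right kernel_power.simps)
    also have "\<dots> = (\<Sum>w\<in>?W. (int d + 1) ^ k * (clique_kernel d x w * clique_kernel d w y))"
      using Suc by (intro sum.cong refl) (simp del: One_nat_def add_Suc_right kernel_power.simps)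
    also have "\<dots> = (int d + 1) ^ k * ((int d + 1) * clique_kernel d x y)"
      unfolding sum_distrib_left[symmetric] clique_kernel_square[OF Suc.prems] ..
    finally show ?case by simp
  qed
  have "walk_trace ?G (Suc k) = walk_trace G0 (Suc k) + (\<Sum>x\<in>?W. ?K (Suc k) (Inr x) (Inr x))"
    unfolding walk_trace_def split left ..
  also have "(\<Sum>x\<in>?W. ?K (Suc k) (Inr x) (Inr x)) = (\<Sum>x\<in>?W. (int d + 1) ^ k * int d)"
    by (intro sum.cong refl) (simp add: right clique_kernel_def del: One_nat_def add_Suc_right kernel_power.simps)
  also have "\<dots> = int (p * d * (d + 1) ^ Suc k)" by (simp add: algebra_simps)
  finally show ?thesis .
qed

section \<open>Complements\<close>

lemma complement_verts [simp]: "verts (complement G) = verts G" "nv (complement G) = nv G"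
  "vertex_list (complement G) = vertex_list G"
  by (simp_all add: complement_def nv_def vertex_list_def)

lemma complement_simple: "simple_graph G \<Longrightarrow> simple_graph (complement G)"
  by (auto simp: simple_graph_def complement_def)

lemma complement_complement: "simple_graph G \<Longrightarrow> complement (complement G) = G"
  by (cases G) (auto simp: simple_graph_def complement_def)

lemma complement_edge:
  assumes "simple_graph G" "u \<in> verts G" "v \<in> verts G"
  shows "{u, v} \<in> edges (complement G) \<longleftrightarrow> u \<noteq> v \<and> {u, v} \<notin> edges G"
  using assms by (auto simp: complement_def all_pairs_def card_insert_if)

lemma finite_edges:
  assumes "simple_graph G"
  shows "finite (edges G)"
  using assms finite_subset[of "edges G" "all_pairs (verts G)"]
  by (simp add: simple_graph_def all_pairs_def)

lemma card_all_pairs: "finite V \<Longrightarrow> card (all_pairs V) = card V choose 2"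
  using n_subsets[of V 2] by (simp add: all_pairs_def)

lemma ne_complement:
  assumes G: "simple_graph G"
  shows "ne (complement G) = (nv G choose 2) - ne G"
  using G card_Diff_subset[OF finite_edges[OF G], of "all_pairs (verts G)"]
  by (simp add: ne_def complement_def nv_def card_all_pairs simple_graph_def)

lemma ne_le_choose:
  assumes "simple_graph G"
  shows "ne G \<le> nv G choose 2"
proof -
  have "finite (verts G)" "edges G \<subseteq> all_pairs (verts G)" using assms by (auto simp: simple_graph_def)
  then show ?thesis
    using card_mono[of "all_pairs (verts G)" "edges G"]
    by (simp add: ne_def nv_def card_all_pairs[symmetric]) (simp add: all_pairs_def)
qed

lemma complement_deg:
  assumes G: "simple_graph G" and v: "v \<in> verts G"
  shows "deg (complement G) v + deg G v = nv G - 1"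
proof -
  have fin: "finite (verts G)" using G by (simp add: simple_graph_def)
  have "nbrs (complement G) v \<union> nbrs G v = verts G - {v}" "nbrs (complement G) v \<inter> nbrs G v = {}"
    using v edge_in_verts(3)[OF G, of v] complement_edge[OF G v] by (auto simp: nbrs_def)
  moreover have "finite (nbrs (complement G) v)" "finite (nbrs G v)"
    using finite_nbrs[OF complement_simple[OF G]] finite_nbrs[OF G] by blast+
  ultimately have "card (nbrs (complement G) v) + card (nbrs G v) = card (verts G - {v})"
    using card_Un_disjoint by metis
  then show ?thesis using v fin by (simp add: deg_eq_card_nbrs G complement_simple nv_def)
qed

lemma complement_regular:
  assumes "regular_graph d G"
  shows "regular_graph (nv G - 1 - d) (complement G)"
  using assms complement_deg[of G] by (fastforce simp: regular_graph_def complement_simple)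

lemma graph_iso_complement:
  assumes "simple_graph G" "simple_graph H" "graph_iso G H"
  shows "graph_iso (complement G) (complement H)"
proof -
  obtain f where f: "bij_betw f (verts G) (verts H)"
    and e: "\<And>u v. u \<in> verts G \<Longrightarrow> v \<in> verts G \<Longrightarrow> {u, v} \<in> edges G \<longleftrightarrow> {f u, f v} \<in> edges H"
    using assms(3) by (auto simp: graph_iso_def)
  have "{u, v} \<in> edges (complement G) \<longleftrightarrow> {f u, f v} \<in> edges (complement H)"
    if "u \<in> verts G" "v \<in> verts G" for u v
  proof -
    have "f u \<in> verts H" "f v \<in> verts H" "f u = f v \<longleftrightarrow> u = v"
      using f that by (auto simp: bij_betw_def inj_on_eq_iff)
    then show ?thesis using that assms(1,2) e by (simp add: complement_edge)
  qed
  then show ?thesis using f unfolding graph_iso_def by auto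
qed

lemma vertex_list_nth:
  assumes "finite (verts G)" "i < nv G"
  shows "vertex_list G ! i \<in> verts G"
    "j < nv G \<Longrightarrow> vertex_list G ! i = vertex_list G ! j \<longleftrightarrow> i = j"
  using vertex_list[OF assms(1)] assms(2) nth_mem[of i "vertex_list G"]
  by (simp_all add: nth_eq_iff_index_eq)

lemma complement_laplacian:
  assumes G: "simple_graph G"
  shows "laplacian_mat (complement G) + ones_mat (nv G) = real (nv G) \<cdot>\<^sub>m 1\<^sub>m (nv G) - laplacian_mat G"
proof (rule eq_matI)
  have fin: "finite (verts G)" using G by (simp add: simple_graph_def)
  fix i j
  assume "i < dim_row (real (nv G) \<cdot>\<^sub>m 1\<^sub>m (nv G) - laplacian_mat G)"
    "j < dim_col (real (nv G) \<cdot>\<^sub>m 1\<^sub>m (nv G) - laplacian_mat G)"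
  then have ij: "i < nv G" "j < nv G" by auto
  let ?u = "vertex_list G ! i" and ?v = "vertex_list G ! j"
  have V: "?u \<in> verts G" "?v \<in> verts G" and eq: "?u = ?v \<longleftrightarrow> i = j"
    using vertex_list_nth[OF fin] ij by simp_all
  have "int (deg (complement G) ?u) + int (deg G ?u) = int (nv G) - 1"
    using complement_deg[OF G V(1)] ij by linarith
  then have "lap (complement G) ?u ?v + 1 = (if i = j then int (nv G) else 0) - lap G ?u ?v"
    using V eq edge_in_verts(3)[OF G, of ?u ?v] by (auto simp: lap_def complement_edge[OF G])
  from arg_cong[OF this, of real_of_int]
  have "real_of_int (lap (complement G) ?u ?v) + 1
      = (if i = j then real (nv G) else 0) - real_of_int (lap G ?u ?v)"
    by (cases "i = j") simp_all
  then show "(laplacian_mat (complement G) + ones_mat (nv G)) $$ (i, j)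
      = (real (nv G) \<cdot>\<^sub>m 1\<^sub>m (nv G) - laplacian_mat G) $$ (i, j)"
    using ij laplacian_mat_index[OF complement_simple[OF G], of i j]
    by (simp add: laplacian_mat_index[OF G] ones_mat_def)
qed (simp_all add: ones_mat_def)

lemma spanning_trees_complement:
  assumes G: "simple_graph G" and n: "nv G > 0" and es: "laplacian_spectrum G es"
  shows "(det (spread_mat (nv G)))\<^sup>2 * real (num_spanning_trees (complement G)) = (\<Prod>e\<leftarrow>es. real (nv G) - e)"
  using matrix_tree[OF complement_simple[OF G]] n es complement_laplacian[OF G]
  by (simp add: laplacian_spectrum_def)

text \<open>
  The coefficient of \<open>J\<close> in \<open>(J + A)\<^sup>k\<close> for an \<open>n\<close> by \<open>n\<close> matrix \<open>A\<close> with all row and column sums \<open>s\<close>.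
\<close>

fun ones_coeff :: "real \<Rightarrow> real \<Rightarrow> nat \<Rightarrow> real" where
  "ones_coeff n s 0 = 0"
| "ones_coeff n s (Suc k) = s ^ k + (n + s) * ones_coeff n s k"

lemma ones_plus_pow:
  assumes A: "A \<in> carrier_mat n n"
    and AJ: "A * ones_mat n = s \<cdot>\<^sub>m ones_mat n" and JA: "ones_mat n * A = s \<cdot>\<^sub>m ones_mat n"
  shows "(ones_mat n + A) ^\<^sub>m k = A ^\<^sub>m k + ones_coeff (real n) s k \<cdot>\<^sub>m ones_mat n"
proof (induction k)
  case 0
  show ?case using A by (intro eq_matI) (auto simp: ones_mat_def)
next
  case (Suc k)
  let ?J = "ones_mat n" and ?c = "ones_coeff (real n) s k"
  have J: "?J \<in> carrier_mat n n" by (simp add: ones_mat_def)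
  have Ak: "A ^\<^sub>m k \<in> carrier_mat n n" by (rule pow_carrier_mat[OF A])
  have JJ: "?J * ?J = real n \<cdot>\<^sub>m ?J" by (rule eq_matI) (auto simp: ones_mat_def scalar_prod_def)
  have AkJ: "A ^\<^sub>m k * ?J = s ^ k \<cdot>\<^sub>m ?J"
  proof (induction k)
    case 0
    show ?case using A J by (intro eq_matI) auto
  next
    case (Suc k)
    have "A ^\<^sub>m Suc k * ?J = A ^\<^sub>m k * (A * ?J)"
      using A J pow_carrier_mat[OF A, of k] by (simp add: assoc_mult_mat[of _ n n _ n _ n])
    also have "\<dots> = s \<cdot>\<^sub>m (s ^ k \<cdot>\<^sub>m ?J)"
      unfolding AJ using J pow_carrier_mat[OF A, of k] Suc by (simp add: mult_smult_distrib[of _ n n _ n])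
    also have "\<dots> = s ^ Suc k \<cdot>\<^sub>m ?J" by (rule eq_matI) auto
    finally show ?case .
  qed
  have "(?J + A) ^\<^sub>m Suc k = (A ^\<^sub>m k + ?c \<cdot>\<^sub>m ?J) * (?J + A)" by (simp add: Suc)
  also have "\<dots> = A ^\<^sub>m k * (?J + A) + (?c \<cdot>\<^sub>m ?J) * (?J + A)"
    using A J Ak by (intro add_mult_distrib_mat[of _ n n]) auto
  also have "A ^\<^sub>m k * (?J + A) = s ^ k \<cdot>\<^sub>m ?J + A ^\<^sub>m Suc k"
    using A J Ak AkJ by (simp add: mult_add_distrib_mat[of _ n n _ n])
  also have "(?c \<cdot>\<^sub>m ?J) * (?J + A) = ?c \<cdot>\<^sub>m (real n \<cdot>\<^sub>m ?J + s \<cdot>\<^sub>m ?J)"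
    using A J JJ JA
    by (simp add: mult_add_distrib_mat[of _ n n _ n] mult_smult_assoc_mat[of _ n n _ n]
        add_smult_distrib_left_mat[of _ n n])
  also have "s ^ k \<cdot>\<^sub>m ?J + A ^\<^sub>m Suc k + ?c \<cdot>\<^sub>m (real n \<cdot>\<^sub>m ?J + s \<cdot>\<^sub>m ?J)
      = A ^\<^sub>m Suc k + ones_coeff (real n) s (Suc k) \<cdot>\<^sub>m ?J"
    using carrier_matD[OF A] carrier_matD[OF Ak] by (intro eq_matI) (auto simp: ones_mat_def algebra_simps)
  finally show ?case .
qed

text \<open>
  Here \<open>A = J + (L - (d + 1)I)\<close>, and the part of the trace that comes from \<open>J\<close> is the same for all
  \<open>d\<close>-regular graphs on \<open>n\<close> vertices.
\<close>

lemma adj_trace_complement: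
  assumes reg: "regular_graph d G" and es: "laplacian_spectrum G es"
  shows "adj_trace (complement G) k
    = (\<Sum>e\<leftarrow>es. (e - real (d + 1)) ^ k) + real (nv G) * ones_coeff (real (nv G)) (- real (d + 1)) k"
proof -
  let ?n = "nv G" and ?c = "- real (d + 1)" and ?J = "ones_mat (nv G)"
  have G: "simple_graph G" and dg: "\<And>v. v \<in> verts G \<Longrightarrow> deg G v = d"
    using reg by (auto simp: regular_graph_def)
  have fin: "finite (verts G)" using G by (simp add: simple_graph_def)
  define N where "N = laplacian_mat G + ?c \<cdot>\<^sub>m 1\<^sub>m ?n"
  have N: "N \<in> carrier_mat ?n ?n" by (simp add: N_def)
  have A: "adjacency_mat (complement G) = ?J + N"
  proof (rule eq_matI)
    fix i j assume "i < dim_row (?J + N)" "j < dim_col (?J + N)"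
    then have ij: "i < ?n" "j < ?n" by (auto simp: N_def)
    let ?u = "vertex_list G ! i" and ?v = "vertex_list G ! j"
    have V: "?u \<in> verts G" "?v \<in> verts G" and eq: "?u = ?v \<longleftrightarrow> i = j"
      using vertex_list_nth[OF fin] ij by simp_all
    show "adjacency_mat (complement G) $$ (i, j) = (?J + N) $$ (i, j)"
      using ij V eq edge_in_verts(3)[OF G, of ?u ?v] dg[OF V(1)]
      by (auto simp: adjacency_mat_def N_def ones_mat_def laplacian_mat_index[OF G] lap_def complement_edge[OF G])
  qed (simp_all add: adjacency_mat_def N_def)
  have row: "(\<Sum>j = 0..<?n. N $$ (i, j)) = ?c" if i: "i < ?n" for i
  proof -
    have "(\<Sum>j = 0..<?n. N $$ (i, j)) = (\<Sum>j = 0..<?n. laplacian_mat G $$ (i, j) + (if i = j then ?c else 0))"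
      using i by (intro sum.cong) (auto simp: N_def)
    then show ?thesis using i by (simp add: sum.distrib laplacian_mat_row_sum[OF G])
  qed
  have sym: "N $$ (i, j) = N $$ (j, i)" if "i < ?n" "j < ?n" for i j
    using that laplacian_mat_sym[OF G that] by (simp add: N_def)
  have NJ: "N * ?J = ?c \<cdot>\<^sub>m ?J"
    using N row by (intro eq_matI) (auto simp: ones_mat_def scalar_prod_def)
  have JN: "?J * N = ?c \<cdot>\<^sub>m ?J"
  proof (rule eq_matI)
    fix i j assume "i < dim_row (?c \<cdot>\<^sub>m ?J)" "j < dim_col (?c \<cdot>\<^sub>m ?J)"
    then have ij: "i < ?n" "j < ?n" by (auto simp: ones_mat_def)
    have "(?J * N) $$ (i, j) = (\<Sum>l = 0..<?n. N $$ (l, j))"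
      using N ij by (auto simp: ones_mat_def scalar_prod_def)
    also have "\<dots> = (\<Sum>l = 0..<?n. N $$ (j, l))" using ij sym by (intro sum.cong) auto
    finally show "(?J * N) $$ (i, j) = (?c \<cdot>\<^sub>m ?J) $$ (i, j)" using ij row by (simp add: ones_mat_def)
  qed (use N in \<open>auto simp: ones_mat_def\<close>)
  have Nk: "N ^\<^sub>m k \<in> carrier_mat ?n ?n" by (rule pow_carrier_mat[OF N])
  have "adj_trace (complement G) k = mat_trace (N ^\<^sub>m k + ones_coeff (real ?n) ?c k \<cdot>\<^sub>m ?J)"
    unfolding adj_trace_def A ones_plus_pow[OF N NJ JN] ..
  also have "\<dots> = mat_trace (N ^\<^sub>m k) + real ?n * ones_coeff (real ?n) ?c k"
    using Nk carrier_matD(1)[OF N] by (simp add: mat_trace_def ones_mat_def sum.distrib)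
  also have "mat_trace (N ^\<^sub>m k) = (\<Sum>e\<leftarrow>es. (e + ?c) ^ k)"
    using es unfolding laplacian_spectrum_def N_def by blast
  finally show ?thesis by (simp only: diff_conv_add_uminus)
qed

section \<open>Products compared through power sums\<close>

lemma ln_one_minus_sums:
  fixes x :: real
  assumes x: "0 \<le> x" "x < 1"
  shows "(\<lambda>k. x ^ k / real k) sums (- ln (1 - x))"
proof -
  let ?a = "\<lambda>n. x ^ Suc n / real (Suc n)"
  have "summable ?a"
  proof (rule summable_comparison_test')
    show "summable (\<lambda>n. x ^ n)" using x by (intro summable_geometric) simp
    fix n :: nat
    have "x ^ Suc n \<le> x ^ n" using x by (intro power_decreasing) auto
    moreover have "x ^ Suc n / real (Suc n) \<le> x ^ Suc n / 1"
      using x by (intro divide_left_mono) auto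
    ultimately show "norm (?a n) \<le> x ^ n" using x by simp
  qed
  moreover have "ln (1 - x) = (\<Sum>n. - ?a n)"
  proof -
    have t: "(- 1) ^ n * (1 / real (n + 1)) * (1 - x - 1) ^ Suc n = - ?a n" for n
      by (cases "even n") simp_all
    have "ln (1 - x) = (\<Sum>n. (- 1) ^ n * (1 / real (n + 1)) * (1 - x - 1) ^ Suc n)"
      by (rule ln_series) (use x in auto)
    then show ?thesis by (simp only: t)
  qed
  ultimately have "?a sums (- ln (1 - x))"
    by (simp add: suminf_minus summable_sums)
  then show ?thesis by (subst (asm) sums_Suc_iff) simp
qed

text \<open>
  The term for \<open>k = 0\<close> is a division by zero, hence \<open>0\<close>, as it should be.
\<close>

lemma power_sum_series:
  fixes es :: "real list"
  assumes "n > 0" "\<And>e. e \<in> set es \<Longrightarrow> 0 \<le> e \<and> e < n"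
  shows "(\<lambda>k. (\<Sum>e\<leftarrow>es. e ^ k) / (real k * n ^ k)) sums (- (\<Sum>e\<leftarrow>es. ln (1 - e / n)))"
  using assms(2)
proof (induction es)
  case (Cons e es)
  have "(\<lambda>k. (e / n) ^ k / real k) sums (- ln (1 - e / n))"
    using Cons.prems assms(1) by (intro ln_one_minus_sums) auto
  from sums_add[OF this Cons.IH] Cons.prems
  show ?case by (simp add: power_divide add_divide_distrib mult.commute)
qed simp

lemma prod_eq_exp_sum_ln:
  fixes es :: "real list"
  assumes "n > 0" "\<And>e. e \<in> set es \<Longrightarrow> e < n"
  shows "(\<Prod>e\<leftarrow>es. n - e) = n ^ length es * exp (\<Sum>e\<leftarrow>es. ln (1 - e / n))"
  using assms(2)
proof (induction es)
  case (Cons e es)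
  have "n - e = n * exp (ln (1 - e / n))" using Cons.prems[of e] assms(1) by (simp add: field_simps)
  then show ?case using Cons by (simp add: exp_add)
qed simp

lemma prod_list_nonneg_real:
  fixes es :: "real list"
  shows "(\<And>e. e \<in> set es \<Longrightarrow> e \<le> n) \<Longrightarrow> 0 \<le> (\<Prod>e\<leftarrow>es. n - e)"
    "(\<And>e. e \<in> set es \<Longrightarrow> e < n) \<Longrightarrow> 0 < (\<Prod>e\<leftarrow>es. n - e)"
  by (induction es) auto

text \<open>
  Equal power sums give equal products; the inequality also covers an entry \<open>n\<close> in \<open>es\<close>, for which the
  logarithm is not available.
\<close>

lemma prod_le_of_equal_power_sums:
  fixes es fs :: "real list"
  assumes n: "n > 0" and len: "length es = length fs"
    and es: "\<And>e. e \<in> set es \<Longrightarrow> 0 \<le> e \<and> e \<le> n" and fs: "\<And>f. f \<in> set fs \<Longrightarrow> 0 \<le> f \<and> f < n"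
    and eq: "\<And>k. 1 \<le> k \<Longrightarrow> (\<Sum>e\<leftarrow>es. e ^ k) = (\<Sum>f\<leftarrow>fs. f ^ k)"
  shows "(\<Prod>e\<leftarrow>es. n - e) \<le> (\<Prod>f\<leftarrow>fs. n - f)"
proof (cases "n \<in> set es")
  case True
  then have z: "(\<Prod>e\<leftarrow>es. n - e) = 0" by (induction es) auto
  show ?thesis unfolding z by (rule prod_list_nonneg_real(1)) (use fs in force)
next
  case False
  then have es': "0 \<le> e \<and> e < n" if "e \<in> set es" for e using es[OF that] that by (metis order_le_less)
  have "(\<lambda>k. (\<Sum>e\<leftarrow>es. e ^ k) / (real k * n ^ k)) = (\<lambda>k. (\<Sum>f\<leftarrow>fs. f ^ k) / (real k * n ^ k))"
  proof
    fix k show "(\<Sum>e\<leftarrow>es. e ^ k) / (real k * n ^ k) = (\<Sum>f\<leftarrow>fs. f ^ k) / (real k * n ^ k)"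
      using eq[of k] by (cases k) auto
  qed
  then have "(\<Sum>e\<leftarrow>es. ln (1 - e / n)) = (\<Sum>f\<leftarrow>fs. ln (1 - f / n))"
    using power_sum_series[OF n es'] power_sum_series[OF n fs] sums_unique2 by fastforce
  then show ?thesis
    using prod_eq_exp_sum_ln[OF n, of es] prod_eq_exp_sum_ln[OF n, of fs] es' fs len by simp
qed

text \<open>
  The difference of the two logarithmic series is at least \<open>1 / (j n\<^sup>j)\<close> minus a geometric tail, whose sum
  is at most \<open>a b\<^sup>j\<^sup>+\<^sup>1 / (2 (j + 1) n\<^sup>j (n - b))\<close>.
\<close>

lemma prod_less_of_power_sums:
  fixes es fs :: "real list" and a b n :: real
  assumes len: "length es = length fs" and b: "0 \<le> b" "b < n" and a: "0 \<le> a" and j: "1 \<le> j"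
    and es: "\<And>e. e \<in> set es \<Longrightarrow> 0 \<le> e \<and> e \<le> n" and fs: "\<And>f. f \<in> set fs \<Longrightarrow> 0 \<le> f \<and> f < n"
    and eq: "\<And>k. 1 \<le> k \<Longrightarrow> k < j \<Longrightarrow> (\<Sum>e\<leftarrow>es. e ^ k) = (\<Sum>f\<leftarrow>fs. f ^ k)"
    and gap: "(\<Sum>f\<leftarrow>fs. f ^ j) + 1 \<le> (\<Sum>e\<leftarrow>es. e ^ j)"
    and tail: "\<And>k. j < k \<Longrightarrow> (\<Sum>f\<leftarrow>fs. f ^ k) - a / 2 * b ^ k \<le> (\<Sum>e\<leftarrow>es. e ^ k)"
    and large: "b + a * b ^ (j + 1) \<le> n"
  shows "(\<Prod>e\<leftarrow>es. n - e) < (\<Prod>f\<leftarrow>fs. n - f)"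
proof (cases "n \<in> set es")
  case True
  then have z: "(\<Prod>e\<leftarrow>es. n - e) = 0" by (induction es) auto
  show ?thesis unfolding z by (rule prod_list_nonneg_real(2)) (use fs in force)
next
  case False
  have n: "n > 0" using b by linarith
  have es': "0 \<le> e \<and> e < n" if "e \<in> set es" for e using es[OF that] that False by (metis order_le_less)
  let ?S = "\<lambda>k. (\<Sum>e\<leftarrow>es. e ^ k)" and ?T = "\<lambda>k. (\<Sum>f\<leftarrow>fs. f ^ k)"
  let ?D = "\<lambda>k. ?S k / (real k * n ^ k) - ?T k / (real k * n ^ k)"
  define q where "q = b / n"
  define C where "C = a / (2 * (real j + 1))"
  have q: "0 \<le> q" "q < 1" using b n by (simp_all add: q_def)
  define g where "g k = (if k < j then 0 else if k = j then 1 / (real j * n ^ j) else - C * q ^ k)" for k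
  have sD: "?D sums (- (\<Sum>e\<leftarrow>es. ln (1 - e / n)) - - (\<Sum>f\<leftarrow>fs. ln (1 - f / n)))"
    using power_sum_series[OF n es'] power_sum_series[OF n fs] by (intro sums_diff) auto
  have g_le: "g k \<le> ?D k" for k
  proof -
    consider "k = 0" | "1 \<le> k" "k < j" | "k = j" | "j < k" by linarith
    then show ?thesis
    proof cases
      case 1
      then show ?thesis using j by (simp add: g_def)
    next
      case 2
      then show ?thesis using eq[of k] by (simp add: g_def)
    next
      case 3
      have "1 / (real j * n ^ j) \<le> (?S j - ?T j) / (real j * n ^ j)"
        using gap n by (intro divide_right_mono) auto
      then show ?thesis using 3 by (simp add: g_def diff_divide_distrib)
    next
      case 4
      have k: "real k \<ge> real j + 1" using 4 by linarith
      have "- C * q ^ k = - (a / 2 * b ^ k) / ((real j + 1) * n ^ k)"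
        by (simp add: C_def q_def power_divide)
      also have "\<dots> \<le> - (a / 2 * b ^ k) / (real k * n ^ k)"
      proof -
        have "(a / 2 * b ^ k) / (real k * n ^ k) \<le> (a / 2 * b ^ k) / ((real j + 1) * n ^ k)"
          using k n a b by (intro divide_left_mono mult_right_mono mult_pos_pos) auto
        then show ?thesis by simp
      qed
      also have "\<dots> \<le> (?S k - ?T k) / (real k * n ^ k)"
        using tail[OF 4] n by (intro divide_right_mono) auto
      finally show ?thesis using 4 by (simp add: g_def diff_divide_distrib)
    qed
  qed
  have shifted: "(\<lambda>i. g (i + Suc j)) sums (- C * q ^ Suc j * (1 / (1 - q)))"
  proof -
    have "(\<lambda>i. - C * q ^ Suc j * q ^ i) sums (- C * q ^ Suc j * (1 / (1 - q)))"
      using q by (intro sums_mult geometric_sums) simp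
    moreover have "(\<lambda>i. - C * q ^ Suc j * q ^ i) = (\<lambda>i. g (i + Suc j))"
      by (auto simp: g_def power_add)
    ultimately show ?thesis by simp
  qed
  have "(\<Sum>i<Suc j. g i) = 1 / (real j * n ^ j)" by (simp add: g_def)
  with shifted have "g sums (- C * q ^ Suc j * (1 / (1 - q)) + 1 / (real j * n ^ j))"
    by (simp only: sums_iff_shift)
  then have sg: "g sums (1 / (real j * n ^ j) - C * q ^ Suc j * (1 / (1 - q)))"
    by (simp add: algebra_simps)
  have "C * q ^ Suc j * (1 / (1 - q)) < 1 / (real j * n ^ j)"
  proof -
    have nb: "0 < n - b" using b by simp
    have "q ^ Suc j * (1 / (1 - q)) = b ^ Suc j / (n ^ j * (n - b))"
      using n nb by (simp add: q_def power_divide field_simps)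
    then have "C * (q ^ Suc j * (1 / (1 - q))) = C * (b ^ Suc j / (n ^ j * (n - b)))" by (rule arg_cong)
    then have "C * q ^ Suc j * (1 / (1 - q)) = (a * b ^ (j + 1)) / (2 * (real j + 1)) / (n ^ j * (n - b))"
      by (simp add: C_def)
    also have "\<dots> \<le> (n - b) / (2 * (real j + 1)) / (n ^ j * (n - b))"
      using large n nb by (intro divide_right_mono) auto
    also have "\<dots> = 1 / ((2 * (real j + 1)) * n ^ j)" using nb by simp
    also have "\<dots> < 1 / (real j * n ^ j)"
      using j n by (intro divide_strict_left_mono mult_strict_right_mono mult_pos_pos) auto
    finally show ?thesis .
  qed
  then have "0 < - (\<Sum>e\<leftarrow>es. ln (1 - e / n)) - - (\<Sum>f\<leftarrow>fs. ln (1 - f / n))"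
    using sums_le[OF g_le sg sD] by linarith
  then have "(\<Sum>e\<leftarrow>es. ln (1 - e / n)) < (\<Sum>f\<leftarrow>fs. ln (1 - f / n))" by simp
  then show ?thesis
    using prod_eq_exp_sum_ln[OF n, of es] prod_eq_exp_sum_ln[OF n, of fs] es' fs len n by simp
qed

section \<open>Bounds on power sums\<close>

text \<open>
  Each \<open>e\<^sup>k\<close> lies above the tangent of the power function at \<open>c\<close>; multiply by \<open>e\<close> and sum.
\<close>

lemma power_sum_lower_bound:
  fixes es :: "real list"
  assumes c: "c > 0" and es: "\<And>e. e \<in> set es \<Longrightarrow> 0 \<le> e" and second: "c * sum_list es \<le> (\<Sum>e\<leftarrow>es. e ^ 2)"
  shows "c ^ k * sum_list es \<le> (\<Sum>e\<leftarrow>es. e ^ Suc k)"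
proof -
  let ?t = "\<lambda>e. c ^ k * e + real k * c ^ k / c * (e ^ 2 - c * e)"
  have tangent: "?t e \<le> e ^ Suc k" if "0 \<le> e" for e
  proof -
    have "1 + real k * (e / c - 1) \<le> (1 + (e / c - 1)) ^ k"
      using that c by (intro Bernoulli_inequality) simp
    then have "c ^ k * e * (1 + real k * (e / c - 1)) \<le> c ^ k * e * (e / c) ^ k"
      using that c by (intro mult_left_mono) auto
    also have "\<dots> = e ^ Suc k" using c by (simp add: power_divide)
    also have "c ^ k * e * (1 + real k * (e / c - 1)) = ?t e"
      using c by (simp add: field_simps power2_eq_square)
    finally show ?thesis .
  qed
  have "(\<Sum>e\<leftarrow>es. A * e + K * (e ^ 2 - c * e)) = A * sum_list es + K * ((\<Sum>e\<leftarrow>es. e ^ 2) - c * sum_list es)"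
    for A K by (induction es) (simp_all add: algebra_simps)
  from this[of "c ^ k" "real k * c ^ k / c"]
  have "(\<Sum>e\<leftarrow>es. ?t e) = c ^ k * sum_list es + real k * c ^ k / c * ((\<Sum>e\<leftarrow>es. e ^ 2) - c * sum_list es)" .
  moreover have "0 \<le> real k * c ^ k / c * ((\<Sum>e\<leftarrow>es. e ^ 2) - c * sum_list es)"
    using c second by simp
  moreover have "(\<Sum>e\<leftarrow>es. ?t e) \<le> (\<Sum>e\<leftarrow>es. e ^ Suc k)"
    using tangent es by (intro sum_list_mono) auto
  ultimately show ?thesis by linarith
qed

lemma power_sum_upper_bound:
  fixes fs :: "real list"
  assumes "\<And>f. f \<in> set fs \<Longrightarrow> 0 \<le> f \<and> f \<le> b"
  shows "(\<Sum>f\<leftarrow>fs. f ^ Suc k) \<le> b ^ k * sum_list fs"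
proof -
  have "(\<Sum>f\<leftarrow>fs. f ^ Suc k) \<le> (\<Sum>f\<leftarrow>fs. b ^ k * f)"
  proof (rule sum_list_mono)
    fix f assume "f \<in> set fs"
    then have "0 \<le> f" "f \<le> b" using assms by auto
    then show "f ^ Suc k \<le> b ^ k * f" using power_mono[of f b k] by (simp add: mult.commute mult_left_mono)
  qed
  then show ?thesis by (simp add: sum_list_const_mult)
qed

section \<open>Integer polynomials with few exceptional roots\<close>

lemma strip_integer_root:
  fixes es :: "real list" and P :: "int poly" and c :: int
  assumes "map_poly real_of_int P = (\<Prod>e\<leftarrow>es. [:- e, 1:])"
  shows "\<exists>g. map_poly real_of_int g = (\<Prod>e\<leftarrow>filter (\<lambda>e. e \<noteq> of_int c) es. [:- e, 1:])"
  using assms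
proof (induction "length es" arbitrary: es P rule: less_induct)
  case less
  show ?case
  proof (cases "real_of_int c \<in> set es")
    case False
    then have "filter (\<lambda>e. e \<noteq> of_int c) es = es" by (auto simp: filter_id_conv)
    then show ?thesis using less.prems by metis
  next
    case True
    have split: "(\<Prod>e\<leftarrow>es. [:- e, 1:]) = [:- real_of_int c, 1:] * (\<Prod>e\<leftarrow>remove1 (of_int c) es. [:- e, 1:])"
      by (rule prod_list_map_remove1[OF True])
    have "poly (map_poly real_of_int P) (of_int c) = 0" unfolding less.prems split by simp
    then have "poly P c = 0" by (simp add: of_int_hom.poly_map_poly)
    then obtain P' where P': "P = [:- c, 1:] * P'" by (auto simp: poly_eq_0_iff_dvd dvd_def)
    have "map_poly real_of_int [:- c, 1:] = [:- real_of_int c, 1:]" by simp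
    then have "[:- real_of_int c, 1:] * map_poly real_of_int P'
        = [:- real_of_int c, 1:] * (\<Prod>e\<leftarrow>remove1 (of_int c) es. [:- e, 1:])"
      using less.prems unfolding split P' of_int_poly_hom.hom_mult by metis
    then have "map_poly real_of_int P' = (\<Prod>e\<leftarrow>remove1 (of_int c) es. [:- e, 1:])"
      by (metis mult_left_cancel pCons_eq_0_iff zero_neq_one)
    moreover have "length (remove1 (of_int c) es) < length es"
      using length_pos_if_in_set[OF True] True by (simp add: length_remove1)
    moreover have "filter (\<lambda>e. e \<noteq> of_int c) (remove1 (of_int c) es) = filter (\<lambda>e. e \<noteq> of_int c) es"
      by (induction es) auto
    ultimately show ?thesis using less.hyps by metis
  qed
qed

lemma prod_list_integer_nonzero:
  fixes rs :: "real list" and g :: "int poly" and c :: int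
  assumes "map_poly real_of_int g = (\<Prod>e\<leftarrow>rs. [:- e, 1:])" "of_int c \<notin> set rs"
  shows "1 \<le> \<bar>\<Prod>e\<leftarrow>rs. of_int c - e\<bar>"
proof -
  have "(\<Prod>e\<leftarrow>rs. of_int c - e) = poly (map_poly real_of_int g) (of_int c)"
    unfolding assms(1) by (induction rs) (simp_all add: algebra_simps)
  also have "\<dots> = of_int (poly g c)" by (simp add: of_int_hom.poly_map_poly)
  finally have eq: "(\<Prod>e\<leftarrow>rs. of_int c - e) = of_int (poly g c)" .
  moreover have "(\<Prod>e\<leftarrow>rs. of_int c - e) \<noteq> 0" using assms(2) by (induction rs) auto
  ultimately have "poly g c \<noteq> 0" by auto
  then have "1 \<le> \<bar>poly g c\<bar>" by linarith
  then show ?thesis unfolding eq by linarith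
qed

text \<open>
  This follows from \<open>ln y \<le> y - 1\<close>.
\<close>

lemma length_le_sum_list:
  fixes ys :: "real list"
  assumes "\<And>y. y \<in> set ys \<Longrightarrow> 0 < y" "1 \<le> prod_list ys"
  shows "real (length ys) \<le> sum_list ys"
proof -
  have "0 < prod_list ys \<and> real (length ys) + ln (prod_list ys) \<le> sum_list ys"
    using assms(1)
  proof (induction ys)
    case (Cons y ys)
    then have "0 < y" "0 < prod_list ys" "real (length ys) + ln (prod_list ys) \<le> sum_list ys" by auto
    then show ?case using ln_le_minus_one[of y] ln_mult_pos[of y "prod_list ys"] by simp
  qed simp
  moreover have "0 \<le> ln (prod_list ys)" using assms(2) by simp
  ultimately show ?thesis by linarith
qed

text \<open>
  Dividing out the roots \<open>0\<close> and \<open>c\<close> leaves an integer polynomial, whose values at \<open>0\<close> and \<open>c\<close> are nonzero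
  integers. They bound the product of \<open>e (e - c)\<^sup>2\<close> over the remaining roots below by \<open>1\<close>, and positive numbers with
  product at least \<open>1\<close> have a sum at least as large as their number.
\<close>

lemma exceptional_roots_bound:
  fixes es :: "real list" and P :: "int poly" and c :: int
  assumes P: "map_poly real_of_int P = (\<Prod>e\<leftarrow>es. [:- e, 1:])" and es: "\<And>e. e \<in> set es \<Longrightarrow> 0 \<le> e"
  shows "real (length (filter (\<lambda>e. e \<noteq> 0 \<and> e \<noteq> of_int c) es)) \<le> (\<Sum>e\<leftarrow>es. e * (e - of_int c)\<^sup>2)"
proof -
  define rs where "rs = filter (\<lambda>e. e \<noteq> 0 \<and> e \<noteq> of_int c) es"
  let ?q = "\<lambda>e. e * (e - real_of_int c)\<^sup>2"
  obtain g0 where g0: "map_poly real_of_int g0 = (\<Prod>e\<leftarrow>filter (\<lambda>e. e \<noteq> of_int 0) es. [:- e, 1:])"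
    using strip_integer_root[OF P] by blast
  obtain g where "map_poly real_of_int g
      = (\<Prod>e\<leftarrow>filter (\<lambda>e. e \<noteq> of_int c) (filter (\<lambda>e. e \<noteq> of_int 0) es). [:- e, 1:])"
    using strip_integer_root[OF g0] by blast
  then have g: "map_poly real_of_int g = (\<Prod>e\<leftarrow>rs. [:- e, 1:])" by (simp add: rs_def conj_commute)
  have rs: "0 < e \<and> e \<noteq> of_int c" if "e \<in> set rs" for e using that es[of e] by (auto simp: rs_def)
  have "prod_list (map ?q rs) = \<bar>\<Prod>e\<leftarrow>rs. of_int 0 - e\<bar> * \<bar>\<Prod>e\<leftarrow>rs. of_int c - e\<bar>\<^sup>2"
    using rs
  proof (induction rs)
    case (Cons e rs)
    have "?q e = \<bar>of_int 0 - e\<bar> * \<bar>of_int c - e\<bar>\<^sup>2" using Cons.prems[of e] by (simp add: power2_commute)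
    then show ?case using Cons by (simp add: abs_mult power_mult_distrib)
  qed simp
  also have "1 \<le> \<dots>"
  proof -
    have "1 * 1\<^sup>2 \<le> \<bar>\<Prod>e\<leftarrow>rs. of_int 0 - e\<bar> * \<bar>\<Prod>e\<leftarrow>rs. of_int c - e\<bar>\<^sup>2"
      using prod_list_integer_nonzero[OF g, of 0] prod_list_integer_nonzero[OF g, of c] rs
      by (intro mult_mono power_mono) auto
    then show ?thesis by simp
  qed
  finally have "real (length (map ?q rs)) \<le> sum_list (map ?q rs)"
    using rs by (intro length_le_sum_list) auto
  moreover have "sum_list (map ?q rs) = sum_list (map ?q es)"
    unfolding rs_def by (induction es) auto
  ultimately show ?thesis unfolding rs_def by simp
qed

text \<open>
  The monic polynomial with root \<open>0\<close> and the roots in \<open>xs\<close> yields a linear recurrence that both sequences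
  of power sums satisfy. Its constant coefficient is \<open>0\<close>, so the power sums of index \<open>0\<close> do not enter.
\<close>

lemma power_sums_eq_of_initial:
  fixes es fs xs :: "real list"
  assumes supp: "\<And>e. e \<in> set es \<union> set fs \<Longrightarrow> e \<noteq> 0 \<Longrightarrow> e \<in> set xs"
    and init: "\<And>k. 1 \<le> k \<Longrightarrow> k \<le> length xs \<Longrightarrow> (\<Sum>e\<leftarrow>es. e ^ k) = (\<Sum>f\<leftarrow>fs. f ^ k)"
    and k: "1 \<le> k"
  shows "(\<Sum>e\<leftarrow>es. e ^ k) = (\<Sum>f\<leftarrow>fs. f ^ k)"
  using k
proof (induction k rule: less_induct)
  case (less k)
  show ?case
  proof (cases "k \<le> length xs")
    case True
    then show ?thesis using init less.prems by simp
  next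
    case False
    define i where "i = k - Suc (length xs)"
    have k: "k = Suc (length xs) + i" using False by (simp add: i_def)
    define P where "P = (\<Prod>x\<leftarrow>0 # xs. [:- x, 1:])"
    have deg: "degree P = Suc (length xs)"
      unfolding P_def by (subst degree_linear_factors) simp
    have "coeff P (degree P) = 1" unfolding P_def by (rule monic_prod_list) auto
    then have lead: "coeff P (Suc (length xs)) = 1" by (simp only: deg)
    have P0: "coeff P 0 = 0" by (simp add: P_def)
    have root: "poly P x = 0" if "x = 0 \<or> x \<in> set xs" for x
      using that unfolding P_def by (induction xs) auto
    have rel: "(\<Sum>l\<le>Suc (length xs). coeff P l * (\<Sum>e\<leftarrow>ys. e ^ (l + i))) = 0"
      if ys: "\<And>e. e \<in> set ys \<Longrightarrow> e = 0 \<or> e \<in> set xs" for ys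
    proof -
      have "(\<Sum>l\<le>Suc (length xs). coeff P l * (\<Sum>e\<leftarrow>ys. e ^ (l + i))) = (\<Sum>e\<leftarrow>ys. e ^ i * poly P e)"
        by (induction ys) (simp_all add: poly_altdef deg sum.distrib distrib_left sum_distrib_left power_add mult_ac
            del: sum.atMost_Suc)
      also have "(\<Sum>e\<leftarrow>ys. e ^ i * poly P e) = (\<Sum>e\<leftarrow>ys. 0)"
        using root ys by (intro arg_cong[where f = sum_list] map_cong) auto
      finally show ?thesis by simp
    qed
    have "(\<Sum>l\<le>length xs. coeff P l * (\<Sum>e\<leftarrow>es. e ^ (l + i))) = (\<Sum>l\<le>length xs. coeff P l * (\<Sum>e\<leftarrow>fs. e ^ (l + i)))"
    proof (intro sum.cong refl)
      fix l assume "l \<in> {..length xs}"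
      then show "coeff P l * (\<Sum>e\<leftarrow>es. e ^ (l + i)) = coeff P l * (\<Sum>e\<leftarrow>fs. e ^ (l + i))"
        using less.IH[of "l + i"] P0 k by (cases "l = 0") auto
    qed
    moreover have "(\<Sum>l\<le>Suc (length xs). coeff P l * (\<Sum>e\<leftarrow>es. e ^ (l + i))) = 0"
      "(\<Sum>l\<le>Suc (length xs). coeff P l * (\<Sum>e\<leftarrow>fs. e ^ (l + i))) = 0"
      using rel[of es] rel[of fs] supp by blast+
    ultimately show ?thesis using lead by (simp add: k)
  qed
qed

section \<open>Lexicographic minimality of the Laplacian traces\<close>

lemma walk_trace_iso:
  assumes H: "simple_graph H" and G: "simple_graph G" and iso: "graph_iso H G"
  shows "walk_trace H k = walk_trace G k"
proof -
  obtain f where f: "bij_betw f (verts H) (verts G)"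
    and e: "\<And>u v. u \<in> verts H \<Longrightarrow> v \<in> verts H \<Longrightarrow> {u, v} \<in> edges H \<longleftrightarrow> {f u, f v} \<in> edges G"
    using iso by (auto simp: graph_iso_def)
  have fV: "f u \<in> verts G" if "u \<in> verts H" for u using f that by (auto simp: bij_betw_def)
  have inj: "f u = f v \<longleftrightarrow> u = v" if "u \<in> verts H" "v \<in> verts H" for u v
    using f that by (auto simp: bij_betw_def inj_on_eq_iff)
  have degf: "deg H u = deg G (f u)" if u: "u \<in> verts H" for u
  proof -
    have "bij_betw f (nbrs H u) (nbrs G (f u))"
      unfolding bij_betw_def
    proof
      show "inj_on f (nbrs H u)" using inj by (auto simp: inj_on_def nbrs_def)
      have "f ` verts H = verts G" using f by (simp add: bij_betw_def)
      then show "f ` nbrs H u = nbrs G (f u)"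
        using e[OF u] fV by (auto simp: nbrs_def image_iff) (metis imageE)
    qed
    then show ?thesis by (simp add: deg_eq_card_nbrs H G bij_betw_same_card)
  qed
  have lapf: "lap H u v = lap G (f u) (f v)" if "u \<in> verts H" "v \<in> verts H" for u v
    using that by (simp add: lap_def inj e degf)
  have "kernel_power (verts H) (lap H) k u v = kernel_power (verts G) (lap G) k (f u) (f v)"
    if "u \<in> verts H" "v \<in> verts H" for u v
    using that(2)
  proof (induction k arbitrary: v)
    case 0
    then show ?case using inj that(1) by simp
  next
    case (Suc k)
    have "kernel_power (verts H) (lap H) (Suc k) u v
        = (\<Sum>w\<in>verts H. kernel_power (verts G) (lap G) k (f u) (f w) * lap G (f w) (f v))"
      using Suc by (simp add: lapf)
    also have "\<dots> = (\<Sum>w\<in>verts G. kernel_power (verts G) (lap G) k (f u) w * lap G w (f v))"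
      by (rule sum.reindex_bij_betw[OF f])
    finally show ?case by simp
  qed
  then have "walk_trace H k = (\<Sum>v\<in>verts H. kernel_power (verts G) (lap G) k (f v) (f v))"
    by (simp add: walk_trace_def)
  also have "\<dots> = walk_trace G k" unfolding walk_trace_def by (rule sum.reindex_bij_betw[OF f])
  finally show ?thesis .
qed

text \<open>
  Lower terms of the binomial expansion cancel.
\<close>

lemma shifted_power_sums:
  fixes es fs :: "real list"
  assumes "\<And>i. i < m \<Longrightarrow> (\<Sum>e\<leftarrow>es. e ^ i) = (\<Sum>f\<leftarrow>fs. f ^ i)"
  shows "(\<Sum>e\<leftarrow>es. (e - c) ^ m) - (\<Sum>f\<leftarrow>fs. (f - c) ^ m) = (\<Sum>e\<leftarrow>es. e ^ m) - (\<Sum>f\<leftarrow>fs. f ^ m)"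
proof -
  have expand: "(\<Sum>y\<leftarrow>ys. (y - c) ^ m) = (\<Sum>y\<leftarrow>ys. y ^ m) + (\<Sum>i<m. real (m choose i) * (- c) ^ (m - i) * (\<Sum>y\<leftarrow>ys. y ^ i))"
    for ys :: "real list"
  proof (induction ys)
    case (Cons y ys)
    have "(y - c) ^ m = (\<Sum>i\<le>m. real (m choose i) * y ^ i * (- c) ^ (m - i))"
      using binomial_ring[of y "- c" m] by simp
    also have "\<dots> = y ^ m + (\<Sum>i<m. real (m choose i) * (- c) ^ (m - i) * y ^ i)"
      by (simp add: lessThan_Suc_atMost[symmetric] mult_ac)
    finally show ?case using Cons by (simp add: distrib_left sum.distrib)
  qed simp
  show ?thesis unfolding expand using assms by simp
qed

lemma class_S_ofD:
  assumes "H \<in> class_S_of G"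
  shows "simple_graph H" "nv H = nv G" "ne H = ne G"
  using assms by (auto simp: class_S_of_def class_S_def)

lemma trace_minimal_regular:
  fixes G K :: "'b sgraph"
  assumes reg: "regular_graph d G" and n: "nv G > 0" and tm: "trace_minimal G"
    and K: "K \<in> class_R d (nv G)"
  shows "seq_preceq (adj_trace G) (adj_trace K)"
proof -
  obtain d' where d': "G \<in> class_R d' (nv G)"
    and min: "\<forall>K\<in>(class_R d' (nv G) :: 'b sgraph set). seq_preceq (adj_trace G) (adj_trace K)"
    using tm unfolding trace_minimal_def by blast
  have "verts G \<noteq> {}" using n by (auto simp: nv_def)
  then obtain v where v: "v \<in> verts G" by blast
  have "deg G v = d" using reg v by (simp add: regular_graph_def)
  moreover have "deg G v = d'" using d' v by (simp add: class_R_def regular_graph_def)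
  ultimately show ?thesis using min K by simp
qed

text \<open>
  The heart of the comparison: a graph that has all traces in common with \<open>G\<close> has a trace-minimal
  complement, and uniqueness makes it isomorphic to \<open>G\<close>; any other graph first differs from \<open>G\<close> upwards, by
  at least \<open>1\<close> because traces are integers.
\<close>

lemma trace_dichotomy:
  fixes G H :: "'b sgraph"
  assumes reg: "regular_graph d G" and n: "nv G > 0" and otm: "only_trace_minimal (complement G)"
    and H: "H \<in> class_S_of G"
  shows "graph_iso H G \<and> (\<forall>k. lap_trace H k = lap_trace G k)
    \<or> \<not> graph_iso H G \<and> (\<exists>j\<ge>1. (\<forall>k<j. lap_trace H k = lap_trace G k) \<and> lap_trace G j + 1 \<le> lap_trace H j)"
proof -
  have G: "simple_graph G" using reg by (simp add: regular_graph_def)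
  note sH = class_S_ofD[OF H]
  have tr: "lap_trace G k = of_int (walk_trace G k)" "lap_trace H k = of_int (walk_trace H k)" for k
    using lap_trace_eq_walk_trace G sH(1) by auto
  obtain es where es: "laplacian_spectrum H es" using laplacian_spectrum_exists[OF sH(1)] by blast
  obtain fs where fs: "laplacian_spectrum G fs" using laplacian_spectrum_exists[OF G] by blast
  have len: "length es = length fs" using es fs sH(2) by (simp add: laplacian_spectrum_def)
  have zero: "lap_trace H 0 = lap_trace G 0"
    using len by (simp add: lap_trace_spectrum[OF es] lap_trace_spectrum[OF fs] sum_list_triv)
  have min: "seq_preceq (adj_trace (complement G)) (adj_trace K)"
    if "K \<in> class_R (nv G - 1 - d) (nv G)" for K :: "'b sgraph"
    using trace_minimal_regular[OF complement_regular[OF reg]] n otm that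
    by (simp add: only_trace_minimal_def)
  show ?thesis
  proof (cases "\<forall>k. lap_trace H k = lap_trace G k")
    case all: True
    then have "walk_trace H 2 = walk_trace G 2" unfolding tr by (metis of_int_eq_iff)
    then have regH: "regular_graph d H"
      using irregular_walk_trace_2[OF sH(1), of d] regular_ne[OF reg] regular_walk_trace_2[OF reg] sH by force
    have "adj_trace (complement H) k = adj_trace (complement G) k" for k
      using all shifted_power_sums[of k es fs "real (d + 1)"] sH(2)
      by (simp add: adj_trace_complement[OF regH es] adj_trace_complement[OF reg fs]
          lap_trace_spectrum[OF es] lap_trace_spectrum[OF fs])
    then have adj: "adj_trace (complement H) = adj_trace (complement G)" by blast
    have cH: "regular_graph (nv G - 1 - d) (complement H)"
      using complement_regular[OF regH] sH(2) by simp
    then have "trace_minimal (complement H)"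
      unfolding trace_minimal_def adj using min sH(2)
      by (intro exI[of _ "nv G - 1 - d"]) (simp add: class_R_def)
    moreover have "complement H \<in> class_R_of (complement G)"
      using cH sH by (auto simp: class_R_of_def ne_complement[OF sH(1)] ne_complement[OF G])
    ultimately have "graph_iso (complement H) (complement G)"
      using otm by (simp add: only_trace_minimal_def)
    then have "graph_iso H G"
      using graph_iso_complement[OF complement_simple[OF sH(1)] complement_simple[OF G]]
      by (simp add: complement_complement sH(1) G)
    then show ?thesis using all by blast
  next
    case False
    then have noniso: "\<not> graph_iso H G" using walk_trace_iso[OF sH(1) G] by (auto simp: tr)
    define j where "j = (LEAST k. lap_trace H k \<noteq> lap_trace G k)"
    have j: "lap_trace H j \<noteq> lap_trace G j" unfolding j_def by (rule LeastI_ex) (use False in blast)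
    have below: "lap_trace H k = lap_trace G k" if "k < j" for k
      using not_less_Least[of k "\<lambda>k. lap_trace H k \<noteq> lap_trace G k"] that by (auto simp: j_def)
    have j1: "1 \<le> j" using j zero by (cases j) auto
    have "lap_trace G j < lap_trace H j"
    proof (cases "regular_graph d H")
      case irr: False
      have "walk_trace G 2 < walk_trace H 2"
        using irregular_walk_trace_2[OF sH(1) _ irr] regular_ne[OF reg] regular_walk_trace_2[OF reg] sH by simp
      moreover have "lap_trace H 1 = lap_trace G 1"
        unfolding tr walk_trace_1[OF G] walk_trace_1[OF sH(1)] sH(3) ..
      then have "2 \<le> j" using j zero by (cases "j = 0"; cases "j = 1") auto
      ultimately have "j = 2" using below[of 2] tr by (cases "j = 2") auto
      then show ?thesis using \<open>walk_trace G 2 < walk_trace H 2\<close> tr by simp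
    next
      case regH: True
      have adjk: "adj_trace (complement H) k - adj_trace (complement G) k = lap_trace H k - lap_trace G k"
        if "k \<le> j" for k
        using below that shifted_power_sums[of k es fs "real (d + 1)"] sH(2)
        by (simp add: adj_trace_complement[OF regH es] adj_trace_complement[OF reg fs]
            lap_trace_spectrum[OF es] lap_trace_spectrum[OF fs])
      have "regular_graph (nv G - 1 - d) (complement H)"
        using complement_regular[OF regH] sH(2) by simp
      then have "seq_preceq (adj_trace (complement G)) (adj_trace (complement H))"
        using sH(2) by (intro min) (simp add: class_R_def)
      then consider "adj_trace (complement G) j = adj_trace (complement H) j"
        | i where "1 \<le> i" "\<And>k. 1 \<le> k \<Longrightarrow> k < i \<Longrightarrow> adj_trace (complement G) k \<le> adj_trace (complement H) k"
          "adj_trace (complement G) i < adj_trace (complement H) i"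
        unfolding seq_preceq_def using j1 by fastforce
      then show ?thesis
      proof cases
        case 1
        then show ?thesis using adjk[of j] j by simp
      next
        case 2
        consider "i < j" | "i = j" | "j < i" by linarith
        then show ?thesis
        proof cases
          case 1
          then show ?thesis using 2(3) adjk[of i] below[of i] by simp
        next
          case b: 2
          then show ?thesis using 2(3) adjk[of j] by simp
        next
          case 3
          then show ?thesis using 2(2)[OF j1] adjk[of j] j by simp
        qed
      qed
    qed
    then have "walk_trace G j + 1 \<le> walk_trace H j" unfolding tr by simp
    then have "real_of_int (walk_trace G j + 1) \<le> real_of_int (walk_trace H j)"
      by (simp only: of_int_le_iff)
    then have "lap_trace G j + 1 \<le> lap_trace H j" by (simp add: tr)
    then show ?thesis using noniso j1 below by blast
  qed
qed

text \<open>
  The minimum of each trace over the refined class is attained at \<open>G\<close>.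
\<close>

lemma class_S_iter_eq:
  fixes G :: "'b sgraph"
  assumes reg: "regular_graph d G" and n: "nv G > 0" and otm: "only_trace_minimal (complement G)"
  shows "class_S_iter_of G (Suc k)
    = {H \<in> class_S_of G. \<forall>i. 1 \<le> i \<and> i \<le> Suc k \<longrightarrow> lap_trace H i = lap_trace G i}"
proof (induction k)
  case 0
  have G: "simple_graph G" using reg by (simp add: regular_graph_def)
  have "lap_trace H i = lap_trace G i" if "H \<in> class_S_of G" "1 \<le> i" "i \<le> Suc 0" for H i
  proof -
    have i: "i = 1" using that by simp
    show ?thesis using class_S_ofD[OF that(1)] G
      unfolding i by (simp add: lap_trace_eq_walk_trace walk_trace_1 del: One_nat_def)
  qed
  then show ?case by (auto simp: class_S_iter_of_def class_S_of_def)
next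
  case (Suc k)
  let ?C = "class_S_iter_of G (Suc k)"
  have G: "G \<in> ?C" using reg by (auto simp: Suc class_S_of_def class_S_def regular_graph_def)
  have least: "lap_trace G (Suc (Suc k)) \<le> lap_trace H (Suc (Suc k))" if "H \<in> ?C" for H
  proof -
    have H: "H \<in> class_S_of G" "\<And>i. 1 \<le> i \<Longrightarrow> i \<le> Suc k \<Longrightarrow> lap_trace H i = lap_trace G i"
      using that by (auto simp: Suc)
    from trace_dichotomy[OF reg n otm H(1)] show ?thesis
    proof (elim disjE conjE exE)
      fix j assume j: "1 \<le> j" "\<forall>k<j. lap_trace H k = lap_trace G k" "lap_trace G j + 1 \<le> lap_trace H j"
      then have "Suc k < j" using H(2)[of j] by (cases "j \<le> Suc k") auto
      then show ?thesis using j(2,3) by (cases "j = Suc (Suc k)") auto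
    qed simp
  qed
  have "class_S_iter_of G (Suc (Suc k)) = {X \<in> ?C. \<forall>H\<in>?C. lap_trace X (Suc (Suc k)) \<le> lap_trace H (Suc (Suc k))}"
    by (simp add: class_S_iter_of_def)
  also have "\<dots> = {X \<in> ?C. lap_trace X (Suc (Suc k)) = lap_trace G (Suc (Suc k))}"
    using G least by (auto intro: antisym)
  also have "\<dots> = {H \<in> class_S_of G. \<forall>i. 1 \<le> i \<and> i \<le> Suc (Suc k) \<longrightarrow> lap_trace H i = lap_trace G i}"
    unfolding Suc by (auto simp: le_Suc_eq)
  finally show ?case .
qed

section \<open>Optimality of the complement\<close>

text \<open>
  Every graph in the class of the complement of \<open>G\<close> is itself the complement of a graph in the class
  of \<open>G\<close>.
\<close>

lemma only_t_optimal_complementI: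
  fixes G :: "'b sgraph"
  assumes G: "simple_graph G"
    and cmp: "\<And>H :: 'b sgraph. H \<in> class_S_of G \<Longrightarrow>
      graph_iso H G \<and> num_spanning_trees (complement H) \<le> num_spanning_trees (complement G)
      \<or> num_spanning_trees (complement H) < num_spanning_trees (complement G)"
  shows "only_t_optimal (complement G)"
proof -
  have co: "complement X \<in> class_S_of G" "complement (complement X) = X" "simple_graph X"
    if X: "X \<in> class_S_of (complement G)" for X :: "'b sgraph"
  proof -
    note sX = class_S_ofD[OF X]
    show "complement X \<in> class_S_of G"
      using sX ne_complement[OF sX(1)] ne_complement[OF G] ne_le_choose[OF G]
      by (simp add: class_S_of_def class_S_def complement_simple)
    show "complement (complement X) = X" "simple_graph X"
      using sX(1) complement_complement by auto
  qed
  have opt: "t_optimal (complement G)"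
    unfolding t_optimal_def
  proof (intro conjI ballI)
    fix X :: "'b sgraph" assume X: "X \<in> class_S_of (complement G)"
    show "num_spanning_trees X \<le> num_spanning_trees (complement G)"
      using cmp[OF co(1)[OF X]] co(2)[OF X] by auto
  qed (rule complement_simple[OF G])
  have "graph_iso X (complement G)" if X: "X \<in> class_S_of (complement G)" "t_optimal X" for X :: "'b sgraph"
  proof -
    have "complement G \<in> class_S_of X"
      using class_S_ofD[OF X(1)] complement_simple[OF G] by (simp add: class_S_of_def class_S_def)
    then have "num_spanning_trees (complement G) \<le> num_spanning_trees X"
      using X(2) by (simp add: t_optimal_def)
    then have "graph_iso (complement X) G" using cmp[OF co(1)[OF X(1)]] co(2)[OF X(1)] by auto
    then show ?thesis
      using graph_iso_complement[OF complement_simple[OF co(3)[OF X(1)]] G] co(2)[OF X(1)] by simp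
  qed
  then show ?thesis using opt by (simp add: only_t_optimal_def)
qed

lemma spanning_trees_comparison:
  fixes G0 :: "'a sgraph" and d p :: nat
  defines "G \<equiv> add_cliques G0 d p"
  assumes reg0: "regular_graph d G0" and large: "nv G > 2 * d" and H: "H \<in> class_S_of G"
  shows "(\<And>k. lap_trace H k = lap_trace G k) \<Longrightarrow>
      num_spanning_trees (complement H) \<le> num_spanning_trees (complement G)"
    and "1 \<le> j \<Longrightarrow> (\<And>k. k < j \<Longrightarrow> lap_trace H k = lap_trace G k) \<Longrightarrow>
      lap_trace G j + 1 \<le> lap_trace H j \<Longrightarrow> nv G \<ge> 2 * d + nv G0 * (2 * d) ^ (j + 1) \<Longrightarrow>
      num_spanning_trees (complement H) < num_spanning_trees (complement G)"
proof -
  let ?n = "real (nv G)"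
  have reg: "regular_graph d G" unfolding G_def by (rule add_cliques_regular[OF reg0])
  have G0: "simple_graph G0" and G: "simple_graph G" using reg0 reg by (auto simp: regular_graph_def)
  note sH = class_S_ofD[OF H]
  obtain es where es: "laplacian_spectrum H es" using laplacian_spectrum_exists[OF sH(1)] by blast
  obtain fs where fs: "laplacian_spectrum G fs" using laplacian_spectrum_exists[OF G] by blast
  obtain hs where hs: "laplacian_spectrum G0 hs" using laplacian_spectrum_exists[OF G0] by blast
  note trH = lap_trace_spectrum[OF es] and trG = lap_trace_spectrum[OF fs]
  have n: "nv G > 0" using large by simp
  have len: "length es = length fs" using es fs sH(2) by (simp add: laplacian_spectrum_def)
  have es_b: "0 \<le> e \<and> e \<le> ?n" if "e \<in> set es" for e
    using es that sH(2) by (auto simp: laplacian_spectrum_def)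
  have fs_b: "0 \<le> f \<and> f < ?n" if "f \<in> set fs" for f
  proof -
    have "0 \<le> f" "f \<le> 2 * real d" using fs that reg unfolding laplacian_spectrum_def by blast+
    then show ?thesis using large by linarith
  qed
  have hs_b: "0 \<le> h \<and> h \<le> 2 * real d" if "h \<in> set hs" for h
    using hs that reg0 unfolding laplacian_spectrum_def by blast
  let ?k = "(det (spread_mat (nv G)))\<^sup>2"
  have k: "?k > 0" using det_spread_mat_nonzero by simp
  have tH: "?k * real (num_spanning_trees (complement H)) = (\<Prod>e\<leftarrow>es. ?n - e)"
    using spanning_trees_complement[OF sH(1) _ es] sH(2) n by simp
  have tG: "?k * real (num_spanning_trees (complement G)) = (\<Prod>f\<leftarrow>fs. ?n - f)"
    using spanning_trees_complement[OF G n fs] .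
  show "num_spanning_trees (complement H) \<le> num_spanning_trees (complement G)"
    if "\<And>k. lap_trace H k = lap_trace G k"
  proof -
    have "(\<Prod>e\<leftarrow>es. ?n - e) \<le> (\<Prod>f\<leftarrow>fs. ?n - f)"
      using n len es_b fs_b that by (intro prod_le_of_equal_power_sums) (auto simp: trH trG)
    then show ?thesis unfolding tH[symmetric] tG[symmetric] using k by simp
  qed
  \<comment> \<open>convexity bounds \<open>\<ell>(H)\<close> from below by what cliques on all \<open>n\<close> vertices would give\<close>
  have tail: "lap_trace G (Suc k) - real (nv G0) / 2 * (2 * real d) ^ Suc k \<le> lap_trace H (Suc k)" for k
  proof -
    have neG: "real (2 * ne G) = ?n * real d" using regular_ne[OF reg] by simp
    have S1: "sum_list es = ?n * real d"
      using trH[of 1] lap_trace_eq_walk_trace[OF sH(1), of 1] walk_trace_1[OF sH(1)] sH(3) neG by simp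
    have "int (nv G * d * (d + 1)) \<le> walk_trace H 2"
    proof (cases "regular_graph d H")
      case True
      then show ?thesis using regular_walk_trace_2[OF True] sH(2) by simp
    next
      case False
      then show ?thesis using irregular_walk_trace_2[OF sH(1) _ False] sH regular_ne[OF reg] by simp
    qed
    then have "real_of_int (int (nv G * d * (d + 1))) \<le> lap_trace H 2"
      unfolding lap_trace_eq_walk_trace[OF sH(1)] by (simp only: of_int_le_iff)
    then have "(real d + 1) * sum_list es \<le> (\<Sum>e\<leftarrow>es. e ^ 2)"
      by (simp add: trH S1 algebra_simps)
    then have low: "(real d + 1) ^ k * (?n * real d) \<le> lap_trace H (Suc k)"
      using power_sum_lower_bound[of "real d + 1" es k] es_b by (simp add: trH S1)
    have neG0: "real (2 * ne G0) = real (nv G0) * real d" using regular_ne[OF reg0] by simp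
    have S0: "sum_list hs = real (nv G0) * real d"
      using lap_trace_spectrum[OF hs, of 1] lap_trace_eq_walk_trace[OF G0, of 1] walk_trace_1[OF G0] neG0 by simp
    have "real_of_int (walk_trace G0 (Suc k)) \<le> (2 * real d) ^ k * (real (nv G0) * real d)"
      using power_sum_upper_bound[of hs "2 * real d" k] hs_b lap_trace_spectrum[OF hs, of "Suc k"]
      by (simp add: lap_trace_eq_walk_trace[OF G0] S0)
    also have "\<dots> = real (nv G0) / 2 * (2 * real d) ^ Suc k" by simp
    finally have up0: "real_of_int (walk_trace G0 (Suc k)) \<le> real (nv G0) / 2 * (2 * real d) ^ Suc k" .
    have "lap_trace G (Suc k) = real_of_int (walk_trace G0 (Suc k)) + real (p * d * (d + 1) ^ Suc k)"
      unfolding lap_trace_eq_walk_trace[OF G] unfolding G_def walk_trace_add_cliques[OF G0] by simp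
    moreover have "real (p * d * (d + 1) ^ Suc k) \<le> (real d + 1) ^ k * (?n * real d)"
    proof -
      have "p * (d + 1) \<le> nv G" unfolding G_def nv_add_cliques[OF G0] by simp
      then have "(d + 1) ^ k * (p * (d + 1) * d) \<le> (d + 1) ^ k * (nv G * d)" by (intro mult_le_mono) auto
      then have "real ((d + 1) ^ k * (p * (d + 1) * d)) \<le> real ((d + 1) ^ k * (nv G * d))"
        by (simp only: of_nat_le_iff)
      then show ?thesis by (simp add: algebra_simps)
    qed
    ultimately show ?thesis using up0 low by linarith
  qed
  show "num_spanning_trees (complement H) < num_spanning_trees (complement G)"
    if j: "1 \<le> j" and eq: "\<And>k. k < j \<Longrightarrow> lap_trace H k = lap_trace G k"
      and gap: "lap_trace G j + 1 \<le> lap_trace H j" and ge: "nv G \<ge> 2 * d + nv G0 * (2 * d) ^ (j + 1)"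
  proof -
    have "(\<Prod>e\<leftarrow>es. ?n - e) < (\<Prod>f\<leftarrow>fs. ?n - f)"
    proof (rule prod_less_of_power_sums[where a = "real (nv G0)" and b = "2 * real d" and j = j])
      show "2 * real d < ?n" using large by linarith
      have "real (2 * d + nv G0 * (2 * d) ^ (j + 1)) \<le> ?n" using ge by (simp only: of_nat_le_iff)
      then show "2 * real d + real (nv G0) * (2 * real d) ^ (j + 1) \<le> ?n" by simp
      show "(\<Sum>f\<leftarrow>fs. f ^ k) - real (nv G0) / 2 * (2 * real d) ^ k \<le> (\<Sum>e\<leftarrow>es. e ^ k)" if "j < k" for k
        using tail[of "k - 1"] that by (simp add: trH trG)
    qed (use j eq gap len es_b fs_b in \<open>auto simp: trH trG\<close>)
    then show ?thesis unfolding tH[symmetric] tG[symmetric] using k by simp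
  qed
qed

lemma no_edges_no_spanning_trees:
  assumes "edges X = {}" "u \<in> verts X" "v \<in> verts X" "u \<noteq> v"
  shows "num_spanning_trees X = 0"
proof -
  have "\<not> connected_graph \<lparr>verts = verts X, edges = {}\<rparr>"
  proof
    assume "connected_graph \<lparr>verts = verts X, edges = {}\<rparr>"
    then have "(u, v) \<in> {}\<^sup>*" using assms(2,3) by (fastforce simp: connected_graph_def)
    then show False using assms(4) by simp
  qed
  then have "{T. T \<subseteq> edges X \<and> is_tree \<lparr>verts = verts X, edges = T\<rparr>} = {}"
    using assms(1) by (auto simp: is_tree_def)
  then show ?thesis by (simp only: num_spanning_trees_def card.empty)
qed

lemma no_edges_iso:
  assumes "edges X = {}" "edges Y = {}" "finite (verts X)" "finite (verts Y)" "nv X = nv Y"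
  shows "graph_iso X Y"
  using finite_same_card_bij[OF assms(3,4)] assms(1,2,5) by (auto simp: graph_iso_def nv_def)

text \<open>
  The case \<open>n = 2d\<close>, in which \<open>n\<close> is an eigenvalue of \<open>G\<close> and the complement has no spanning tree.
\<close>

lemma two_vertices_one_edge:
  assumes G: "simple_graph G" "nv G = 2" "ne G = 1" and H: "H \<in> class_S_of G"
  shows "graph_iso H G \<and> num_spanning_trees (complement H) \<le> num_spanning_trees (complement G)"
proof -
  note sH = class_S_ofD[OF H]
  have empty: "edges (complement X) = {}" if X: "simple_graph X" "nv X = 2" "ne X = 1" for X :: "'a sgraph"
  proof -
    have "finite (verts X)" using X(1) by (simp add: simple_graph_def)
    then have "finite (edges (complement X))" by (simp add: complement_def all_pairs_def)
    moreover have "card (edges (complement X)) = 0"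
      using ne_complement[OF X(1)] X(2,3) by (simp add: ne_def)
    ultimately show ?thesis by simp
  qed
  have eG: "edges (complement G) = {}" and eH: "edges (complement H) = {}"
    using empty G sH by auto
  have "graph_iso (complement H) (complement G)"
    using sH G(1) by (intro no_edges_iso) (auto simp: eG eH simple_graph_def)
  then have "graph_iso H G"
    using graph_iso_complement[OF complement_simple[OF sH(1)] complement_simple[OF G(1)]]
    by (simp add: complement_complement sH(1) G(1))
  moreover have "card (verts H) = 2" using sH(2) G(2) by (simp add: nv_def)
  then obtain u v where "verts H = {u, v}" "u \<noteq> v" unfolding card_2_iff by blast
  then have "num_spanning_trees (complement H) = 0"
    using no_edges_no_spanning_trees[OF eH, of u v] by simp
  ultimately show ?thesis by simp
qed

lemma only_t_optimal_of_iter_bound: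
  fixes G0 :: "'a sgraph" and d p c :: nat
  defines "G \<equiv> add_cliques G0 d p"
  assumes reg0: "regular_graph d G0" and p: "p > 0" and otm: "only_trace_minimal (complement G)"
    and iter: "\<And>H. H \<in> class_S_of G \<Longrightarrow> \<not> graph_iso H G \<Longrightarrow> H \<notin> class_S_iter_of G (c + 1)"
    and large: "nv G \<ge> 2 * d + nv G0 * (2 * d) ^ (c + 2)"
  shows "only_t_optimal (complement G)"
proof -
  have reg: "regular_graph d G" unfolding G_def by (rule add_cliques_regular[OF reg0])
  have G0: "simple_graph G0" and G: "simple_graph G" using reg0 reg by (auto simp: regular_graph_def)
  have nG: "nv G = nv G0 + p * (d + 1)" unfolding G_def by (rule nv_add_cliques[OF G0])
  then have n: "nv G > 0" using p by simp
  show ?thesis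
  proof (cases "nv G > 2 * d")
    case True
    note compare = spanning_trees_comparison[OF reg0, where p = p, folded G_def, OF True]
    show ?thesis
    proof (rule only_t_optimal_complementI[OF G])
      fix H assume H: "H \<in> class_S_of G"
      from trace_dichotomy[OF reg n otm H]
      show "graph_iso H G \<and> num_spanning_trees (complement H) \<le> num_spanning_trees (complement G)
        \<or> num_spanning_trees (complement H) < num_spanning_trees (complement G)"
      proof (elim disjE conjE exE)
        assume "graph_iso H G" "\<forall>k. lap_trace H k = lap_trace G k"
        then show ?thesis using compare(1)[OF H] by blast
      next
        fix j assume noniso: "\<not> graph_iso H G" and j: "1 \<le> j" "\<forall>k<j. lap_trace H k = lap_trace G k"
          "lap_trace G j + 1 \<le> lap_trace H j"
        have "j \<le> c + 1"
        proof (rule ccontr)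
          assume "\<not> j \<le> c + 1"
          then have "H \<in> class_S_iter_of G (Suc c)"
            using class_S_iter_eq[OF reg n otm, of c] H j(2) by auto
          then show False using iter[OF H noniso] by simp
        qed
        then have "(2 * d) ^ (j + 1) \<le> (2 * d) ^ (c + 2)"
          by (cases "d = 0") (simp, rule power_increasing, simp_all)
        then have "nv G0 * (2 * d) ^ (j + 1) \<le> nv G0 * (2 * d) ^ (c + 2)" by (rule mult_le_mono2)
        then have "nv G \<ge> 2 * d + nv G0 * (2 * d) ^ (j + 1)" using large by linarith
        then show ?thesis using compare(2)[OF H j(1) _ j(3)] j(2) by blast
      qed
    qed
  next
    \<comment> \<open>then \<open>G\<close> is a single edge\<close>
    case False
    then have n2: "nv G = 2 * d" and z: "nv G0 * (2 * d) ^ (c + 2) = 0" using large by linarith+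
    have "d > 0" using n n2 by simp
    then have "nv G0 = 0" using z by simp
    then have pd: "p * (d + 1) = 2 * d" using nG n2 by simp
    have "p = 1"
    proof (rule ccontr)
      assume "p \<noteq> 1"
      then have "2 \<le> p" using p by simp
      then have "2 * (d + 1) \<le> p * (d + 1)" by (rule mult_le_mono1)
      then show False using pd by simp
    qed
    then have "d = 1" using pd by simp
    then have "nv G = 2" "ne G = 1" using n2 regular_ne[OF reg] by auto
    then show ?thesis
      using two_vertices_one_edge[OF G] by (intro only_t_optimal_complementI[OF G]) blast
  qed
qed

text \<open>
  With \<open>q(x) = x (x - (d + 1))\<^sup>2\<close>, the cliques contribute nothing to the sum of \<open>q\<close> over the eigenvalues, so
  this sum bounds the number of eigenvalues other than \<open>0\<close> and \<open>d + 1\<close> independently of \<open>p\<close>.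
\<close>

lemma iter_bound_exists:
  fixes G0 :: "'a sgraph" and d :: nat
  assumes reg0: "regular_graph d G0"
    and otm: "\<And>p. p > 0 \<Longrightarrow> only_trace_minimal (complement (add_cliques G0 d p))"
  shows "\<exists>c. \<forall>p>0. \<forall>H\<in>class_S_of (add_cliques G0 d p). \<not> graph_iso H (add_cliques G0 d p) \<longrightarrow>
    H \<notin> class_S_iter_of (add_cliques G0 d p) (c + 1)"
proof -
  have G0: "simple_graph G0" using reg0 by (simp add: regular_graph_def)
  define r :: int where "r = int d + 1"
  define B where "B = walk_trace G0 3 - 2 * r * walk_trace G0 2 + r\<^sup>2 * walk_trace G0 1"
  \<comment> \<open>at most \<open>B\<close> exceptional eigenvalues for each graph, and \<open>d + 1\<close>; the \<open>3\<close> also secures the traces up to the third\<close>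
  define c where "c = 2 * nat B + 3"
  have "graph_iso H (add_cliques G0 d p)"
    if p: "p > 0" and H: "H \<in> class_S_of (add_cliques G0 d p)"
      and it: "H \<in> class_S_iter_of (add_cliques G0 d p) (c + 1)" for p H
  proof -
    define G where "G = add_cliques G0 d p"
    have reg: "regular_graph d G" unfolding G_def by (rule add_cliques_regular[OF reg0])
    have G: "simple_graph G" using reg by (simp add: regular_graph_def)
    have n: "nv G > 0" using p unfolding G_def nv_add_cliques[OF G0] by simp
    have H: "H \<in> class_S_of G" using H by (simp add: G_def)
    note sH = class_S_ofD[OF H]
    have eq: "lap_trace H i = lap_trace G i" if "1 \<le> i" "i \<le> c + 1" for i
      using it that class_S_iter_eq[OF reg n otm[OF p, folded G_def], of c] by (simp add: G_def)
    obtain es where es: "laplacian_spectrum H es" using laplacian_spectrum_exists[OF sH(1)] by blast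
    obtain fs where fs: "laplacian_spectrum G fs" using laplacian_spectrum_exists[OF G] by blast
    note trH = lap_trace_spectrum[OF es] and trG = lap_trace_spectrum[OF fs]
    have q: "(\<Sum>y\<leftarrow>ys. y * (y - of_int r)\<^sup>2)
        = (\<Sum>y\<leftarrow>ys. y ^ 3) - 2 * of_int r * (\<Sum>y\<leftarrow>ys. y ^ 2) + (of_int r)\<^sup>2 * (\<Sum>y\<leftarrow>ys. y ^ 1)"
      for ys :: "real list"
      by (induction ys) (simp_all add: power2_eq_square power3_eq_cube algebra_simps)
    have w: "walk_trace G (Suc k) = walk_trace G0 (Suc k) + int p * int d * r ^ Suc k" for k
      unfolding G_def walk_trace_add_cliques[OF G0] by (simp add: r_def algebra_simps)
    have "walk_trace G 3 - 2 * r * walk_trace G 2 + r\<^sup>2 * walk_trace G 1 = B"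
      using w[of 0] w[of 1] w[of 2] by (simp add: B_def power2_eq_square power3_eq_cube numeral_2_eq_2 numeral_3_eq_3 algebra_simps)
    from arg_cong[OF this, of real_of_int]
    have BG: "lap_trace G 3 - 2 * of_int r * lap_trace G 2 + (of_int r)\<^sup>2 * lap_trace G 1 = of_int B"
      unfolding lap_trace_eq_walk_trace[OF G] by simp
    have BH: "lap_trace H 3 - 2 * of_int r * lap_trace H 2 + (of_int r)\<^sup>2 * lap_trace H 1 = of_int B"
      using BG eq[of 1] eq[of 2] eq[of 3] by (simp add: c_def)
    let ?ex = "filter (\<lambda>e. e \<noteq> 0 \<and> e \<noteq> real_of_int r)"
    have bound: "length (?ex ys) \<le> nat B"
      if ys: "laplacian_spectrum X ys"
        and sum: "lap_trace X 3 - 2 * of_int r * lap_trace X 2 + (of_int r)\<^sup>2 * lap_trace X 1 = of_int B"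
      for X :: "('a + nat \<times> nat) sgraph" and ys
    proof -
      have "real (length (?ex ys)) \<le> (\<Sum>y\<leftarrow>ys. y * (y - of_int r)\<^sup>2)"
        using ys by (intro exceptional_roots_bound) (auto simp: laplacian_spectrum_def)
      also have "\<dots> = of_int B" unfolding q using sum by (simp add: lap_trace_spectrum[OF ys])
      finally show ?thesis by linarith
    qed
    define xs where "xs = ?ex es @ of_int r # ?ex fs"
    have len: "length xs \<le> c + 1" using bound[OF es BH] bound[OF fs BG] by (simp add: xs_def c_def)
    have "lap_trace H k = lap_trace G k" if "1 \<le> k" for k
      unfolding trH trG
    proof (rule power_sums_eq_of_initial[where xs = xs])
      show "(\<Sum>e\<leftarrow>es. e ^ i) = (\<Sum>f\<leftarrow>fs. f ^ i)" if "1 \<le> i" "i \<le> length xs" for i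
        using eq[of i] that len by (simp add: trH trG)
    qed (use that in \<open>auto simp: xs_def\<close>)
    then show ?thesis
      using trace_dichotomy[OF reg n otm[OF p, folded G_def] H] by (fastforce simp: G_def)
  qed
  then show ?thesis by blast
qed

theorem theorem22:
  fixes G0 :: "'a sgraph" and d :: nat
  assumes "regular_graph d G0"
    and "\<And>p. p > 0 \<Longrightarrow> only_trace_minimal (complement (add_cliques G0 d p))"
  shows "(\<exists>n0>0. \<forall>p>0. nv (add_cliques G0 d p) \<ge> n0 \<longrightarrow>
            only_t_optimal (complement (add_cliques G0 d p)))
       \<and> (\<forall>c>0. (\<forall>p>0. \<forall>H\<in>class_S_of (add_cliques G0 d p).
                     \<not> graph_iso H (add_cliques G0 d p) \<longrightarrow>
                     H \<notin> class_S_iter_of (add_cliques G0 d p) (c + 1)) \<longrightarrow>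
            (\<forall>p>0. nv (add_cliques G0 d p) \<ge> 2 * d + nv G0 * (2 * d) ^ (c + 2) \<longrightarrow>
                     only_t_optimal (complement (add_cliques G0 d p))))"
proof
  obtain c where c: "\<forall>p>0. \<forall>H\<in>class_S_of (add_cliques G0 d p). \<not> graph_iso H (add_cliques G0 d p) \<longrightarrow>
      H \<notin> class_S_iter_of (add_cliques G0 d p) (c + 1)"
    using iter_bound_exists[OF assms] by blast
  have "only_t_optimal (complement (add_cliques G0 d p))"
    if "p > 0" "Suc (2 * d + nv G0 * (2 * d) ^ (c + 2)) \<le> nv (add_cliques G0 d p)" for p
    using only_t_optimal_of_iter_bound[OF assms(1) that(1) assms(2)[OF that(1)], of c] c that by simp
  then show "\<exists>n0>0. \<forall>p>0. nv (add_cliques G0 d p) \<ge> n0 \<longrightarrow>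
      only_t_optimal (complement (add_cliques G0 d p))"
    by blast
next
  show "\<forall>c>0. (\<forall>p>0. \<forall>H\<in>class_S_of (add_cliques G0 d p).
                     \<not> graph_iso H (add_cliques G0 d p) \<longrightarrow>
                     H \<notin> class_S_iter_of (add_cliques G0 d p) (c + 1)) \<longrightarrow>
            (\<forall>p>0. nv (add_cliques G0 d p) \<ge> 2 * d + nv G0 * (2 * d) ^ (c + 2) \<longrightarrow>
                     only_t_optimal (complement (add_cliques G0 d p)))"
    using only_t_optimal_of_iter_bound[OF assms(1) _ assms(2)] by blast
qed

end
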